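(* Let $n\ge 1$ be an integer. If $0<p_1<p_2\le n$, then $$\mathcal{N}_{p_1}\subsetneq\mathcal{N}_{p_2}\subsetneq A^{-\frac{n+1}{2}}.$$
   Context: $\mathbb{B}$ is the open unit ball of $\mathbb{C}^n$ and $\mathcal{O}(\mathbb{B})$ is the space of holomorphic functions on $\mathbb{B}$. $dV$ is the normalized volume measure on $\mathbb{B}$. For $a\in\mathbb{B}$, $\Phi_a$ is the involutive automorphism of $\mathbb{B}$ interchanging $0$ and $a$: $\Phi_0(z)=-z$ and, for $a\neq0$, $\Phi_a(z)=\frac{a-P_az-\sqrt{1-|a|^2}\,(z-P_az)}{1-\langle z,a\rangle}$, where $P_a$ is the orthogonal projection of $\mathbb{C}^n$ onto $\mathbb{C}a$ and $\langle\cdot,\cdot\rangle$ is the standard Hermitian inner product (linear in the first variable). For $p>0$, $\mathcal{N}_p$ is the space of all $f\in\mathcal{O}(\mathbb{B})$ with $\|f\|_p=\sup_{a\in\mathbb{B}}\left(\int_{\mathbb{B}}|f(z)|^2(1-|\Phi_a(z)|^2)^p\,dV(z)\right)^{1/2}<\infty$. For $q>0$, $A^{-q}$ is the space of all $f\in\mathcal{O}(\mathbb{B})$ with $\sup_{z\in\mathbb{B}}|f(z)|(1-|z|^2)^q<\infty$. *)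

theory Defs
  imports "HOL-Analysis.Analysis"
begin

text \<open>
  The space $\mathbf{C}^n$ is rendered as \<open>complex ^ 'n\<close>, whose library norm is the Euclidean
  (Hermitian) norm, so \<open>ball 0 1\<close> is the open unit ball.
\<close>

definition hinner :: "complex ^ 'n \<Rightarrow> complex ^ 'n \<Rightarrow> complex" where
  "hinner z w = (\<Sum>i\<in>UNIV. z $ i * cnj (w $ i))"

text \<open>
  Holomorphy in several variables: the real Frechet derivative exists and is complex linear.
  Intended for open sets only.
\<close>

definition cn_holomorphic_on :: "(complex ^ 'n \<Rightarrow> complex) \<Rightarrow> (complex ^ 'n) set \<Rightarrow> bool" where
  "cn_holomorphic_on f S \<longleftrightarrow>
     (\<forall>z\<in>S. \<exists>D. (f has_derivative D) (at z) \<and> (\<forall>c v. D (c *s v) = c * D v))"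

definition cproj :: "complex ^ 'n \<Rightarrow> complex ^ 'n \<Rightarrow> complex ^ 'n" where
  "cproj a z = (hinner z a / hinner a a) *s a"

definition ball_aut :: "complex ^ 'n \<Rightarrow> complex ^ 'n \<Rightarrow> complex ^ 'n" where
  "ball_aut a z =
     (if a = 0 then - z
      else (1 / (1 - hinner z a)) *s
             (a - cproj a z - sqrt (1 - (norm a)\<^sup>2) *\<^sub>R (z - cproj a z)))"

definition ball_vol :: "(complex ^ 'n) measure" where
  "ball_vol = uniform_measure lborel (ball 0 1)"

definition ennsqrt :: "ennreal \<Rightarrow> ennreal" where
  "ennsqrt x = (if x = \<infinity> then \<infinity> else ennreal (sqrt (enn2real x)))"

text \<open>
  The norms take values in \<open>[0, \<infinity>]\<close>. Functions on the ball are represented by total functions.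
  The integrand is cut off to the ball because the values of \<open>f\<close> outside it, which are irrelevant,
  need not be measurable.
\<close>

definition Np_norm :: "real \<Rightarrow> (complex ^ 'n \<Rightarrow> complex) \<Rightarrow> ennreal" where
  "Np_norm p f =
     (SUP a\<in>ball 0 1. ennsqrt
        (\<integral>\<^sup>+z\<in>ball 0 1. ennreal ((cmod (f z))\<^sup>2 * (1 - (norm (ball_aut a z))\<^sup>2) powr p) \<partial>ball_vol))"

definition Np_space :: "real \<Rightarrow> (complex ^ 'n \<Rightarrow> complex) set" where
  "Np_space p = {f. cn_holomorphic_on f (ball 0 1) \<and> Np_norm p f < \<infinity>}"

text \<open>\<open>growth_space q\<close> is $A^{-q}$.\<close>

definition growth_norm :: "real \<Rightarrow> (complex ^ 'n \<Rightarrow> complex) \<Rightarrow> ennreal" where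
  "growth_norm q f = (SUP z\<in>ball 0 1. ennreal (cmod (f z) * (1 - (norm z)\<^sup>2) powr q))"

definition growth_space :: "real \<Rightarrow> (complex ^ 'n \<Rightarrow> complex) set" where
  "growth_space q = {f. cn_holomorphic_on f (ball 0 1) \<and> growth_norm q f < \<infinity>}"

end

theory Submission
  imports Defs "HOL-Complex_Analysis.Complex_Analysis"
begin

text \<open>
  Let \<open>n\<close> be the dimension. Everything starts from the identity
  \<open>1 - |\<Phi>\<^sub>a(z)|\<^sup>2 = (1 - |a|\<^sup>2) (1 - |z|\<^sup>2) / |1 - \<langle>z,a\<rangle>|\<^sup>2\<close> (\<open>one_minus_norm_ball_aut\<close>). Its value lies
  between \<open>0\<close> and \<open>1\<close>, so a larger exponent makes the integrals in the norm of \<open>\<N>\<^sub>p\<close> smaller: the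
  spaces increase with \<open>p\<close> (\<open>Np_space_mono\<close>). The same quantity is bounded below on an ellipsoid
  around \<open>a\<close> whose volume is a multiple of \<open>(1 - |a|\<^sup>2)\<^bsup>n+1\<^esup>\<close>; the sub-mean-value inequality for
  \<open>|f|\<^sup>2\<close> on this ellipsoid bounds \<open>|f(a)|\<^sup>2 (1 - |a|\<^sup>2)\<^bsup>n+1\<^esup>\<close> by the squared norm of \<open>f\<close>, which is
  the second inclusion (\<open>Np_space_subset_growth_space\<close>).

  Both inclusions are strict because of one family of functions. For \<open>p > 0\<close> and \<open>q = (p + 1) / 2\<close>
  the lacunary series \<open>f = \<Sum>\<^sub>k 4\<^bsup>kq\<^esup> P\<^sub>k\<close> belongs to \<open>A\<^bsup>-q\<^esup>\<close> although the integral of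
  \<open>|f|\<^sup>2 (1 - |z|\<^sup>2)\<^sup>p\<close> diverges, so that \<open>f\<close> is not in \<open>\<N>\<^sub>p\<close> (\<open>lacunary_in_growth_space\<close>,
  \<open>lacunary_energy_infinite\<close>). This works as soon as the \<open>P\<^sub>k\<close> are homogeneous polynomials of degree
  \<open>4\<^sup>k\<close>, bounded on the ball independently of \<open>k\<close>, whose mean square over the sphere does not tend to
  \<open>0\<close>. Ryll and Wojtaszczyk proved that such polynomials exist; here they are written down. Take the
  monomials \<open>z\<^sup>\<alpha>\<close> with \<open>|\<alpha>| = 4\<^sup>k\<close> and all \<open>\<alpha>\<^sub>i\<close> divisible by \<open>2\<^sup>k\<close>, divide each by its maximum on the
  sphere, and add them up. As a function of \<open>(|z\<^sub>1|\<^sup>2, \<dots>, |z\<^sub>n|\<^sup>2)\<close> the modulus of such a normalised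
  monomial is a Gaussian bump of width \<open>2\<^bsup>-k\<^esup>\<close> centred at \<open>\<alpha> / 4\<^sup>k\<close>, and these centres form a grid of
  mesh \<open>2\<^bsup>-k\<^esup>\<close>. Hence the sum of the moduli is bounded (\<open>norm_bump_sum_le\<close>), while every point away
  from the coordinate hyperplanes is close to some centre, which bounds the sum of the squares below
  (\<open>sum_norm_sq_bump_ge\<close>). Monomials are orthogonal for every weight that depends only on the moduli
  of the coordinates, so the integral of \<open>|f|\<^sup>2 (1 - |z|\<^sup>2)\<^sup>p\<close> is the sum of the contributions of the
  \<open>P\<^sub>k\<close>, and for \<open>k \<ge> 1\<close> each is at least a fixed positive constant.

  With \<open>p = n\<close> this gives a function in \<open>A\<^bsup>-(n+1)/2\<^esup>\<close> outside \<open>\<N>\<^sub>n\<close>, hence outside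
  \<open>\<N>\<^sub>p\<close> for all \<open>p \<le> n\<close>. For the first inclusion one needs in addition that \<open>A\<^bsup>-q\<^esup>\<close> is
  contained in \<open>\<N>\<^bsub>p2\<^esub>\<close> when \<open>q = (p + 1) / 2\<close> and \<open>p2 - 1 \<le> p < p2 \<le> n\<close>
  (\<open>growth_space_subset_Np_space\<close>). This is an estimate of Forelli-Rudin type, obtained from a dyadic
  decomposition of the ball according to the size of \<open>|1 - \<langle>z,a\<rangle>|\<close>.
\<close>

section \<open>Invariance of Lebesgue measure under linear isometries\<close>

text \<open>
  A linear isometry takes balls to balls of the same radius. By Vitali's covering theorem an open set
  is a disjoint union of balls up to a null set, and isometries preserve null sets, so the measure of
  every open set is preserved, in particular that of boxes.
\<close>

lemma lborel_distr_isometry: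
  fixes T :: "'a::euclidean_space \<Rightarrow> 'a"
  assumes lin: "linear T" and iso: "\<And>x. norm (T x) = norm x"
  shows "distr lborel borel T = lborel"
proof -
  have inj: "inj T"
    using iso by (simp add: linear_injective_0[OF lin]) (metis norm_eq_zero)
  have surj: "surj T" by (rule linear_injective_imp_surjective[OF lin inj]) simp
  define R where "R = inv T"
  have TR: "T (R x) = x" for x unfolding R_def by (simp add: surj surj_f_inv_f)
  have RT: "R (T x) = x" for x unfolding R_def by (simp add: inj)
  have dT: "dist (T x) (T y) = dist x y" for x y
    by (metis dist_norm iso lin linear_diff)
  have dR: "dist (R x) (R y) = dist x y" for x y
    by (metis TR dT)
  have [measurable]: "T \<in> borel_measurable borel"
    by (intro borel_measurable_continuous_onI linear_continuous_on linear_conv_bounded_linear[THEN iffD1] lin)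
  have vim: "T -` S = R ` S" for S
    using TR RT by (auto simp: image_iff) metis
  have vball: "T -` ball x r = ball (R x) r" for x r
    by (auto simp: vimage_def) (metis dT TR)+
  have opens: "emeasure lborel (T -` S) = emeasure lborel S" if S: "open S" for S
  proof -
    let ?K = "{(x,r). ball x r \<subseteq> S \<and> r > 0}"
    obtain C where C: "countable C" "C \<subseteq> ?K"
      "pairwise (\<lambda>i j. disjnt (ball (fst i) (snd i)) (ball (fst j) (snd j))) C"
      "negligible (S - (\<Union>i \<in> C. ball (fst i) (snd i)))"
    proof (rule Vitali_covering_theorem_balls[of S ?K fst snd])
      fix x and d :: real assume x: "x \<in> S" "0 < d"
      then obtain e where "e > 0" "ball x e \<subseteq> S" using S openE by blast
      then show "\<exists>i. i \<in> ?K \<and> x \<in> ball (fst i) (snd i) \<and> snd i < d"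
        using x by (intro exI[of _ "(x, min e (d/2))"]) (auto simp: subset_iff)
    qed blast
    let ?U = "\<Union>i \<in> C. ball (fst i) (snd i)"
    let ?N = "S - ?U"
    have US: "?U \<subseteq> S" using C(2) by fastforce
    have Ub: "?U \<in> sets borel" by (intro borel_open open_UN) auto
    have Nb: "?N \<in> sets borel" using S by (intro sets.Diff borel_open open_UN) auto
    have N0: "?N \<in> null_sets lborel"
      using C(4) Nb by (simp add: negligible_iff_null_sets null_sets_completion_iff)
    have "negligible (R ` ?N)"
      by (rule negligible_locally_Lipschitz_image[OF _ C(4)])
        (auto intro!: exI[of _ UNIV] exI[of _ 1] simp: dist_norm[symmetric] dR)
    then have TN0: "T -` ?N \<in> null_sets lborel"
      using measurable_sets[of T borel borel ?N] Nb
      by (simp add: negligible_iff_null_sets null_sets_completion_iff flip: vim)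
    have disj: "disjoint_family_on (\<lambda>i. ball (fst i) (snd i)) C"
      using C(3) by (auto simp: disjoint_family_on_def pairwise_def disjnt_def)
    then have disj': "disjoint_family_on (\<lambda>i. T -` ball (fst i) (snd i)) C"
      unfolding disjoint_family_on_def by (simp flip: vimage_Int)
    have bb: "emeasure lborel (T -` ball x r) = emeasure lborel (ball x r)" if "r > 0" for x :: 'a and r
      using that by (simp add: vball emeasure_ball)
    have "emeasure lborel S = emeasure lborel (?U \<union> ?N)"
      using US by (auto intro!: arg_cong[where f="emeasure lborel"])
    also have "\<dots> = emeasure lborel ?U"
      using Ub by (intro emeasure_Un_null_set[OF _ N0]) simp
    also have "\<dots> = (\<integral>\<^sup>+ i. emeasure lborel (ball (fst i) (snd i)) \<partial>count_space C)"
      using disj C(1) by (intro emeasure_UN_countable) auto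
    also have "\<dots> = (\<integral>\<^sup>+ i. emeasure lborel (T -` ball (fst i) (snd i)) \<partial>count_space C)"
      using C(2) by (intro nn_integral_cong) (auto simp: bb)
    also have "\<dots> = emeasure lborel (\<Union>i\<in>C. T -` ball (fst i) (snd i))"
      using disj' C(1) measurable_sets[of T borel borel]
      by (intro emeasure_UN_countable[symmetric]) auto
    also have "(\<Union>i\<in>C. T -` ball (fst i) (snd i)) = T -` ?U" by auto
    also have "emeasure lborel (T -` ?U) = emeasure lborel (T -` ?U \<union> T -` ?N)"
      using measurable_sets[of T borel borel ?U] Ub
      by (intro emeasure_Un_null_set[OF _ TN0, symmetric]) auto
    also have "T -` ?U \<union> T -` ?N = T -` S" using US by auto
    finally show ?thesis ..
  qed
  show ?thesis
  proof (rule lborel_eqI[symmetric])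
    fix l u :: 'a assume "\<And>b. b \<in> Basis \<Longrightarrow> l \<bullet> b \<le> u \<bullet> b"
    then show "emeasure (distr lborel borel T) (box l u) = (\<Prod>b\<in>Basis. (u - l) \<bullet> b)"
      by (simp add: emeasure_distr opens open_box)
  qed simp
qed

lemma nn_integral_isometry:
  fixes T :: "'a::euclidean_space \<Rightarrow> 'a"
  assumes "linear T" "\<And>x. norm (T x) = norm x" "f \<in> borel_measurable borel"
  shows "(\<integral>\<^sup>+x. f (T x) \<partial>lborel) = (\<integral>\<^sup>+x. f x \<partial>lborel)"
proof -
  have [measurable]: "T \<in> borel_measurable borel"
    by (intro borel_measurable_continuous_onI linear_continuous_on linear_conv_bounded_linear[THEN iffD1] assms)
  have "(\<integral>\<^sup>+x. f x \<partial>distr lborel borel T) = (\<integral>\<^sup>+x. f (T x) \<partial>lborel)"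
    using assms(3) by (intro nn_integral_distr) auto
  then show ?thesis by (simp add: lborel_distr_isometry[OF assms(1,2)])
qed

lemma integral_isometry:
  fixes T :: "'a::euclidean_space \<Rightarrow> 'a" and f :: "'a \<Rightarrow> 'b::{banach, second_countable_topology}"
  assumes "linear T" "\<And>x. norm (T x) = norm x" "f \<in> borel_measurable borel"
  shows "(LINT x|lborel. f (T x)) = (LINT x|lborel. f x)"
proof -
  have [measurable]: "T \<in> borel_measurable borel"
    by (intro borel_measurable_continuous_onI linear_continuous_on linear_conv_bounded_linear[THEN iffD1] assms)
  have "(LINT x|distr lborel borel T. f x) = (LINT x|lborel. f (T x))"
    using assms(3) by (intro integral_distr) auto
  then show ?thesis by (simp add: lborel_distr_isometry[OF assms(1,2)])
qed

section \<open>The Hermitian inner product and the automorphisms of the ball\<close>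

lemma hinner_self: "hinner z z = of_real ((norm z)\<^sup>2)"
  by (simp add: hinner_def norm_vec_def L2_set_def sum_nonneg complex_norm_square[symmetric] del: of_real_power)

lemma Re_hinner: "Re (hinner z w) = z \<bullet> w"
  by (simp add: hinner_def inner_vec_def inner_complex_def)

lemma hinner_simps:
  "hinner (x + y) w = hinner x w + hinner y w" "hinner w (x + y) = hinner w x + hinner w y"
  "hinner (x - y) w = hinner x w - hinner y w" "hinner w (x - y) = hinner w x - hinner w y"
  "hinner (c *s x) w = c * hinner x w" "hinner w (c *s x) = cnj c * hinner w x"
  "hinner 0 w = 0" "hinner w 0 = 0"
  by (simp_all add: hinner_def algebra_simps sum.distrib sum_subtractf sum_distrib_left)

lemma scaleR_conv_smult: "r *\<^sub>R (x :: complex ^ 'n) = of_real r *s x"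
  by (rule vec_eq_iff[THEN iffD2]) (simp add: scaleR_conv_of_real[where 'a=complex])

lemma cnj_hinner: "cnj (hinner z w) = hinner w z"
  by (simp add: hinner_def mult.commute)

lemma norm_sq_vec: "(norm (z :: complex ^ 'n))\<^sup>2 = (\<Sum>i\<in>UNIV. (cmod (z $ i))\<^sup>2)"
  by (simp add: norm_vec_def L2_set_def sum_nonneg)

lemma norm_smult: "norm (c *s (x :: complex ^ 'n)) = cmod c * norm x"
proof -
  have "(norm (c *s x))\<^sup>2 = (cmod c * norm x)\<^sup>2"
    by (simp add: norm_sq_vec norm_mult power_mult_distrib sum_distrib_left)
  then show ?thesis by (simp add: power2_eq_imp_eq)
qed

lemma cmod_hinner_le: "cmod (hinner z w) \<le> norm z * norm w"
proof (cases "hinner z w = 0")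
  case False
  define c where "c = cnj (hinner z w) / of_real (cmod (hinner z w))"
  have nc: "cmod c = 1" using False by (simp add: c_def norm_divide)
  have "hinner (c *s z) w = of_real (cmod (hinner z w))"
    using False by (simp add: hinner_simps c_def field_simps complex_norm_square power2_eq_square[symmetric] flip: of_real_power)
  then have "cmod (hinner z w) = (c *s z) \<bullet> w"
    by (simp flip: Re_hinner)
  also have "\<dots> \<le> norm (c *s z) * norm w" by (rule norm_cauchy_schwarz)
  finally show ?thesis by (simp add: norm_smult nc)
qed simp

lemma one_minus_hinner:
  assumes "norm a < 1" "norm z < 1"
  shows "cmod (hinner z a) < 1" "1 - norm a \<le> cmod (1 - hinner z a)" "1 - hinner z a \<noteq> 0"
proof -
  have *: "cmod (hinner z a) \<le> norm z * norm a" by (rule cmod_hinner_le)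
  also have le: "norm z * norm a \<le> 1 * norm a" using assms by (intro mult_right_mono) auto
  finally show 1: "cmod (hinner z a) < 1" using assms by simp
  have "cmod 1 - cmod (hinner z a) \<le> cmod (1 - hinner z a)" by (rule norm_triangle_ineq2)
  then show "1 - norm a \<le> cmod (1 - hinner z a)" using * le by simp
  show "1 - hinner z a \<noteq> 0" using 1 by auto
qed

abbreviation mobius_kernel :: "complex ^ 'n \<Rightarrow> complex ^ 'n \<Rightarrow> real" where
  "mobius_kernel a z \<equiv> (1 - (norm a)\<^sup>2) * (1 - (norm z)\<^sup>2) / (cmod (1 - hinner z a))\<^sup>2"

text \<open>
  The numerator of \<open>\<Phi>\<^sub>a(z)\<close> is the sum of a vector along \<open>a\<close> and one orthogonal to \<open>a\<close>. By
  Pythagoras the identity becomes an algebraic one in \<open>c = \<langle>z,a\<rangle> / \<langle>a,a\<rangle>\<close>.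
\<close>

lemma one_minus_norm_ball_aut:
  assumes a: "norm a < 1" and z: "norm z < 1"
  shows "1 - (norm (ball_aut a z))\<^sup>2 = mobius_kernel a z"
proof (cases "a = 0")
  case True
  then show ?thesis by (simp add: ball_aut_def hinner_simps)
next
  case False
  define c where "c = hinner z a / hinner a a"
  define A where "A = (norm a)\<^sup>2"
  define s where "s = sqrt (1 - A)"
  have A: "A > 0" "A < 1" using False a by (auto simp: A_def power_less_one_iff abs_square_less_1)
  have s2: "s\<^sup>2 = 1 - A" using A by (simp add: s_def)
  have za: "hinner z a = c * of_real A" using A unfolding c_def by (simp add: hinner_self flip: A_def)
  have az: "hinner a z = cnj c * of_real A" by (metis za cnj_hinner complex_cnj_mult complex_cnj_complex_of_real)
  have aa: "hinner a a = of_real A" by (simp add: hinner_self A_def)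
  define w where "w = a - cproj a z - s *\<^sub>R (z - cproj a z)"
  have w: "w = a - c *s a - of_real s *s (z - c *s a)"
    by (simp add: w_def cproj_def c_def scaleR_conv_smult)
  have nz: "1 - hinner z a \<noteq> 0" using one_minus_hinner[OF a z] by simp
  have zz: "hinner z z = of_real ((norm z)\<^sup>2)" by (rule hinner_self)
  have "hinner w w = of_real ((cmod (1 - c))\<^sup>2 * A + s\<^sup>2 * ((norm z)\<^sup>2 - (cmod c)\<^sup>2 * A))"
    unfolding w hinner_simps aa za az zz of_real_mult of_real_add of_real_diff complex_norm_square
    by (simp add: algebra_simps power2_eq_square)
  then have nw: "(norm w)\<^sup>2 = (cmod (1 - c))\<^sup>2 * A + (1 - A) * ((norm z)\<^sup>2 - (cmod c)\<^sup>2 * A)"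
    unfolding hinner_self of_real_eq_iff s2 .
  have n1: "(cmod (1 - hinner z a))\<^sup>2 = (1 - Re c * A)\<^sup>2 + (Im c * A)\<^sup>2"
    unfolding za by (simp add: cmod_power2)
  have "norm (ball_aut a z) = norm w / cmod (1 - hinner z a)"
    unfolding ball_aut_def if_not_P[OF False] norm_smult by (simp add: norm_divide w_def s_def A_def)
  then have "1 - (norm (ball_aut a z))\<^sup>2 = ((cmod (1 - hinner z a))\<^sup>2 - (norm w)\<^sup>2) / (cmod (1 - hinner z a))\<^sup>2"
    using nz by (simp add: power_divide diff_divide_distrib)
  also have "(cmod (1 - hinner z a))\<^sup>2 - (norm w)\<^sup>2 = (1 - A) * (1 - (norm z)\<^sup>2)"
    unfolding n1 nw unfolding cmod_power2 by (simp add: algebra_simps power2_eq_square)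
  finally show ?thesis by (simp add: A_def)
qed


section \<open>Unitary maps\<close>

definition unitary_map :: "(complex ^ 'n \<Rightarrow> complex ^ 'n) \<Rightarrow> bool" where
  "unitary_map U \<longleftrightarrow> (\<forall>x y. U (x + y) = U x + U y) \<and> (\<forall>c x. U (c *s x) = c *s U x)
     \<and> (\<forall>x y. hinner (U x) (U y) = hinner x y)"

lemma unitary_mapD:
  assumes "unitary_map U"
  shows "U (x + y) = U x + U y" "U (c *s x) = c *s U x" "hinner (U x) (U y) = hinner x y"
    "norm (U x) = norm x" "linear U" "bounded_linear U"
proof -
  show *: "U (x + y) = U x + U y" "U (c *s x) = c *s U x" "hinner (U x) (U y) = hinner x y" for x y c
    using assms by (auto simp: unitary_map_def)
  have "(norm (U x))\<^sup>2 = (norm x)\<^sup>2"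
    using *(3)[of x x] unfolding hinner_self of_real_eq_iff .
  then show "norm (U x) = norm x" by simp
  show "linear U" by (rule linearI) (simp_all add: * scaleR_conv_smult)
  then show "bounded_linear U" by (simp add: linear_conv_bounded_linear)
qed

text \<open>
  Multiply by the unimodular number \<open>\<tau>\<close> that makes \<open>\<langle>\<tau> e, v\<rangle>\<close> real, where \<open>e\<close> is the \<open>k\<close>-th unit vector.
  Then \<open>\<tau> e\<close> and \<open>v\<close> are interchanged by the complex reflection in the hyperplane orthogonal to
  \<open>u = \<tau> e - v\<close>.
\<close>

lemma unitary_map_exists:
  fixes v :: "complex ^ 'n"
  assumes v: "norm v = 1"
  obtains U where "unitary_map U" "U (axis k 1) = v"
proof -
  define e :: "complex ^ 'n" where "e = axis k 1"
  define h where "h = hinner e v"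
  define \<tau> where "\<tau> = (if h = 0 then 1 else cnj h / of_real (cmod h))"
  have tau: "\<tau> * cnj \<tau> = 1"
  proof -
    have "cmod \<tau> = 1" by (auto simp: \<tau>_def norm_divide)
    then show ?thesis using complex_norm_square[of \<tau>] by simp
  qed
  have e1: "hinner e e = 1"
    by (simp add: hinner_self e_def)
  have vv: "hinner v v = 1" by (simp add: hinner_self v)
  define \<rho> where "\<rho> = cmod h"
  have "\<tau> * h = of_real \<rho>"
    by (auto simp: \<tau>_def \<rho>_def complex_norm_square[symmetric] mult.commute[of "cnj h"] power2_eq_square)
  then have rho: "hinner (\<tau> *s e) v = of_real \<rho>"
    by (simp add: hinner_simps h_def)
  then have rho': "hinner v (\<tau> *s e) = of_real \<rho>"
    by (metis cnj_hinner complex_cnj_complex_of_real)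
  have tt: "hinner (\<tau> *s e) (\<tau> *s e) = 1"
    unfolding hinner_simps e1 using tau by (simp add: mult.commute)
  define u where "u = \<tau> *s e - v"
  have uu: "hinner u u = 2 - 2 * of_real \<rho>"
    unfolding u_def using rho rho' tt vv by (simp only: hinner_simps) (simp add: algebra_simps)
  have eu: "hinner (\<tau> *s e) u = 1 - of_real \<rho>"
    unfolding u_def hinner_simps(4) rho tt by simp
  define U where "U = (\<lambda>z. \<tau> *s z - (2 * hinner (\<tau> *s z) u / hinner u u) *s u)"
  have "unitary_map U"
    unfolding unitary_map_def
  proof (intro conjI allI)
    show "U (x + y) = U x + U y" for x y
      by (simp add: U_def vec_eq_iff hinner_simps algebra_simps add_divide_distrib)
    show "U (c *s x) = c *s U x" for c x
      by (simp add: U_def vec_eq_iff hinner_simps algebra_simps)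
    fix x y
    show "hinner (U x) (U y) = hinner x y"
    proof (cases "hinner u u = 0")
      case True
      then show ?thesis using tau by (simp add: U_def hinner_simps mult.commute)
    next
      case False
      define X Y where "X = \<tau> *s x" and "Y = \<tau> *s y"
      have ux: "hinner u Y = cnj (hinner Y u)" by (simp add: cnj_hinner)
      have cu: "cnj (hinner u u) = hinner u u" by (simp add: cnj_hinner)
      have "hinner (U x) (U y) = hinner X Y"
        unfolding U_def unfolding X_def[symmetric] Y_def[symmetric] unfolding hinner_simps ux
        using False by (simp add: cu field_simps)
      also have "\<dots> = hinner x y" using tau by (simp add: X_def Y_def hinner_simps mult.commute)
      finally show ?thesis .
    qed
  qed
  moreover have "U e = v"
  proof (cases "hinner u u = 0")
    case True
    then have "u = 0" by (simp add: hinner_self)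
    then show ?thesis by (simp add: U_def hinner_simps) (simp add: u_def)
  next
    case False
    then have "2 * hinner (\<tau> *s e) u / hinner u u = 1"
      unfolding eu uu by (simp add: field_simps)
    then have "U e = \<tau> *s e - 1 *s u" unfolding U_def by simp
    then show ?thesis by (simp add: u_def)
  qed
  ultimately show ?thesis using that by (simp add: e_def)
qed

lemma unitary_map_onto:
  fixes a :: "complex ^ 'n"
  obtains U where "unitary_map U" "U (axis k (of_real (norm a))) = a"
proof (cases "a = 0")
  case True
  have "unitary_map (\<lambda>x :: complex ^ 'n. x)" by (simp add: unitary_map_def)
  then show ?thesis using that[of "\<lambda>x. x"] True by (simp add: axis_def vec_eq_iff)
next
  case False
  obtain U where U: "unitary_map U" "U (axis k 1) = (1 / of_real (norm a)) *s a"
    by (rule unitary_map_exists[of "(1 / of_real (norm a)) *s a" k])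
      (use False in \<open>auto simp: norm_smult norm_divide\<close>)
  have "axis k (of_real (norm a)) = of_real (norm a) *s axis k (1::complex)"
    by (simp add: axis_def vec_eq_iff)
  then have "U (axis k (of_real (norm a))) = of_real (norm a) *s ((1 / of_real (norm a)) *s a)"
    using unitary_mapD(2)[OF U(1)] U(2) by simp
  also have "\<dots> = a" using False by (simp add: vec_eq_iff)
  finally show ?thesis using that U by blast
qed

section \<open>The integrals in the norm of the spaces\<close>

lemma cn_holomorphic_imp_continuous:
  "cn_holomorphic_on f S \<Longrightarrow> continuous_on S f"
  unfolding cn_holomorphic_on_def
  by (intro continuous_at_imp_continuous_on ballI) (blast intro: has_derivative_continuous)

lemma ball_borel_measurable:
  fixes g :: "'a::euclidean_space \<Rightarrow> real"
  assumes "continuous_on (ball 0 1) g"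
  shows "(\<lambda>z. ennreal (g z) * indicator (ball 0 1) z) \<in> borel_measurable borel"
proof -
  have "(\<lambda>z. indicator (ball 0 1) z *\<^sub>R g z) \<in> borel_measurable borel"
    by (intro borel_measurable_continuous_on_indicator assms) auto
  then have "(\<lambda>z. ennreal (indicator (ball 0 1) z *\<^sub>R g z)) \<in> borel_measurable borel"
    by measurable
  also have "(\<lambda>z. ennreal (indicator (ball 0 1) z *\<^sub>R g z)) = (\<lambda>z. ennreal (g z) * indicator (ball 0 1) z)"
    by (auto simp: indicator_def)
  finally show ?thesis .
qed

text \<open>
  The integral in the norm of \<open>\<N>\<^sub>p\<close> after the identity for \<open>1 - |\<Phi>\<^sub>a|\<^sup>2\<close> has been inserted, taken with
  respect to Lebesgue measure that is not normalised.
\<close>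

definition energy :: "real \<Rightarrow> (complex ^ 'n \<Rightarrow> complex) \<Rightarrow> complex ^ 'n \<Rightarrow> ennreal" where
  "energy p f a = (\<integral>\<^sup>+z. ennreal ((cmod (f z))\<^sup>2 *
     mobius_kernel a z powr p) * indicator (ball 0 1) z \<partial>lborel)"

lemma continuous_on_hinner [continuous_intros]: "continuous_on S (\<lambda>z. hinner z a)"
  unfolding hinner_def by (intro continuous_intros)

lemma energy_kernel_pos:
  assumes "norm a < 1" "norm z < 1"
  shows "0 < mobius_kernel a z"
  using assms one_minus_hinner[OF assms]
  by (intro divide_pos_pos mult_pos_pos) (auto simp: power_less_one_iff abs_square_less_1)

lemma energy_kernel_le_1:
  assumes "norm a < 1" "norm z < 1"
  shows "mobius_kernel a z \<le> 1"
  using one_minus_norm_ball_aut[OF assms] by (metis diff_le_eq le_add_same_cancel1 zero_le_power2)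

lemma continuous_on_energy_integrand:
  fixes f :: "complex ^ 'n \<Rightarrow> complex"
  assumes f: "continuous_on (ball 0 1) f" and a: "norm a < 1"
  shows "continuous_on (ball 0 1) (\<lambda>z. (cmod (f z))\<^sup>2 *
     mobius_kernel a z powr p)"
proof (intro continuous_intros f)
  show "\<forall>x\<in>ball 0 1. (cmod (1 - hinner x a))\<^sup>2 \<noteq> 0"
    using one_minus_hinner(3)[OF a] by auto
  show "\<forall>x\<in>ball 0 1. mobius_kernel a x \<noteq> 0"
    using energy_kernel_pos[OF a] by (metis less_irrefl mem_ball_0)
qed

lemma energy_mono:
  assumes "p \<le> p'" "norm a < 1"
  shows "energy p' f a \<le> energy p f a"
  unfolding energy_def
proof (intro nn_integral_mono)
  fix z
  show "ennreal ((cmod (f z))\<^sup>2 * mobius_kernel a z powr p')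
      * indicator (ball 0 1) z
    \<le> ennreal ((cmod (f z))\<^sup>2 * mobius_kernel a z powr p)
      * indicator (ball 0 1) z"
  proof (cases "norm z < 1")
    case True
    have "mobius_kernel a z powr p'
      \<le> mobius_kernel a z powr p"
      using energy_kernel_pos[OF assms(2) True] energy_kernel_le_1[OF assms(2) True] assms(1)
      by (intro powr_mono') auto
    then show ?thesis by (intro mult_right_mono ennreal_leI mult_left_mono) auto
  qed auto
qed

lemma ennsqrt_le_iff:
  assumes "0 \<le> b"
  shows "ennsqrt x \<le> ennreal b \<longleftrightarrow> x \<le> ennreal (b\<^sup>2)"
proof (cases x)
  case (real r)
  have "sqrt r \<le> b \<longleftrightarrow> r \<le> b\<^sup>2"
    using assms real by (metis real_sqrt_le_iff real_sqrt_abs abs_of_nonneg)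
  then show ?thesis using real assms by (simp add: ennsqrt_def)
qed (simp add: ennsqrt_def top_unique)

text \<open>
  Normalising the measure only changes the integrals by a constant factor, and the square root is
  monotone, so membership in \<open>\<N>\<^sub>p\<close> can be decided on \<open>energy\<close>.
\<close>

lemma Np_norm_finite_iff:
  fixes f :: "complex ^ 'n \<Rightarrow> complex"
  assumes f: "continuous_on (ball 0 1) f"
  shows "Np_norm p f < \<infinity> \<longleftrightarrow> (\<exists>C. \<forall>a\<in>ball 0 1. energy p f a \<le> ennreal C)"
proof -
  define v where "v = measure lborel (ball 0 1 :: (complex ^ 'n) set)"
  have v: "v > 0" "emeasure lborel (ball 0 1 :: (complex ^ 'n) set) = ennreal v"
    unfolding v_def by (simp, intro emeasure_eq_ennreal_measure) (use emeasure_lborel_ball_finite[of 0 1] in \<open>simp add: less_top\<close>)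
  have I: "(\<integral>\<^sup>+z\<in>ball 0 1. ennreal ((cmod (f z))\<^sup>2 * (1 - (norm (ball_aut a z))\<^sup>2) powr p) \<partial>ball_vol)
     = energy p f a / ennreal v" if a: "norm a < 1" for a
  proof -
    have "(\<integral>\<^sup>+z\<in>ball 0 1. ennreal ((cmod (f z))\<^sup>2 * (1 - (norm (ball_aut a z))\<^sup>2) powr p) \<partial>ball_vol)
      = (\<integral>\<^sup>+z. ennreal ((cmod (f z))\<^sup>2 * mobius_kernel a z powr p)
          * indicator (ball 0 1) z \<partial>ball_vol)"
      by (intro nn_integral_cong) (auto simp: one_minus_norm_ball_aut[OF a] split: split_indicator)
    also have "\<dots> = (\<integral>\<^sup>+z. ennreal ((cmod (f z))\<^sup>2 * mobius_kernel a z powr p)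
          * indicator (ball 0 1) z * indicator (ball 0 1) z \<partial>lborel) / emeasure lborel (ball 0 1 :: (complex ^ 'n) set)"
      unfolding ball_vol_def
      using ball_borel_measurable[OF continuous_on_energy_integrand[OF f a, of p]]
      by (intro nn_integral_uniform_measure) simp_all
    also have "(\<integral>\<^sup>+z. ennreal ((cmod (f z))\<^sup>2 * mobius_kernel a z powr p)
          * indicator (ball 0 1) z * indicator (ball 0 1) z \<partial>lborel) = energy p f a"
      unfolding energy_def by (intro nn_integral_cong) (auto split: split_indicator)
    finally show ?thesis using v by simp
  qed
  have N: "Np_norm p f = (SUP a\<in>ball 0 1. ennsqrt (energy p f a / ennreal v))"
    unfolding Np_norm_def by (intro SUP_cong refl) (simp add: I)
  have div: "x / ennreal v \<le> ennreal c \<longleftrightarrow> x \<le> ennreal (c * v)" if "c \<ge> 0" for x c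
    using v(1) that by (cases x) (auto simp: divide_ennreal ennreal_top_divide top_unique field_simps)
  show ?thesis
  proof
    assume fin: "Np_norm p f < \<infinity>"
    then obtain b where b: "b \<ge> 0" "Np_norm p f = ennreal b"
      by (cases "Np_norm p f") auto
    have "energy p f a \<le> ennreal (b\<^sup>2 * v)" if "a \<in> ball 0 1" for a
    proof -
      have "ennsqrt (energy p f a / ennreal v) \<le> ennreal b"
        unfolding b(2)[symmetric] N using that by (intro SUP_upper)
      then show ?thesis using b by (simp add: ennsqrt_le_iff div)
    qed
    then show "\<exists>C. \<forall>a\<in>ball 0 1. energy p f a \<le> ennreal C" by blast
  next
    assume "\<exists>C. \<forall>a\<in>ball 0 1. energy p f a \<le> ennreal C"
    then obtain C where C: "\<And>a. a \<in> ball 0 1 \<Longrightarrow> energy p f a \<le> ennreal C" by blast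
    define b where "b = sqrt (max C 0 / v)"
    have b: "b \<ge> 0" "b\<^sup>2 = max C 0 / v" using v by (simp_all add: b_def)
    have "Np_norm p f \<le> ennreal b"
      unfolding N
    proof (intro SUP_least)
      fix a :: "complex ^ 'n" assume "a \<in> ball 0 1"
      then have "energy p f a \<le> ennreal (max C 0)"
        using C by (meson order_trans ennreal_leI max.cobounded1)
      then show "ennsqrt (energy p f a / ennreal v) \<le> ennreal b"
        using v b by (simp add: ennsqrt_le_iff div)
    qed
    then show "Np_norm p f < \<infinity>" using ennreal_less_top le_less_trans by (metis infinity_ennreal_def)
  qed
qed

text \<open>
  Unitary invariance allows the point \<open>a\<close> to be moved to a coordinate axis, where explicit
  coordinates are available.
\<close>

lemma energy_unitary:
  fixes f :: "complex ^ 'n \<Rightarrow> complex"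
  assumes f: "continuous_on (ball 0 1) f" and U: "unitary_map U" and a: "norm a < 1"
  shows "energy p f (U a) = energy p (f \<circ> U) a"
proof -
  note U' = unitary_mapD[OF U]
  have "energy p f (U a) = (\<integral>\<^sup>+z. ennreal ((cmod (f (U z)))\<^sup>2 *
     mobius_kernel (U a) (U z) powr p)
      * indicator (ball 0 1) (U z) \<partial>lborel)"
    unfolding energy_def using a
    by (intro nn_integral_isometry[symmetric] ball_borel_measurable continuous_on_energy_integrand f U')
      (simp add: U')
  also have "\<dots> = energy p (f \<circ> U) a"
    unfolding energy_def by (intro nn_integral_cong) (simp add: U' indicator_def)
  finally show ?thesis .
qed

lemma cn_holomorphic_on_unitary:
  assumes f: "cn_holomorphic_on f (ball 0 1)" and U: "unitary_map U"
  shows "cn_holomorphic_on (f \<circ> U) (ball 0 1)"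
  unfolding cn_holomorphic_on_def
proof
  fix z :: "complex ^ 'a" assume z: "z \<in> ball 0 1"
  then have "U z \<in> ball 0 1" by (simp add: unitary_mapD[OF U])
  then obtain D where D: "(f has_derivative D) (at (U z))" "\<And>c v. D (c *s v) = c * D v"
    using f unfolding cn_holomorphic_on_def by blast
  have "(f \<circ> U has_derivative D \<circ> U) (at z)"
    by (rule diff_chain_at[OF bounded_linear_imp_has_derivative[OF unitary_mapD(6)[OF U]] D(1)])
  then show "\<exists>D. (f \<circ> U has_derivative D) (at z) \<and> (\<forall>c v. D (c *s v) = c * D v)"
    using D(2) unitary_mapD(2)[OF U] by (intro exI[of _ "D \<circ> U"]) simp
qed


section \<open>The sub-mean-value inequality\<close>

lemma cn_holomorphic_slice:
  fixes f :: "complex ^ 'n \<Rightarrow> complex"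
  assumes D: "(f has_derivative D) (at (z + \<zeta> *s v))" and lin: "\<And>c v. D (c *s v) = c * D v"
  shows "((\<lambda>\<zeta>. f (z + \<zeta> *s v)) has_field_derivative D v) (at \<zeta>)"
proof -
  have bl: "bounded_linear (\<lambda>c. c *s v)"
    by (intro linear_conv_bounded_linear[THEN iffD1] linearI)
      (simp_all add: vec_eq_iff algebra_simps scaleR_conv_of_real[where 'a=complex])
  have "((\<lambda>\<zeta>. z + \<zeta> *s v) has_derivative (\<lambda>c. c *s v)) (at \<zeta>)"
    using has_derivative_add[OF has_derivative_const[of z] bounded_linear_imp_has_derivative[OF bl]] by simp
  from diff_chain_at[OF this D] have "((\<lambda>\<zeta>. f (z + \<zeta> *s v)) has_derivative (\<lambda>c. c * D v)) (at \<zeta>)"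
    by (simp add: o_def lin)
  then show ?thesis by (simp add: has_field_derivative_def mult_commute_abs)
qed

lemma cn_holomorphic_on_slice:
  assumes "cn_holomorphic_on f S" "\<And>\<zeta>. \<zeta> \<in> A \<Longrightarrow> z + \<zeta> *s v \<in> S"
  shows "(\<lambda>\<zeta>. f (z + \<zeta> *s v)) holomorphic_on A"
  unfolding holomorphic_on_def
proof
  fix \<zeta> assume "\<zeta> \<in> A"
  then obtain D where "(f has_derivative D) (at (z + \<zeta> *s v))" "\<And>c v. D (c *s v) = c * D v"
    using assms unfolding cn_holomorphic_on_def by blast
  from cn_holomorphic_slice[OF this]
  show "(\<lambda>\<zeta>. f (z + \<zeta> *s v)) field_differentiable at \<zeta> within A"
    using field_differentiable_at_within field_differentiable_def by blast
qed

text \<open>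
  Cauchy's integral formula at the centre of the disc.
\<close>

lemma circle_mean_bound:
  assumes g: "g holomorphic_on cball 0 1"
  shows "ennreal (2 * pi * cmod (g 0)) \<le> (\<integral>\<^sup>+t. ennreal (cmod (g (cis t))) * indicator {0..2*pi} t \<partial>lborel)"
proof -
  have "((\<lambda>u. g u/(u-0)) has_contour_integral (2 * of_real pi * \<i> * g 0)) (circlepath 0 1)"
    by (rule Cauchy_integral_circlepath_simple[OF g]) simp
  then have "((\<lambda>t. g (cis t) / cis t * \<i> * cis t) has_integral (2 * of_real pi * \<i> * g 0)) {0..2*pi}"
    unfolding circlepath_def by (simp add: has_contour_integral_part_circlepath_iff mult.assoc)
  then have I: "((\<lambda>t. \<i> * g (cis t)) has_integral (2 * of_real pi * \<i> * g 0)) {0..2*pi}"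
    by (simp add: mult.commute)
  have cont: "continuous_on {0..2*pi} (\<lambda>t. \<i> * g (cis t))"
    by (intro continuous_intros continuous_on_compose2[OF holomorphic_on_imp_continuous_on[OF g]]) auto
  have si: "set_integrable lborel {0..2*pi} (\<lambda>t. \<i> * g (cis t))"
    by (rule borel_integrable_atLeastAtMost'[OF cont])
  have "(LINT t:{0..2*pi}|lborel. \<i> * g (cis t)) = 2 * of_real pi * \<i> * g 0"
    using set_borel_integral_eq_integral(2)[OF si] integral_unique[OF I] by (simp only:)
  then have "ennreal (2 * pi * cmod (g 0)) = ennreal (norm (LINT t:{0..2*pi}|lborel. \<i> * g (cis t)))"
    by (simp add: norm_mult)
  also have "\<dots> \<le> (\<integral>\<^sup>+t. ennreal (norm (indicator {0..2*pi} t *\<^sub>R (\<i> * g (cis t)))) \<partial>lborel)"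
    unfolding set_lebesgue_integral_def
    by (rule integral_norm_bound_ennreal) (use si in \<open>simp add: set_integrable_def\<close>)
  also have "\<dots> = (\<integral>\<^sup>+t. ennreal (cmod (g (cis t))) * indicator {0..2*pi} t \<partial>lborel)"
    by (intro nn_integral_cong) (auto simp: norm_mult indicator_def)
  finally show ?thesis .
qed

lemma linear_smult: "linear (\<lambda>x :: complex ^ 'n. c *s x)"
  by (rule linearI) (simp_all add: vec_eq_iff algebra_simps)

text \<open>
  For each \<open>w\<close> in the ball, apply the bound on circles to the holomorphic function
  \<open>\<zeta> \<mapsto> f(\<zeta>w)\<^sup>2\<close> and integrate over \<open>w\<close>. After exchanging the integrals, every rotation
  \<open>w \<mapsto> e\<^bsup>it\<^esup>w\<close> gives the same integral over the ball.
\<close>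

lemma norm_sq_submean:
  fixes f :: "complex ^ 'n \<Rightarrow> complex"
  assumes f: "cn_holomorphic_on f (ball 0 1)"
  shows "ennreal ((cmod (f 0))\<^sup>2) * emeasure lborel (ball 0 1 :: (complex ^ 'n) set)
    \<le> (\<integral>\<^sup>+z. ennreal ((cmod (f z))\<^sup>2) * indicator (ball 0 1) z \<partial>lborel)" (is "_ \<le> ?I")
proof -
  let ?B = "ball 0 1 :: (complex ^ 'n) set"
  have contf: "continuous_on ?B f" using f by (rule cn_holomorphic_imp_continuous)
  define F where "F = (\<lambda>(w :: complex ^ 'n, t). ennreal ((cmod (f (cis t *s w)))\<^sup>2) * indicator ?B w)"
  have contF: "continuous_on (?B \<times> UNIV) (\<lambda>x. (cmod (f (cis (snd x) *s fst x)))\<^sup>2)"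
  proof (intro continuous_intros continuous_on_compose2[OF contf])
    have "continuous_on (?B \<times> UNIV) (\<lambda>x. \<chi> i. cis (snd x) * fst x $ i)"
      by (intro continuous_intros) 
    then show "continuous_on (?B \<times> UNIV) (\<lambda>x. cis (snd x) *s (fst x :: complex ^ 'n))"
      by (simp add: vector_scalar_mult_def)
  qed (auto simp: norm_smult)
  have "(\<lambda>x. ennreal (indicator (?B \<times> UNIV) x *\<^sub>R (cmod (f (cis (snd x) *s fst x)))\<^sup>2)) \<in> borel_measurable borel"
    by (intro measurable_compose[OF _ measurable_ennreal] borel_measurable_continuous_on_indicator contF) 
      (auto intro!: borel_open open_Times)
  also have "(\<lambda>x. ennreal (indicator (?B \<times> UNIV) x *\<^sub>R (cmod (f (cis (snd x) *s fst x)))\<^sup>2)) = F"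
    by (auto simp: F_def fun_eq_iff indicator_def)
  finally have F[measurable]: "F \<in> borel_measurable (lborel \<Otimes>\<^sub>M lborel)"
    by (simp add: lborel_prod)
  have mean: "ennreal (2 * pi * (cmod (f 0))\<^sup>2) * indicator ?B w
    \<le> (\<integral>\<^sup>+t. F (w, t) * indicator {0..2*pi} t \<partial>lborel)" for w
  proof (cases "w \<in> ?B")
    case True
    have "(\<lambda>\<zeta>. f (0 + \<zeta> *s w)) holomorphic_on cball 0 1"
      by (rule cn_holomorphic_on_slice[OF f])
        (use True in \<open>auto simp: norm_smult intro: le_less_trans[OF mult_left_le_one_le]\<close>)
    then have "(\<lambda>\<zeta>. (f (\<zeta> *s w))\<^sup>2) holomorphic_on cball 0 1"
      by (intro holomorphic_intros) simp
    from circle_mean_bound[OF this] True show ?thesis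
      by (simp add: norm_power F_def)
  qed simp
  have "ennreal (2 * pi * (cmod (f 0))\<^sup>2) * emeasure lborel ?B
      = (\<integral>\<^sup>+w. ennreal (2 * pi * (cmod (f 0))\<^sup>2) * indicator ?B w \<partial>lborel)"
    by (simp add: nn_integral_cmult_indicator)
  also have "\<dots> \<le> (\<integral>\<^sup>+w. (\<integral>\<^sup>+t. F (w, t) * indicator {0..2*pi} t \<partial>lborel) \<partial>lborel)"
    by (intro nn_integral_mono mean)
  also have "\<dots> = (\<integral>\<^sup>+t. (\<integral>\<^sup>+w. F (w, t) * indicator {0..2*pi} t \<partial>lborel) \<partial>lborel)"
    using lborel_pair.Fubini'[of "\<lambda>w t. F (w, t) * indicator {0..2*pi} t"] by simp
  also have "\<dots> = (\<integral>\<^sup>+t. (\<integral>\<^sup>+w. F (w, t) \<partial>lborel) * indicator {0..2*pi} t \<partial>lborel)"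
    by (intro nn_integral_cong nn_integral_multc) simp
  also have "\<dots> = (\<integral>\<^sup>+t. ?I * indicator {0..2*pi} t \<partial>lborel)"
  proof (rule nn_integral_cong)
    fix t :: real
    have "(\<integral>\<^sup>+w. F (w, t) \<partial>lborel)
      = (\<integral>\<^sup>+w. ennreal ((cmod (f (cis t *s w)))\<^sup>2) * indicator ?B (cis t *s w) \<partial>lborel)"
      by (intro nn_integral_cong) (auto simp: F_def indicator_def norm_smult)
    also have "\<dots> = ?I"
      by (intro nn_integral_isometry[of "\<lambda>x. cis t *s x" "\<lambda>z. ennreal ((cmod (f z))\<^sup>2) * indicator ?B z"]
          linear_smult ball_borel_measurable continuous_intros contf) (simp add: norm_smult)
    finally show "(\<integral>\<^sup>+w. F (w, t) \<partial>lborel) * indicator {0..2*pi} t = ?I * indicator {0..2*pi} t" by simp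
  qed
  also have "\<dots> = ?I * ennreal (2 * pi)"
    by (simp add: nn_integral_cmult)
  finally have "ennreal (2 * pi) * (ennreal ((cmod (f 0))\<^sup>2) * emeasure lborel ?B) \<le> ennreal (2 * pi) * ?I"
    by (simp add: ennreal_mult' mult_ac)
  then show ?thesis
    by (subst (asm) ennreal_mult_le_mult_iff) auto
qed

section \<open>The growth of functions with finite norm\<close>

lemma prod_axis_scale:
  fixes x s :: real and k :: "'n::finite"
  shows "(\<Prod>i\<in>UNIV. if i = k then x else s)\<^sup>2 = x\<^sup>2 * (s\<^sup>2) ^ (CARD('n) - 1)"
proof -
  have "(\<Prod>i\<in>UNIV. if i = k then x else s) = x * (\<Prod>i\<in>UNIV - {k}. if i = k then x else s)"
    by (subst prod.remove[of _ k]) auto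
  also have "(\<Prod>i\<in>UNIV - {k}. if i = k then x else s) = (\<Prod>i\<in>UNIV - {k}. s)"
    by (intro prod.cong) auto
  also have "\<dots> = s ^ (CARD('n) - 1)" by (simp add: card_Diff_singleton)
  finally have eq: "(\<Prod>i\<in>UNIV. if i = k then x else s) = x * s ^ (CARD('n) - 1)" .
  show ?thesis
    unfolding eq power_mult_distrib power_mult[symmetric] mult.commute[of "CARD('n) - 1" 2] ..
qed

lemma prod_Basis_vec:
  "(\<Prod>j\<in>(Basis :: (complex ^ 'n) set). h j) = (\<Prod>i\<in>UNIV. h (axis i 1) * h (axis i \<i>))"
proof -
  have B: "(Basis :: (complex ^ 'n) set) = (\<lambda>(i,u). axis i u) ` (UNIV \<times> Basis)"
    by (auto simp: Basis_vec_def)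
  have inj: "inj_on (\<lambda>(i,u). axis i u :: complex ^ 'n) (UNIV \<times> Basis)"
    by (auto simp: inj_on_def axis_eq_axis)
  have "(\<Prod>j\<in>(Basis :: (complex ^ 'n) set). h j) = (\<Prod>(i,u)\<in>UNIV \<times> Basis. h (axis i u))"
    unfolding B prod.reindex[OF inj] by (intro prod.cong) auto
  also have "\<dots> = (\<Prod>i\<in>UNIV. \<Prod>u\<in>Basis. h (axis i u))"
    by (rule prod.cartesian_product[symmetric])
  finally show ?thesis by (simp add: Basis_complex_def)
qed

text \<open>
  The square in the Jacobian is due to each complex coordinate being two real ones.
\<close>

lemma nn_integral_diag_affine:
  fixes d :: "'n::finite \<Rightarrow> real" and a :: "complex ^ 'n"
  assumes d: "\<And>i. d i > 0" and F: "F \<in> borel_measurable borel"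
  shows "(\<integral>\<^sup>+z. F z \<partial>lborel) = ennreal ((\<Prod>i\<in>UNIV. d i)\<^sup>2) * (\<integral>\<^sup>+w. F (a + (\<chi> i. d i *\<^sub>R w $ i)) \<partial>lborel)"
proof -
  define c where "c = (\<lambda>j :: complex ^ 'n. \<Sum>i\<in>UNIV. d i * norm (j $ i))"
  have c: "c (axis i u) = d i * norm u" for i u
    by (simp add: c_def axis_def if_distrib if_distribR cong: if_cong)
  have cB: "c j > 0" if "j \<in> Basis" for j
    using that d by (auto simp: Basis_vec_def c)
  have T: "(\<Sum>j\<in>Basis. (c j * (x \<bullet> j)) *\<^sub>R j) = (\<chi> i. d i *\<^sub>R x $ i)" for x :: "complex ^ 'n"
  proof (rule euclidean_eqI)
    fix b :: "complex ^ 'n" assume b: "b \<in> Basis"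
    then obtain i u where iu: "b = axis i u" "u \<in> Basis" by (auto simp: Basis_vec_def)
    have "(\<Sum>j\<in>Basis. (c j * (x \<bullet> j)) *\<^sub>R j) \<bullet> b = c b * (x \<bullet> b)"
      using b by (simp add: inner_sum_left inner_Basis if_distrib cong: if_cong)
    also have "\<dots> = (\<chi> i. d i *\<^sub>R x $ i) \<bullet> b"
      using iu by (simp add: c inner_axis)
    finally show "(\<Sum>j\<in>Basis. (c j * (x \<bullet> j)) *\<^sub>R j) \<bullet> b = (\<chi> i. d i *\<^sub>R x $ i) \<bullet> b" .
  qed
  have P: "(\<Prod>j\<in>Basis. \<bar>c j\<bar>) = (\<Prod>i\<in>UNIV. d i)\<^sup>2"
    using d by (simp add: prod_Basis_vec c power2_eq_square prod.distrib less_imp_le)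
  have [measurable]: "(\<lambda>x. a + (\<chi> i. d i *\<^sub>R x $ i)) \<in> borel_measurable borel"
    by (intro borel_measurable_continuous_onI continuous_intros)
  have "lborel = density (distr lborel borel (\<lambda>x. a + (\<chi> i. d i *\<^sub>R x $ i))) (\<lambda>_. ennreal ((\<Prod>i\<in>UNIV. d i)\<^sup>2))"
    using lborel_affine_euclidean[of c a] cB unfolding T P by force
  then have "(\<integral>\<^sup>+z. F z \<partial>lborel)
    = (\<integral>\<^sup>+z. F z \<partial>density (distr lborel borel (\<lambda>x. a + (\<chi> i. d i *\<^sub>R x $ i))) (\<lambda>_. ennreal ((\<Prod>i\<in>UNIV. d i)\<^sup>2)))"
    by simp
  also have "\<dots> = ennreal ((\<Prod>i\<in>UNIV. d i)\<^sup>2) * (\<integral>\<^sup>+w. F (a + (\<chi> i. d i *\<^sub>R w $ i)) \<partial>lborel)"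
    using F by (simp add: nn_integral_density nn_integral_distr nn_integral_cmult)
  finally show ?thesis .
qed

lemma norm_axis_vec: "norm (axis k c :: complex ^ 'n) = cmod c"
proof -
  have "(norm (axis k c :: complex ^ 'n))\<^sup>2 = (cmod c)\<^sup>2"
  proof -
    have "(cmod (axis k c $ i))\<^sup>2 = (if i = k then (cmod c)\<^sup>2 else 0)" for i :: 'n
      by (simp add: axis_def)
    then show ?thesis unfolding norm_sq_vec by simp
  qed
  then show ?thesis by simp
qed

lemma hinner_axis: "hinner z (axis k c) = z $ k * cnj c"
  by (simp add: hinner_def axis_def if_distrib cong: if_cong)

text \<open>
  Put \<open>\<delta> = 1 - r\<^sup>2\<close>. The map \<open>T\<close> in the proof takes the unit ball onto an ellipsoid about \<open>a\<close> with semi-axes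
  \<open>\<delta>/4\<close> in the direction of \<open>a\<close> and \<open>\<surd>\<delta>/4\<close> in the orthogonal complex directions. On it the kernel is at least
  \<open>6/25\<close>, and its volume is \<open>\<delta>\<^bsup>n+1\<^esup>/16\<^sup>n\<close> times that of the ball; the sub-mean-value inequality for
  \<open>f \<circ> T\<close> gives the claim.
\<close>

lemma energy_lower_bound_axis:
  fixes f :: "complex ^ 'n \<Rightarrow> complex" and k :: 'n
  assumes f: "cn_holomorphic_on f (ball 0 1)" and r: "0 \<le> r" "r < 1" and p: "0 < p"
  defines "a \<equiv> axis k (of_real r)"
  shows "ennreal ((6/25) powr p * (1 - r\<^sup>2) ^ (CARD('n) + 1) / 16 ^ CARD('n) * (cmod (f a))\<^sup>2)
      * emeasure lborel (ball 0 1 :: (complex ^ 'n) set) \<le> energy p f a"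
proof -
  let ?B = "ball 0 1 :: (complex ^ 'n) set"
  define \<delta> where "\<delta> = 1 - r\<^sup>2"
  have \<delta>: "0 < \<delta>" "\<delta> \<le> 1" using r by (auto simp: \<delta>_def power_less_one_iff abs_square_less_1)
  define d where "d = (\<lambda>i. if i = k then \<delta>/4 else sqrt \<delta>/4)"
  have d: "d i > 0" for i using \<delta> by (simp add: d_def)
  \<comment> \<open>the ellipsoid as an affine image of the unit ball\<close>
  define T where "T = (\<lambda>w :: complex ^ 'n. a + (\<chi> i. d i *\<^sub>R w $ i))"
  have na: "norm a < 1" using r by (simp add: a_def norm_axis_vec)
  have Tk: "T w $ k = of_real r + of_real (\<delta>/4) * w $ k" for w
    by (simp add: T_def a_def d_def scaleR_conv_of_real)
  have Ti: "i \<noteq> k \<Longrightarrow> T w $ i = of_real (sqrt \<delta>/4) * w $ i" for w i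
    by (simp add: T_def a_def d_def scaleR_conv_of_real axis_def)
  have est: "1 - (norm (T w))\<^sup>2 \<ge> 3 * \<delta> / 8" "cmod (1 - hinner (T w) a) \<le> 5 * \<delta> / 4" if w: "norm w < 1" for w
  proof -
    have wk: "cmod (w $ k) \<le> 1" using w Finite_Cartesian_Product.norm_nth_le[of w k] by linarith
    have w2: "(norm w)\<^sup>2 \<le> 1" using w by (simp add: power_le_one)
    have wk2: "(cmod (w $ k))\<^sup>2 \<le> 1" using wk by (simp add: power_le_one)
    have "(norm w)\<^sup>2 = (cmod (w $ k))\<^sup>2 + (\<Sum>i\<in>UNIV - {k}. (cmod (w $ i))\<^sup>2)"
      unfolding norm_sq_vec by (rule sum.remove) auto
    then have S: "(\<Sum>i\<in>UNIV - {k}. (cmod (w $ i))\<^sup>2) \<le> 1" using w2 by (smt (verit) zero_le_power2)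
    have "(norm (T w))\<^sup>2 = (cmod (T w $ k))\<^sup>2 + (\<Sum>i\<in>UNIV - {k}. (cmod (T w $ i))\<^sup>2)"
      unfolding norm_sq_vec by (rule sum.remove) auto
    also have "(\<Sum>i\<in>UNIV - {k}. (cmod (T w $ i))\<^sup>2) = \<delta>/16 * (\<Sum>i\<in>UNIV - {k}. (cmod (w $ i))\<^sup>2)"
      using \<delta> by (simp add: Ti norm_mult norm_divide power_mult_distrib power_divide sum_distrib_left)
    also have "\<dots> \<le> \<delta>/16 * 1" using S \<delta> by (intro mult_left_mono) auto
    also have "(cmod (T w $ k))\<^sup>2 = r\<^sup>2 + r * \<delta> * Re (w $ k) / 2 + \<delta>\<^sup>2/16 * (cmod (w $ k))\<^sup>2"
      unfolding Tk cmod_power2 by (simp add: power2_eq_square algebra_simps)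
    also have "r * \<delta> * Re (w $ k) \<le> 1 * \<delta> * 1"
    proof -
      have "r * \<delta> * Re (w $ k) \<le> r * \<delta> * 1"
        using r \<delta> wk complex_Re_le_cmod[of "w $ k"] by (intro mult_left_mono) auto
      also have "\<dots> \<le> 1 * \<delta> * 1" using r \<delta> by simp
      finally show ?thesis .
    qed
    also have "\<delta>\<^sup>2/16 * (cmod (w $ k))\<^sup>2 \<le> \<delta>/16 * 1"
      using \<delta> wk2 by (intro mult_mono) (auto simp: power2_eq_square mult_left_le)
    finally have "(norm (T w))\<^sup>2 \<le> r\<^sup>2 + 1 * \<delta> * 1 / 2 + \<delta>/16 * 1 + \<delta>/16 * 1" by simp
    then show "1 - (norm (T w))\<^sup>2 \<ge> 3 * \<delta> / 8" using \<delta>_def by linarith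
    have "1 - hinner (T w) a = of_real \<delta> - of_real (r * \<delta> / 4) * w $ k"
      by (simp add: a_def hinner_axis Tk[unfolded a_def] \<delta>_def algebra_simps power2_eq_square)
    then have "cmod (1 - hinner (T w) a) \<le> cmod (of_real \<delta>) + cmod (of_real (r * \<delta> / 4) * w $ k)"
      by (metis norm_triangle_ineq4)
    also have "\<dots> = \<delta> + r * \<delta> / 4 * cmod (w $ k)" using \<delta> r by (simp add: norm_mult)
    also have "\<dots> \<le> \<delta> + 1 * \<delta> / 4 * 1"
      using \<delta> r wk by (intro add_left_mono mult_mono divide_right_mono) auto
    finally show "cmod (1 - hinner (T w) a) \<le> 5 * \<delta> / 4" by simp
  qed
  have Tball: "T w \<in> ?B" if "norm w < 1" for w
  proof -
    have "(norm (T w))\<^sup>2 < 1" using est(1)[OF that] \<delta> by linarith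
    then show ?thesis by (simp add: abs_square_less_1)
  qed
  have kern: "6/25 \<le> mobius_kernel a (T w)" if w: "norm w < 1" for w
  proof -
    have nz: "1 - hinner (T w) a \<noteq> 0" using one_minus_hinner[OF na] Tball[OF w] by simp
    \<comment> \<open>\<open>6/25\<close> is \<open>3/8\<close> divided by the square of \<open>5/4\<close>, the two constants of \<open>est\<close>\<close>
    have "6/25 * (cmod (1 - hinner (T w) a))\<^sup>2 \<le> 6/25 * (5 * \<delta> / 4)\<^sup>2"
      using est(2)[OF w] by (intro mult_left_mono power_mono) auto
    also have "\<dots> = \<delta> * (3 * \<delta> / 8)" by (simp add: power2_eq_square)
    also have "\<dots> \<le> \<delta> * (1 - (norm (T w))\<^sup>2)"
      using est(1)[OF w] \<delta> by (intro mult_left_mono) auto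
    also have "\<delta> = 1 - (norm a)\<^sup>2" using r by (simp add: a_def \<delta>_def norm_axis_vec)
    finally show ?thesis using nz by (simp add: pos_le_divide_eq)
  qed
  define g where "g = f \<circ> T"
  have g: "cn_holomorphic_on g (ball 0 1)"
    unfolding cn_holomorphic_on_def
  proof
    fix z :: "complex ^ 'n" assume "z \<in> ?B"
    then have "T z \<in> ?B" using Tball by simp
    then obtain D where D: "(f has_derivative D) (at (T z))" "\<And>c v. D (c *s v) = c * D v"
      using f unfolding cn_holomorphic_on_def by blast
    have bl: "bounded_linear (\<lambda>w :: complex ^ 'n. \<chi> i. d i *\<^sub>R w $ i)"
      by (intro linear_conv_bounded_linear[THEN iffD1] linearI) (simp_all add: vec_eq_iff algebra_simps)
    have "(T has_derivative (\<lambda>w. \<chi> i. d i *\<^sub>R w $ i)) (at z)"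
      unfolding T_def
      using has_derivative_add[OF has_derivative_const[of a] bounded_linear_imp_has_derivative[OF bl]] by simp
    from diff_chain_at[OF this D(1)]
    have "(g has_derivative (\<lambda>w. D (\<chi> i. d i *\<^sub>R w $ i))) (at z)" by (simp add: g_def o_def)
    moreover have "D (\<chi> i. d i *\<^sub>R (c *s v) $ i) = c * D (\<chi> i. d i *\<^sub>R v $ i)" for c v
    proof -
      have "(\<chi> i. d i *\<^sub>R (c *s v) $ i) = c *s (\<chi> i. d i *\<^sub>R v $ i)" by (simp add: vec_eq_iff)
      then show ?thesis by (simp add: D(2))
    qed
    ultimately show "\<exists>D. (g has_derivative D) (at z) \<and> (\<forall>c v. D (c *s v) = c * D v)" by blast
  qed
  have contf: "continuous_on ?B f" using f by (rule cn_holomorphic_imp_continuous)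
  have contg: "continuous_on ?B g" using g by (rule cn_holomorphic_imp_continuous)
  have g0: "g 0 = f a" by (simp add: g_def T_def zero_vec_def[symmetric])
  have P: "(\<Prod>i\<in>UNIV. d i)\<^sup>2 = \<delta> ^ (CARD('n) + 1) / 16 ^ CARD('n)"
  proof -
    have "(\<Prod>i\<in>UNIV. d i)\<^sup>2 = (\<delta>/4)\<^sup>2 * ((sqrt \<delta> / 4)\<^sup>2) ^ (CARD('n) - 1)"
      unfolding d_def by (rule prod_axis_scale)
    also have "(sqrt \<delta> / 4)\<^sup>2 = \<delta> / 16" using \<delta> by (simp add: power_divide)
    also have "(\<delta>/4)\<^sup>2 * (\<delta> / 16) ^ (CARD('n) - 1) = \<delta> * (\<delta>/16) ^ (Suc (CARD('n) - 1))"
      unfolding power_Suc by (simp add: power2_eq_square)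
    also have "Suc (CARD('n) - 1) = CARD('n)" by simp
    finally show ?thesis by (simp add: power_divide)
  qed
  define c where "c = (6/25 :: real) powr p"
  have "ennreal (c * \<delta> ^ (CARD('n) + 1) / 16 ^ CARD('n) * (cmod (f a))\<^sup>2) * emeasure lborel ?B
    = ennreal ((\<Prod>i\<in>UNIV. d i)\<^sup>2) * (ennreal c * (ennreal ((cmod (g 0))\<^sup>2) * emeasure lborel ?B))"
    unfolding P g0 mult.assoc[symmetric] using \<delta> by (simp add: ennreal_mult'[symmetric] c_def mult_ac)
  also have "\<dots> \<le> ennreal ((\<Prod>i\<in>UNIV. d i)\<^sup>2) * (ennreal c * (\<integral>\<^sup>+w. ennreal ((cmod (g w))\<^sup>2) * indicator ?B w \<partial>lborel))"
    by (intro mult_left_mono norm_sq_submean g) auto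
  also have "ennreal c * (\<integral>\<^sup>+w. ennreal ((cmod (g w))\<^sup>2) * indicator ?B w \<partial>lborel)
      = (\<integral>\<^sup>+w. ennreal c * (ennreal ((cmod (g w))\<^sup>2) * indicator ?B w) \<partial>lborel)"
    by (intro nn_integral_cmult[symmetric]) (simp, intro ball_borel_measurable continuous_intros contg)
  also have "\<dots> \<le> (\<integral>\<^sup>+w. ennreal ((cmod (f (T w)))\<^sup>2 *
     mobius_kernel a (T w) powr p) * indicator ?B (T w) \<partial>lborel)"
  proof (intro nn_integral_mono)
    fix w
    show "ennreal c * (ennreal ((cmod (g w))\<^sup>2) * indicator ?B w) \<le> ennreal ((cmod (f (T w)))\<^sup>2 *
     mobius_kernel a (T w) powr p) * indicator ?B (T w)"
    proof (cases "w \<in> ?B")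
      case True
      have "c \<le> mobius_kernel a (T w) powr p"
        unfolding c_def using kern[of w] True p by (intro powr_mono2) auto
      then have "(cmod (f (T w)))\<^sup>2 * c \<le> (cmod (f (T w)))\<^sup>2 *
          mobius_kernel a (T w) powr p"
        by (intro mult_left_mono) auto
      then show ?thesis using True Tball[of w]
        by (simp add: g_def ennreal_mult'[symmetric] c_def mult.commute[of _ "(cmod _)\<^sup>2"] ennreal_leI)
    qed simp
  qed
  also have "ennreal ((\<Prod>i\<in>UNIV. d i)\<^sup>2) * \<dots> = energy p f a"
    unfolding energy_def T_def
    by (intro nn_integral_diag_affine[symmetric] d ball_borel_measurable continuous_on_energy_integrand contf na)
  finally show ?thesis by (simp add: c_def \<delta>_def mult_left_mono)
qed

text \<open>
  Rotate \<open>z\<close> to a coordinate axis and use the lower bound for the integral belonging to \<open>a = z\<close>.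
\<close>

theorem Np_space_subset_growth_space:
  assumes p: "0 < p"
  shows "Np_space p \<subseteq> (growth_space ((real CARD('n) + 1) / 2) :: (complex ^ 'n \<Rightarrow> complex) set)"
proof
  fix f :: "complex ^ 'n \<Rightarrow> complex" assume fN: "f \<in> Np_space p"
  then have f: "cn_holomorphic_on f (ball 0 1)" by (simp add: Np_space_def)
  note contf = cn_holomorphic_imp_continuous[OF f]
  have "\<exists>C. \<forall>a\<in>ball 0 1. energy p f a \<le> ennreal C"
    using fN Np_norm_finite_iff[OF contf, of p] by (auto simp: Np_space_def)
  then obtain C where C: "\<And>a. a \<in> ball 0 1 \<Longrightarrow> energy p f a \<le> ennreal C" by blast
  define v where "v = measure lborel (ball 0 1 :: (complex ^ 'n) set)"
  have v: "v > 0" "emeasure lborel (ball 0 1 :: (complex ^ 'n) set) = ennreal v"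
    unfolding v_def by (simp, intro emeasure_eq_ennreal_measure) (use emeasure_lborel_ball_finite[of 0 1] in \<open>simp add: less_top\<close>)
  define c where "c = (6/25) powr p / 16 ^ CARD('n) * v"
  have c: "c > 0" using v by (simp add: c_def)
  have bd: "cmod (f z) * (1 - (norm z)\<^sup>2) powr ((real CARD('n) + 1) / 2) \<le> sqrt (max C 0 / c)" if z: "norm z < 1" for z
  proof -
    obtain k :: 'n where True by blast
    obtain U where U: "unitary_map U" "U (axis k (of_real (norm z))) = z"
      by (rule unitary_map_onto)
    define \<delta> where "\<delta> = 1 - (norm z)\<^sup>2"
    have \<delta>: "\<delta> > 0" using z by (simp add: \<delta>_def power_less_one_iff abs_square_less_1)
    have "ennreal ((6/25) powr p * (1 - (norm z)\<^sup>2) ^ (CARD('n) + 1) / 16 ^ CARD('n) * (cmod ((f \<circ> U) (axis k (of_real (norm z)))))\<^sup>2)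
      * emeasure lborel (ball 0 1 :: (complex ^ 'n) set) \<le> energy p (f \<circ> U) (axis k (of_real (norm z)))"
      by (rule energy_lower_bound_axis[OF cn_holomorphic_on_unitary[OF f U(1)]]) (use z p in auto)
    also have "\<dots> = energy p f z"
      using energy_unitary[OF contf U(1), of "axis k (of_real (norm z))" p] z U(2) by (simp add: norm_axis_vec)
    also have "\<dots> \<le> ennreal (max C 0)" using C[of z] z by (simp add: ennreal_leI order_trans[OF C])
    finally have "ennreal (c * (\<delta> ^ (CARD('n) + 1) * (cmod (f z))\<^sup>2)) \<le> ennreal (max C 0)"
      using v \<delta> by (simp add: U(2) ennreal_mult'[symmetric] c_def \<delta>_def mult_ac)
    then have "c * (\<delta> ^ (CARD('n) + 1) * (cmod (f z))\<^sup>2) \<le> max C 0" by simp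
    then have "\<delta> ^ (CARD('n) + 1) * (cmod (f z))\<^sup>2 \<le> max C 0 / c"
      using c by (simp add: pos_le_divide_eq mult.commute)
    also have "\<delta> ^ (CARD('n) + 1) = \<delta> powr real (CARD('n) + 1)"
      by (rule powr_realpow[OF \<delta>, symmetric])
    also have "\<dots> = (\<delta> powr ((real CARD('n) + 1) / 2))\<^sup>2"
      using \<delta> by (simp add: powr_power add.commute add_divide_distrib)
    finally have "(cmod (f z) * \<delta> powr ((real CARD('n) + 1) / 2))\<^sup>2 \<le> max C 0 / c"
      by (simp add: power_mult_distrib mult.commute)
    then show ?thesis unfolding \<delta>_def by (rule real_le_rsqrt)
  qed
  have "growth_norm ((real CARD('n) + 1) / 2) f \<le> ennreal (sqrt (max C 0 / c))"
    unfolding growth_norm_def by (intro SUP_least ennreal_leI bd) simp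
  then have "growth_norm ((real CARD('n) + 1) / 2) f < \<infinity>"
    using ennreal_less_top le_less_trans by (metis infinity_ennreal_def)
  then show "f \<in> growth_space ((real CARD('n) + 1) / 2)" using f by (simp add: growth_space_def)
qed


section \<open>Integrals over Carleson tents\<close>

text \<open>
  As \<open>\<rho>\<close> runs through a geometric progression, these sets decompose the ball according to the size
  of the denominator of the kernel.
\<close>

definition carleson_tent :: "real \<Rightarrow> complex ^ 'n \<Rightarrow> (complex ^ 'n) set" where
  "carleson_tent \<rho> a = {z. norm z < 1 \<and> cmod (1 - hinner z a) < \<rho>}"

lemma open_carleson_tent: "open (carleson_tent \<rho> a)"
  unfolding carleson_tent_def by (intro open_Collect_conj open_Collect_less continuous_intros)

lemma carleson_tent_borel [measurable]: "carleson_tent \<rho> a \<in> sets borel"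
  using open_carleson_tent by (rule borel_open)

lemma carleson_tent_bound:
  assumes "z \<in> carleson_tent \<rho> a" "norm a < 1"
  shows "1 - norm z < \<rho>" "1 - norm a < \<rho>" "1 - cmod (hinner z a) < \<rho>"
proof -
  have z: "norm z < 1" "cmod (1 - hinner z a) < \<rho>" using assms by (auto simp: carleson_tent_def)
  have "cmod 1 - cmod (hinner z a) \<le> cmod (1 - hinner z a)" by (rule norm_triangle_ineq2)
  then show 1: "1 - cmod (hinner z a) < \<rho>" using z by simp
  have 2: "cmod (hinner z a) \<le> norm z * norm a" by (rule cmod_hinner_le)
  have "norm z * norm a \<le> norm z * 1" using assms by (intro mult_left_mono) auto
  then show "1 - norm z < \<rho>" using 1 2 by simp
  have "norm z * norm a \<le> 1 * norm a" using z by (intro mult_right_mono) auto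
  then show "1 - norm a < \<rho>" using 1 2 by simp
qed

text \<open>
  Let \<open>|a| \<ge> 1/2\<close> and rotate \<open>a\<close> to \<open>r e\<^sub>k\<close>. In the tent \<open>|z\<^sub>k - 1/r| < 2\<rho>\<close>, and
  \<open>|z\<^sub>i|\<^sup>2 \<le> 1 - |z\<^sub>k|\<^sup>2 \<le> 2\<rho>\<close> for \<open>i \<noteq> k\<close>. So the tent lies in a polydisc whose volume is
  proportional to \<open>\<rho>\<^sup>2 \<rho>\<^bsup>n-1\<^esup>\<close>; rescaling its sides to length one puts it inside the fixed ball of
  radius \<open>n + 1\<close>. When \<open>\<rho>\<close> exceeds \<open>1/2\<close> the right-hand side exceeds the volume of the unit ball,
  and when both \<open>\<rho>\<close> and \<open>|a|\<close> are small the tent is empty.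
\<close>

lemma emeasure_carleson_tent_le:
  fixes a :: "complex ^ 'n"
  assumes a: "norm a < 1" and \<rho>: "0 < \<rho>"
  shows "emeasure lborel (carleson_tent \<rho> a)
    \<le> ennreal ((2 * \<rho>) ^ (CARD('n) + 1)) * emeasure lborel (ball 0 (real CARD('n) + 1) :: (complex ^ 'n) set)"
proof (cases "\<rho> \<le> 1/2 \<and> norm a < 1/2")
  case True
  then have "carleson_tent \<rho> a = {}" using carleson_tent_bound[OF _ a] by force
  then show ?thesis by simp
next
  case False
  let ?V = "emeasure lborel (ball 0 (real CARD('n) + 1) :: (complex ^ 'n) set)"
  show ?thesis
  proof (cases "\<rho> \<le> 1/2")
    case big: False
    have le: "emeasure lborel (carleson_tent \<rho> a) \<le> ?V"
      by (intro emeasure_mono) (auto simp: carleson_tent_def)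
    have one: "1 \<le> (2 * \<rho>) ^ (CARD('n) + 1)" using big by (intro one_le_power) simp
    have "1 \<le> ennreal ((2 * \<rho>) ^ (CARD('n) + 1))"
      using ennreal_leI[OF one] unfolding ennreal_1 .
    then have V1: "1 * ?V \<le> ennreal ((2 * \<rho>) ^ (CARD('n) + 1)) * ?V"
      by (rule mult_right_mono) simp
    show ?thesis by (rule order_trans[OF le V1[unfolded mult_1_left]])
  next
    case small: True
    define r where "r = norm a"
    have r: "1/2 \<le> r" "r < 1" using False small a by (auto simp: r_def)
    obtain k :: 'n where True by blast
    obtain U where U: "unitary_map U" "U (axis k (of_real (norm a))) = a"
      by (rule unitary_map_onto)
    define e :: "complex ^ 'n" where "e = axis k (of_real r)"
    have Ue: "U e = a" using U by (simp add: e_def r_def)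
    define d where "d = (\<lambda>i. if i = k then 2 * \<rho> else sqrt (2 * \<rho>))"
    have d: "d i > 0" for i using \<rho> by (simp add: d_def)
    have P: "(\<Prod>i\<in>UNIV. d i)\<^sup>2 = (2 * \<rho>) ^ (CARD('n) + 1)"
    proof -
      have "(\<Prod>i\<in>UNIV. d i)\<^sup>2 = (2 * \<rho>)\<^sup>2 * (2 * \<rho>) ^ (CARD('n) - 1)"
        unfolding d_def prod_axis_scale using \<rho> by simp
      also have "\<dots> = (2 * \<rho>) ^ (2 + (CARD('n) - 1))" by (simp only: power_add)
      also have "2 + (CARD('n) - 1) = CARD('n) + 1"
        using zero_less_card_finite[where 'a='n] by linarith
      finally show ?thesis .
    qed
    let ?x = "axis k (of_real (1/r)) :: complex ^ 'n"
    have sub: "w \<in> ball 0 (real CARD('n) + 1)" if w: "?x + (\<chi> i. d i *\<^sub>R w $ i) \<in> carleson_tent \<rho> e" for w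
    proof -
      define z where "z = ?x + (\<chi> i. d i *\<^sub>R w $ i)"
      have z: "z \<in> carleson_tent \<rho> e" "norm z < 1" using w by (auto simp: z_def carleson_tent_def)
      have h: "hinner z e = of_real r * z $ k" by (simp add: e_def hinner_axis)
      have zk: "z $ k = of_real (1/r) + of_real (2*\<rho>) * w $ k"
        by (simp add: z_def d_def scaleR_conv_of_real)
      have zi: "z $ i = of_real (sqrt (2*\<rho>)) * w $ i" if "i \<noteq> k" for i
        using that by (simp add: z_def d_def axis_def scaleR_conv_of_real)
      have wi: "cmod (w $ i) \<le> 1" for i
      proof (cases "i = k")
        case True
        have "1 - hinner z e = - of_real (r * (2 * \<rho>)) * w $ k"
          using r unfolding h zk by (simp add: algebra_simps)
        then have "cmod (1 - hinner z e) = r * (2 * \<rho>) * cmod (w $ k)"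
          using r \<rho> by (simp add: norm_mult)
        then have "r * (2 * \<rho>) * cmod (w $ k) < \<rho>" using z by (simp add: carleson_tent_def)
        moreover have "1/2 * (2 * \<rho>) * cmod (w $ k) \<le> r * (2 * \<rho>) * cmod (w $ k)"
          using r \<rho> by (intro mult_right_mono) auto
        ultimately have "\<rho> * cmod (w $ k) < \<rho> * 1" by simp
        then show ?thesis using \<rho> True by (subst (asm) mult_less_cancel_left_pos) auto
      next
        case False
        have "1 - cmod (hinner z e) < \<rho>"
          by (rule carleson_tent_bound(3)[OF z(1)]) (use r in \<open>simp add: e_def norm_axis_vec\<close>)
        moreover have "cmod (hinner z e) \<le> 1 * cmod (z $ k)"
          unfolding h norm_mult using r by (intro mult_right_mono) auto
        ultimately have zk1: "1 - cmod (z $ k) < \<rho>" by simp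
        have zk2: "cmod (z $ k) < 1" using Finite_Cartesian_Product.norm_nth_le[of z k] z by linarith
        have "(cmod (z $ i))\<^sup>2 + (cmod (z $ k))\<^sup>2 = (\<Sum>j\<in>{i,k}. (cmod (z $ j))\<^sup>2)"
          using False by simp
        also have "\<dots> \<le> (norm z)\<^sup>2" unfolding norm_sq_vec by (intro sum_mono2) auto
        also have "\<dots> \<le> 1" using z by (simp add: power_le_one)
        finally have "(cmod (z $ i))\<^sup>2 \<le> (1 - cmod (z $ k)) * (1 + cmod (z $ k))"
          by (simp add: power2_eq_square algebra_simps)
        also have "\<dots> \<le> \<rho> * 2" using zk1 zk2 \<rho> by (intro mult_mono) auto
        finally have "(cmod (w $ i))\<^sup>2 * (2 * \<rho>) \<le> 1 * (2 * \<rho>)"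
          using \<rho> by (simp add: zi[OF False] norm_mult power_mult_distrib mult.commute)
        then have "(cmod (w $ i))\<^sup>2 \<le> 1" using \<rho> by (subst (asm) mult_le_cancel_right_pos) auto
        then show ?thesis by (simp add: abs_square_le_1)
      qed
      have "norm w \<le> (\<Sum>i\<in>UNIV. norm (w $ i))" unfolding norm_vec_def by (intro L2_set_le_sum) simp
      also have "\<dots> \<le> (\<Sum>i\<in>(UNIV :: 'n set). 1)" by (intro sum_mono wi)
      finally show ?thesis by simp
    qed
    have "emeasure lborel (carleson_tent \<rho> a) = (\<integral>\<^sup>+z. indicator (carleson_tent \<rho> a) z \<partial>lborel)"
      by simp
    also have "\<dots> = (\<integral>\<^sup>+z. indicator (carleson_tent \<rho> a) (U z) \<partial>lborel)"
      by (intro nn_integral_isometry[symmetric] unitary_mapD[OF U(1)]) simp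
    also have "\<dots> = (\<integral>\<^sup>+z. indicator (carleson_tent \<rho> e) z \<partial>lborel)"
      unfolding Ue[symmetric] by (intro nn_integral_cong) (simp add: carleson_tent_def unitary_mapD[OF U(1)] indicator_def)
    also have "\<dots> = ennreal ((\<Prod>i\<in>UNIV. d i)\<^sup>2) * (\<integral>\<^sup>+w. indicator (carleson_tent \<rho> e) (?x + (\<chi> i. d i *\<^sub>R w $ i)) \<partial>lborel)"
      by (rule nn_integral_diag_affine[OF d]) simp
    also have "(\<integral>\<^sup>+w. indicator (carleson_tent \<rho> e) (?x + (\<chi> i. d i *\<^sub>R w $ i)) \<partial>lborel)
      \<le> (\<integral>\<^sup>+w. indicator (ball 0 (real CARD('n) + 1) :: (complex ^ 'n) set) w \<partial>lborel)"
      using sub by (intro nn_integral_mono) (auto simp: indicator_def)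
    also have "\<dots> = ?V" by simp
    finally show ?thesis by (simp add: P mult_left_mono)
  qed
qed

lemma nn_integral_powr_shift:
  fixes t c \<rho> :: real
  assumes t: "-1 < t" and \<rho>: "0 < \<rho>"
  shows "(\<integral>\<^sup>+s. ennreal ((s - c) powr t) * indicator {c..c+\<rho>} s \<partial>lborel) = ennreal (\<rho> powr (t + 1) / (t + 1))"
proof -
  have "(\<integral>\<^sup>+s. ennreal ((s - c) powr t) * indicator {c..c+\<rho>} s \<partial>lborel)
    = (\<integral>\<^sup>+s. ennreal ((c + 1 * s - c) powr t) * indicator {c..c+\<rho>} (c + 1 * s) \<partial>lborel)"
    by (subst nn_integral_real_affine[of _ 1 c]) auto
  also have "\<dots> = (\<integral>\<^sup>+s. ennreal (indicator {0..\<rho>} s * s powr t) \<partial>lborel)"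
    by (intro nn_integral_cong) (auto simp: indicator_def)
  also have "\<dots> = ennreal (\<rho> powr (t + 1) / (t + 1))"
    using nn_integral_has_integral_lebesgue[OF _ has_integral_powr_from_0[OF t, of \<rho>]] \<rho> by simp
  finally show ?thesis .
qed

text \<open>
  Averaging over dilations replaces integration in polar coordinates. For \<open>1 - \<kappa> < l < 1\<close> the
  integral over the tent is comparable to the integral of its dilate by \<open>l\<close>, which is supported in the
  tent of twice the size. Now integrate over \<open>l\<close> first: for a fixed point the
  weight contributes at most the integral of \<open>s powr t\<close> over \<open>{0..\<rho>}\<close>, which is finite since
  \<open>t > -1\<close>, and what is left is the volume of the larger tent.
\<close>

lemma nn_integral_carleson_tent_le:
  fixes a :: "complex ^ 'n"
  assumes t: "-1 < t" "t \<le> 0" and a: "norm a < 1" and \<rho>: "0 < \<rho>"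
  shows "ennreal (min \<rho> (1/2)) * (\<integral>\<^sup>+z. ennreal ((1 - (norm z)\<^sup>2) powr t) * indicator (carleson_tent \<rho> a) z \<partial>lborel)
    \<le> ennreal (4 ^ CARD('n) * (\<rho> powr (t + 1) / (t + 1)) * (4 * \<rho>) ^ (CARD('n) + 1))
        * emeasure lborel (ball 0 (real CARD('n) + 1) :: (complex ^ 'n) set)"
proof -
  define G where "G = (\<lambda>z :: complex ^ 'n. ennreal ((1 - (norm z)\<^sup>2) powr t) * indicator (carleson_tent \<rho> a) z)"
  have G[measurable]: "G \<in> borel_measurable borel" unfolding G_def by measurable
  define \<kappa> where "\<kappa> = min \<rho> (1/2)"
  \<comment> \<open>\<open>\<kappa> \<le> 1/2\<close> keeps \<open>l\<close> above \<open>1/2\<close>, so that dilating by \<open>1/l\<close> costs at most the factor \<open>4\<^sup>n\<close>\<close>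
  have \<kappa>: "0 < \<kappa>" "\<kappa> \<le> 1/2" "\<kappa> \<le> \<rho>" using \<rho> by (auto simp: \<kappa>_def)
  have scale: "(\<integral>\<^sup>+z. G z \<partial>lborel) \<le> ennreal (4 ^ CARD('n)) * (\<integral>\<^sup>+z. G ((1/l) *\<^sub>R z) \<partial>lborel)"
    if l: "l \<in> {1-\<kappa><..<1}" for l
  proof -
    have l0: "l \<ge> 1/2" using l \<kappa> by auto
    have "(\<integral>\<^sup>+z. G z \<partial>lborel) = ennreal ((\<Prod>i\<in>(UNIV :: 'n set). 1/l)\<^sup>2) * (\<integral>\<^sup>+w. G (0 + (\<chi> i. (1/l) *\<^sub>R w $ i)) \<partial>lborel)"
      using l0 by (intro nn_integral_diag_affine) auto
    also have "\<dots> = ennreal (((1/l)\<^sup>2) ^ CARD('n)) * (\<integral>\<^sup>+z. G ((1/l) *\<^sub>R z) \<partial>lborel)"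
    proof -
      have "0 + (\<chi> i. (1/l) *\<^sub>R w $ i) = (1/l) *\<^sub>R w" for w :: "complex ^ 'n" by (simp add: vec_eq_iff)
      then show ?thesis by (simp add: power_mult[symmetric] mult.commute)
    qed
    also have "\<dots> \<le> ennreal (4 ^ CARD('n)) * (\<integral>\<^sup>+z. G ((1/l) *\<^sub>R z) \<partial>lborel)"
    proof (intro mult_right_mono ennreal_leI power_mono)
      have "(1/l)\<^sup>2 \<le> 2\<^sup>2" using l0 by (intro power_mono) (auto simp: field_simps)
      then show "(1/l)\<^sup>2 \<le> 4" by simp
    qed auto
    finally show ?thesis .
  qed
  have inner: "(\<integral>\<^sup>+l. G ((1/l) *\<^sub>R z) * indicator {1-\<kappa><..<1} l \<partial>lborel)
      \<le> ennreal (\<rho> powr (t + 1) / (t + 1)) * indicator (carleson_tent (2*\<rho>) a) z" for z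
  proof -
    have key: "G ((1/l) *\<^sub>R z) * indicator {1-\<kappa><..<1} l
       \<le> (ennreal ((l - norm z) powr t) * indicator {norm z..norm z+\<rho>} l) * indicator (carleson_tent (2*\<rho>) a) z" for l
    proof (cases "l \<in> {1-\<kappa><..<1} \<and> (1/l) *\<^sub>R z \<in> carleson_tent \<rho> a")
      case True
      define y where "y = (1/l) *\<^sub>R z"
      have l: "1 - \<kappa> < l" "l < 1" "l > 0" using True \<kappa> by auto
      have z: "z = l *\<^sub>R y" using l by (simp add: y_def)
      have y: "y \<in> carleson_tent \<rho> a" "norm y < 1" using True by (auto simp: y_def carleson_tent_def)
      have nz: "norm z = l * norm y" using l by (simp add: z)
      have nz1: "norm z < l" unfolding nz using l y by (metis mult.right_neutral mult_less_cancel_left_pos)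
      have "l - norm z = l * (1 - norm y)" by (simp add: nz algebra_simps)
      also have "\<dots> \<le> 1 * (1 - norm y)" using l y by (intro mult_right_mono) auto
      also have "\<dots> < \<rho>" using carleson_tent_bound(1)[OF y(1) a] by simp
      finally have up: "l \<le> norm z + \<rho>" by simp
      have hz: "hinner z a = of_real l * hinner y a" by (simp add: z scaleR_conv_smult hinner_simps)
      have hy: "cmod (hinner y a) < 1" using one_minus_hinner(1)[OF a y(2)] .
      have "1 - hinner z a = (1 - hinner y a) + of_real (1 - l) * hinner y a"
        by (simp add: hz algebra_simps)
      then have "cmod (1 - hinner z a) \<le> cmod (1 - hinner y a) + cmod (of_real (1 - l) * hinner y a)"
        by (metis norm_triangle_ineq)
      also have "cmod (of_real (1 - l) * hinner y a) = (1 - l) * cmod (hinner y a)"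
        using l by (simp only: norm_mult norm_of_real)
      also have "\<dots> \<le> (1 - l) * 1" using l hy by (intro mult_left_mono) auto
      finally have "cmod (1 - hinner z a) < 2 * \<rho>" using y l \<kappa> by (simp add: carleson_tent_def)
      then have z2: "z \<in> carleson_tent (2*\<rho>) a" using nz1 l by (simp add: carleson_tent_def)
      have "l - norm z \<le> 1 - norm y"
        using \<open>l - norm z = l * (1 - norm y)\<close> l y by (simp add: mult_left_le_one_le)
      also have "\<dots> \<le> 1 - (norm y)\<^sup>2" using y by (simp add: power2_eq_square mult_left_le)
      finally have "(1 - (norm y)\<^sup>2) powr t \<le> (l - norm z) powr t"
        using nz1 t by (intro powr_mono2') auto
      then show ?thesis using z2 up nz1 l y \<kappa> by (simp add: G_def y_def[symmetric] ennreal_leI)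
    next
      case False
      then show ?thesis by (auto simp: G_def)
    qed
    have "(\<integral>\<^sup>+l. G ((1/l) *\<^sub>R z) * indicator {1-\<kappa><..<1} l \<partial>lborel)
      \<le> (\<integral>\<^sup>+l. (ennreal ((l - norm z) powr t) * indicator {norm z..norm z+\<rho>} l) * indicator (carleson_tent (2*\<rho>) a) z \<partial>lborel)"
      by (intro nn_integral_mono key)
    also have "\<dots> = (\<integral>\<^sup>+l. ennreal ((l - norm z) powr t) * indicator {norm z..norm z+\<rho>} l \<partial>lborel) * indicator (carleson_tent (2*\<rho>) a) z"
      by (intro nn_integral_multc) measurable
    finally show ?thesis by (simp only: nn_integral_powr_shift[OF t(1) \<rho>])
  qed
  define I where "I = (\<integral>\<^sup>+z. G z \<partial>lborel)"
  have meas: "(\<lambda>x. G ((1/fst x) *\<^sub>R snd x)) \<in> borel_measurable (lborel \<Otimes>\<^sub>M lborel)"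
    by measurable
  have "ennreal \<kappa> * I = (\<integral>\<^sup>+l. I * indicator {1-\<kappa><..<1} l \<partial>lborel)"
    using \<kappa> by (simp add: nn_integral_cmult_indicator mult.commute)
  also have "\<dots> \<le> (\<integral>\<^sup>+l. ennreal (4 ^ CARD('n)) * ((\<integral>\<^sup>+z. G ((1/l) *\<^sub>R z) \<partial>lborel) * indicator {1-\<kappa><..<1} l) \<partial>lborel)"
    using scale by (intro nn_integral_mono) (auto simp: indicator_def I_def)
  also have "\<dots> = ennreal (4 ^ CARD('n)) * (\<integral>\<^sup>+l. ((\<integral>\<^sup>+z. G ((1/l) *\<^sub>R z) \<partial>lborel) * indicator {1-\<kappa><..<1} l) \<partial>lborel)"
    by (intro nn_integral_cmult) measurable
  also have "(\<integral>\<^sup>+l. ((\<integral>\<^sup>+z. G ((1/l) *\<^sub>R z) \<partial>lborel) * indicator {1-\<kappa><..<1} l) \<partial>lborel)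
     = (\<integral>\<^sup>+l. (\<integral>\<^sup>+z. G ((1/l) *\<^sub>R z) * indicator {1-\<kappa><..<1} l \<partial>lborel) \<partial>lborel)"
    by (intro nn_integral_cong nn_integral_multc[symmetric]) measurable
  also have "\<dots> = (\<integral>\<^sup>+z. (\<integral>\<^sup>+l. G ((1/l) *\<^sub>R z) * indicator {1-\<kappa><..<1} l \<partial>lborel) \<partial>lborel)"
    by (rule lborel_pair.Fubini'[symmetric]) measurable
  also have "\<dots> \<le> (\<integral>\<^sup>+z. ennreal (\<rho> powr (t + 1) / (t + 1)) * indicator (carleson_tent (2*\<rho>) a) z \<partial>lborel)"
    by (intro nn_integral_mono inner)
  also have "\<dots> = ennreal (\<rho> powr (t + 1) / (t + 1)) * emeasure lborel (carleson_tent (2*\<rho>) a)"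
    by (simp add: nn_integral_cmult_indicator)
  also have "\<dots> \<le> ennreal (\<rho> powr (t + 1) / (t + 1)) * (ennreal ((2 * (2 * \<rho>)) ^ (CARD('n) + 1)) * emeasure lborel (ball 0 (real CARD('n) + 1) :: (complex ^ 'n) set))"
    using \<rho> by (intro mult_left_mono emeasure_carleson_tent_le a) auto
  finally have "ennreal \<kappa> * I \<le> ennreal (4 ^ CARD('n)) * (ennreal (\<rho> powr (t + 1) / (t + 1)) * (ennreal ((4 * \<rho>) ^ (CARD('n) + 1)) * emeasure lborel (ball 0 (real CARD('n) + 1) :: (complex ^ 'n) set)))"
    by (simp add: mult_left_mono)
  also have "\<dots> = ennreal (4 ^ CARD('n) * (\<rho> powr (t + 1) / (t + 1)) * (4 * \<rho>) ^ (CARD('n) + 1)) * emeasure lborel (ball 0 (real CARD('n) + 1) :: (complex ^ 'n) set)"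
  proof -
    have "ennreal A * (ennreal B * (ennreal C * V)) = ennreal (A * B * C) * V" if "0 \<le> A" "0 \<le> B" for A B C V
      using that by (simp add: ennreal_mult' mult.assoc)
    then show ?thesis using t by simp
  qed
  finally show ?thesis unfolding I_def G_def \<kappa>_def .
qed


text \<open>
  With \<open>t = p - 2q\<close> and \<open>R\<^sub>j = 2\<^sup>j (1 - |a|)\<close>, the part of the ball where
  \<open>R\<^sub>j \<le> |1 - \<langle>z,a\<rangle>| < 2 R\<^sub>j\<close> contributes at most a multiple of
  \<open>R\<^sub>j\<^bsup>n+1+t-p\<^esup> 2\<^bsup>-jp\<^esup>\<close>. The exponent of \<open>R\<^sub>j\<close> is \<open>n + 1 - 2q > 0\<close>, and only indices with
  \<open>R\<^sub>j \<le> 2\<close> occur, so a convergent geometric series that does not depend on \<open>a\<close> dominates the sum.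
\<close>

lemma weighted_kernel_integral_bounded:
  fixes p q :: real
  assumes p: "0 < p" and t: "-1 < p - 2 * q" "p - 2 * q \<le> 0" and q: "2 * q < real CARD('n) + 1"
  obtains K where "\<And>a :: complex ^ 'n. norm a < 1 \<Longrightarrow>
    (\<integral>\<^sup>+z. ennreal ((1 - (norm z)\<^sup>2) powr (p - 2 * q) * ((1 - (norm a)\<^sup>2) / (cmod (1 - hinner z a))\<^sup>2) powr p)
       * indicator (ball 0 1) z \<partial>lborel) \<le> ennreal K"
proof -
  define t where "t = p - 2 * q"
  define n where "n = real CARD('n)"
  define V where "V = measure lborel (ball 0 (real CARD('n) + 1) :: (complex ^ 'n) set)"
  have V: "emeasure lborel (ball 0 (real CARD('n) + 1) :: (complex ^ 'n) set) = ennreal V" "0 \<le> V"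
    unfolding V_def by (intro emeasure_eq_ennreal_measure) (use emeasure_lborel_ball_finite in \<open>simp_all add: less_top\<close>)
  define C where "C = 8 * 4 ^ CARD('n) / (t + 1) * 4 ^ (CARD('n) + 1) * V"
  have C: "0 \<le> C" using t V by (simp add: C_def t_def)
  have t': "-1 < t" "t \<le> 0" using t by (simp_all add: t_def)
  have tent: "(\<integral>\<^sup>+z. ennreal ((1 - (norm z)\<^sup>2) powr t) * indicator (carleson_tent \<rho> a) z \<partial>lborel)
      \<le> ennreal (C * \<rho> powr (n + 1 + t))" if a: "norm a < 1" and \<rho>: "0 < \<rho>" "\<rho> \<le> 4" for a :: "complex ^ 'n" and \<rho>
  proof -
    let ?I = "\<integral>\<^sup>+z. ennreal ((1 - (norm z)\<^sup>2) powr t) * indicator (carleson_tent \<rho> a) z \<partial>lborel"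
    have "ennreal (\<rho> / 8) * ?I \<le> ennreal (min \<rho> (1/2)) * ?I"
      using \<rho> by (intro mult_right_mono ennreal_leI) auto
    also have "\<dots> \<le> ennreal (4 ^ CARD('n) * (\<rho> powr (t + 1) / (t + 1)) * (4 * \<rho>) ^ (CARD('n) + 1)) * ennreal V"
      unfolding V(1)[symmetric] by (rule nn_integral_carleson_tent_le[OF t' a \<rho>(1)])
    also have "\<dots> = ennreal (4 ^ CARD('n) * (\<rho> powr (t + 1) / (t + 1)) * (4 * \<rho>) ^ (CARD('n) + 1) * V)"
      using \<rho> t' V by (intro ennreal_mult'[symmetric]) simp
    also have "4 ^ CARD('n) * (\<rho> powr (t + 1) / (t + 1)) * (4 * \<rho>) ^ (CARD('n) + 1) * V
       = (\<rho> / 8) * (C * (\<rho> powr (t + 1) * \<rho> ^ CARD('n)))"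
    proof -
      have "(4 * \<rho>) ^ (CARD('n) + 1) = 4 ^ (CARD('n) + 1) * (\<rho> ^ CARD('n) * \<rho>)"
        unfolding power_mult_distrib by simp
      then show ?thesis unfolding C_def by (simp only:) simp
    qed
    also have "\<rho> powr (t + 1) * \<rho> ^ CARD('n) = \<rho> powr (n + 1 + t)"
      unfolding powr_realpow[OF \<rho>(1), of "CARD('n)", symmetric] powr_add[symmetric] by (simp add: n_def add_ac)
    also have "ennreal (\<rho> / 8 * (C * \<rho> powr (n + 1 + t))) = ennreal (\<rho> / 8) * ennreal (C * \<rho> powr (n + 1 + t))"
      using \<rho> by (intro ennreal_mult') simp
    finally show ?thesis using \<rho> by (subst (asm) ennreal_mult_le_mult_iff) auto
  qed
  define e where "e = n + 1 + t - p"
  have e: "e > 0" using q by (simp add: e_def t_def n_def)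
  define C' where "C' = 2 powr p * (C * 2 powr (n + 1 + t)) * 2 powr e"
  have C': "0 \<le> C'" using C by (simp add: C'_def)
  define b where "b = (1/2 :: real) powr p"
  have b: "0 < b" "b < 1" using p powr_less_mono2[of p "1/2" 1] by (auto simp: b_def)
  have summ: "summable (\<lambda>j. C' * b ^ j)" using b by (intro summable_mult summable_geometric) auto
  have main: "(\<integral>\<^sup>+z. ennreal ((1 - (norm z)\<^sup>2) powr t * ((1 - (norm a)\<^sup>2) / (cmod (1 - hinner z a))\<^sup>2) powr p)
       * indicator (ball 0 1) z \<partial>lborel) \<le> ennreal (\<Sum>j. C' * b ^ j)" if a: "norm a < 1" for a :: "complex ^ 'n"
  proof -
    define \<delta> where "\<delta> = 1 - norm a"
    have \<delta>: "0 < \<delta>" "\<delta> \<le> 1" using a by (auto simp: \<delta>_def)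
    define R where "R = (\<lambda>j::nat. 2 ^ j * \<delta>)"
    have R: "R j > 0" for j using \<delta> by (simp add: R_def)
    \<comment> \<open>the cut-off at \<open>2\<close> is harmless since \<open>|1 - \<langle>z,a\<rangle>| \<le> 2\<close>\<close>
    define w where "w = (\<lambda>j. if R j \<le> 2 then ((1 - (norm a)\<^sup>2) / (R j)\<^sup>2) powr p else 0)"
    have a2: "0 < 1 - (norm a)\<^sup>2" using a by (simp add: abs_square_less_1)
    have a2\<delta>: "1 - (norm a)\<^sup>2 \<le> 2 * \<delta>"
    proof -
      have "1 - (norm a)\<^sup>2 = \<delta> * (1 + norm a)" by (simp add: \<delta>_def power2_eq_square algebra_simps)
      also have "\<dots> \<le> \<delta> * 2" using a \<delta> by (intro mult_left_mono) auto
      finally show ?thesis by simp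
    qed
    have pt: "ennreal ((1 - (norm z)\<^sup>2) powr t * ((1 - (norm a)\<^sup>2) / (cmod (1 - hinner z a))\<^sup>2) powr p) * indicator (ball 0 1) z
       \<le> (\<Sum>j. ennreal (w j) * (ennreal ((1 - (norm z)\<^sup>2) powr t) * indicator (carleson_tent (2 * R j) a) z))" for z
    proof (cases "norm z < 1")
      case True
      define x where "x = cmod (1 - hinner z a)"
      have x: "\<delta> \<le> x" "x \<le> 2"
      proof -
        show "\<delta> \<le> x" using one_minus_hinner(2)[OF a True] by (simp add: x_def \<delta>_def)
        have "x \<le> cmod 1 + cmod (hinner z a)" unfolding x_def by (rule norm_triangle_ineq4)
        then show "x \<le> 2" using one_minus_hinner(1)[OF a True] by simp
      qed
      obtain N where "x / \<delta> < 2 ^ N" using real_arch_pow[of 2 "x/\<delta>"] by auto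
      then have ex: "\<exists>N. x < R N" using \<delta> by (auto simp: R_def field_simps intro!: exI[of _ N])
      define M where "M = (LEAST N. x < R N)"
      have M1: "x < R M" unfolding M_def by (rule LeastI_ex[OF ex])
      have M2: "R k \<le> x" if "k < M" for k
        using not_less_Least[OF that[unfolded M_def]] by simp
      have "M \<noteq> 0"
      proof
        assume "M = 0" then have "x < \<delta>" using M1 by (simp add: R_def)
        then show False using x by simp
      qed
      then obtain j where j: "M = Suc j" by (cases M) auto
      have Rj: "R j \<le> x" "x < 2 * R j" using M2[of j] M1 j by (auto simp: R_def)
      have "((1 - (norm a)\<^sup>2) / x\<^sup>2) powr p \<le> ((1 - (norm a)\<^sup>2) / (R j)\<^sup>2) powr p"
        using a2 Rj R[of j] p by (intro powr_mono2 divide_left_mono power_mono) auto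
      also have "\<dots> = w j" using Rj x by (simp add: w_def)
      finally have "(1 - (norm z)\<^sup>2) powr t * ((1 - (norm a)\<^sup>2) / x\<^sup>2) powr p \<le> (1 - (norm z)\<^sup>2) powr t * w j"
        by (intro mult_left_mono) auto
      then have "ennreal ((1 - (norm z)\<^sup>2) powr t * ((1 - (norm a)\<^sup>2) / x\<^sup>2) powr p)
         \<le> ennreal ((1 - (norm z)\<^sup>2) powr t * w j)" by (rule ennreal_leI)
      also have "\<dots> \<le> ennreal (w j) * (ennreal ((1 - (norm z)\<^sup>2) powr t) * indicator (carleson_tent (2 * R j) a) z)"
        using Rj True by (simp add: carleson_tent_def x_def[symmetric] ennreal_mult''[symmetric] mult.commute)
      also have "\<dots> \<le> (\<Sum>j. ennreal (w j) * (ennreal ((1 - (norm z)\<^sup>2) powr t) * indicator (carleson_tent (2 * R j) a) z))"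
        using sum_le_suminf[of "\<lambda>j. ennreal (w j) * (ennreal ((1 - (norm z)\<^sup>2) powr t) * indicator (carleson_tent (2 * R j) a) z)" "{j}"]
        by (simp add: summableI)
      finally show ?thesis using True by (simp add: x_def)
    qed simp
    have shell: "ennreal (w j) * (\<integral>\<^sup>+z. ennreal ((1 - (norm z)\<^sup>2) powr t) * indicator (carleson_tent (2 * R j) a) z \<partial>lborel)
       \<le> ennreal (C' * b ^ j)" for j
    proof (cases "R j \<le> 2")
      case True
      have "(1 - (norm a)\<^sup>2) / (R j)\<^sup>2 \<le> 2 * \<delta> / (R j)\<^sup>2"
        using a2\<delta> by (intro divide_right_mono) auto
      also have "\<dots> = 2 * (1/2) ^ j / R j"
        using \<delta> by (simp add: R_def power2_eq_square field_simps power_mult_distrib[symmetric])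
      finally have "w j \<le> (2 * (1/2) ^ j / R j) powr p"
        using True a2 p by (simp add: w_def powr_mono2)
      also have "\<dots> = 2 powr p * b ^ j * R j powr (-p)"
      proof -
        have "(1/2::real) ^ j = (1/2) powr real j" by (rule powr_realpow[symmetric]) simp
        then have "((1/2::real) ^ j) powr p = (1/2) powr (real j * p)" by (simp only: powr_powr)
        then have "((1/2::real) ^ j) powr p = b ^ j" by (simp add: b_def powr_power mult.commute)
        then show ?thesis using R[of j] by (simp add: powr_mult powr_divide powr_minus_divide)
      qed
      finally have w: "w j \<le> 2 powr p * b ^ j * R j powr (-p)" .
      have "ennreal (w j) * (\<integral>\<^sup>+z. ennreal ((1 - (norm z)\<^sup>2) powr t) * indicator (carleson_tent (2 * R j) a) z \<partial>lborel)
         \<le> ennreal (2 powr p * b ^ j * R j powr (-p)) * ennreal (C * (2 * R j) powr (n + 1 + t))"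
        using True R[of j] by (intro mult_mono ennreal_leI w tent a) auto
      also have "\<dots> = ennreal (2 powr p * b ^ j * R j powr (-p) * (C * (2 * R j) powr (n + 1 + t)))"
        using b by (intro ennreal_mult'[symmetric]) simp
      also have "2 powr p * b ^ j * R j powr (-p) * (C * (2 * R j) powr (n + 1 + t))
         = 2 powr p * (C * 2 powr (n + 1 + t)) * R j powr e * b ^ j"
      proof -
        have "R j powr e = R j powr (n + 1 + t) * R j powr (-p)"
          by (simp add: e_def powr_add[symmetric])
        then show ?thesis using R[of j] by (simp add: powr_mult)
      qed
      also have "\<dots> \<le> C' * b ^ j"
        unfolding C'_def using True R[of j] e C b by (intro mult_right_mono mult_left_mono powr_mono2) auto
      finally show ?thesis by (simp add: ennreal_leI)
    qed (simp add: w_def)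
    have "(\<integral>\<^sup>+z. ennreal ((1 - (norm z)\<^sup>2) powr t * ((1 - (norm a)\<^sup>2) / (cmod (1 - hinner z a))\<^sup>2) powr p) * indicator (ball 0 1) z \<partial>lborel)
      \<le> (\<integral>\<^sup>+z. (\<Sum>j. ennreal (w j) * (ennreal ((1 - (norm z)\<^sup>2) powr t) * indicator (carleson_tent (2 * R j) a) z)) \<partial>lborel)"
      by (intro nn_integral_mono pt)
    also have "\<dots> = (\<Sum>j. \<integral>\<^sup>+z. ennreal (w j) * (ennreal ((1 - (norm z)\<^sup>2) powr t) * indicator (carleson_tent (2 * R j) a) z) \<partial>lborel)"
      by (intro nn_integral_suminf) measurable
    also have "\<dots> = (\<Sum>j. ennreal (w j) * (\<integral>\<^sup>+z. ennreal ((1 - (norm z)\<^sup>2) powr t) * indicator (carleson_tent (2 * R j) a) z \<partial>lborel))"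
      by (intro suminf_cong nn_integral_cmult) measurable
    also have "\<dots> \<le> (\<Sum>j. ennreal (C' * b ^ j))"
      by (intro suminf_le shell summableI)
    also have "\<dots> = ennreal (\<Sum>j. C' * b ^ j)"
      using C' b by (intro suminf_ennreal2 summ) simp
    finally show ?thesis .
  qed
  show ?thesis using that[of "\<Sum>j. C' * b ^ j"] main unfolding t_def by blast
qed

text \<open>
  The bound \<open>|f|\<^sup>2 \<le> B\<^sup>2 (1 - |z|\<^sup>2)\<^bsup>-2q\<^esup>\<close> turns the integrand into \<open>(1 - |z|\<^sup>2)\<^bsup>p-2q\<^esup>\<close> times the part of
  the kernel that depends on \<open>a\<close>.
\<close>

theorem growth_space_subset_Np_space:
  fixes p q :: real
  assumes p: "0 < p" and t: "-1 < p - 2 * q" "p - 2 * q \<le> 0" and q: "2 * q < real CARD('n) + 1"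
  shows "growth_space q \<subseteq> (Np_space p :: (complex ^ 'n \<Rightarrow> complex) set)"
proof
  fix f :: "complex ^ 'n \<Rightarrow> complex" assume fG: "f \<in> growth_space q"
  then have f: "cn_holomorphic_on f (ball 0 1)" by (simp add: growth_space_def)
  note contf = cn_holomorphic_imp_continuous[OF f]
  obtain B where B: "0 \<le> B" "growth_norm q f = ennreal B"
    using fG by (cases "growth_norm q f") (auto simp: growth_space_def)
  have fB: "cmod (f z) * (1 - (norm z)\<^sup>2) powr q \<le> B" if "norm z < 1" for z
  proof -
    have "ennreal (cmod (f z) * (1 - (norm z)\<^sup>2) powr q) \<le> ennreal B"
      unfolding B(2)[symmetric] growth_norm_def using that by (intro SUP_upper) simp
    then show ?thesis using B by simp
  qed
  obtain K where K: "\<And>a :: complex ^ 'n. norm a < 1 \<Longrightarrow>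
    (\<integral>\<^sup>+z. ennreal ((1 - (norm z)\<^sup>2) powr (p - 2 * q) * ((1 - (norm a)\<^sup>2) / (cmod (1 - hinner z a))\<^sup>2) powr p)
       * indicator (ball 0 1) z \<partial>lborel) \<le> ennreal K"
    using weighted_kernel_integral_bounded[OF assms] by blast
  have "energy p f a \<le> ennreal (B\<^sup>2 * K)" if a: "a \<in> ball 0 1" for a
  proof -
    have na: "norm a < 1" using a by simp
    have "energy p f a \<le> (\<integral>\<^sup>+z. ennreal (B\<^sup>2) * (ennreal ((1 - (norm z)\<^sup>2) powr (p - 2 * q) * ((1 - (norm a)\<^sup>2) / (cmod (1 - hinner z a))\<^sup>2) powr p)
       * indicator (ball 0 1) z) \<partial>lborel)"
      unfolding energy_def
    proof (rule nn_integral_mono)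
      fix z :: "complex ^ 'n"
      show "ennreal ((cmod (f z))\<^sup>2 * mobius_kernel a z powr p) * indicator (ball 0 1) z
        \<le> ennreal (B\<^sup>2) * (ennreal ((1 - (norm z)\<^sup>2) powr (p - 2 * q) * ((1 - (norm a)\<^sup>2) / (cmod (1 - hinner z a))\<^sup>2) powr p) * indicator (ball 0 1) z)"
      proof (cases "norm z < 1")
        case True
        define x where "x = 1 - (norm z)\<^sup>2"
        have x: "x > 0" using True by (simp add: x_def abs_square_less_1)
        define y where "y = (1 - (norm a)\<^sup>2) / (cmod (1 - hinner z a))\<^sup>2"
        have y: "y \<ge> 0" using na by (simp add: y_def power_le_one)
        have "cmod (f z) * x powr q \<le> B" using fB[OF True] by (simp add: x_def)
        then have "(cmod (f z) * x powr q)\<^sup>2 \<le> B\<^sup>2" using x by (intro power_mono) auto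
        then have "(cmod (f z))\<^sup>2 * x powr (2 * q) \<le> B\<^sup>2"
          using x by (simp add: power_mult_distrib powr_power mult.commute)
        then have "((cmod (f z))\<^sup>2 * x powr (2 * q)) * (x powr (p - 2 * q) * y powr p) \<le> B\<^sup>2 * (x powr (p - 2 * q) * y powr p)"
          by (intro mult_right_mono) auto
        moreover have "((cmod (f z))\<^sup>2 * x powr (2 * q)) * (x powr (p - 2 * q) * y powr p) = (cmod (f z))\<^sup>2 * (y * x) powr p"
        proof -
          have xp: "x powr p = x powr (2 * q) * x powr (p - 2 * q)" by (simp add: powr_add[symmetric])
          have yx: "(y * x) powr p = y powr p * x powr p" using x y by (simp add: powr_mult)
          have "((cmod (f z))\<^sup>2 * x powr (2 * q)) * (x powr (p - 2 * q) * y powr p)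
              = (cmod (f z))\<^sup>2 * (y powr p * (x powr (2 * q) * x powr (p - 2 * q)))"
            by (simp only: mult_ac)
          then show ?thesis by (simp only: yx xp)
        qed
        moreover have "(1 - (norm a)\<^sup>2) * x / (cmod (1 - hinner z a))\<^sup>2 = y * x" by (simp add: y_def)
        ultimately show ?thesis using True
          by (simp add: x_def[symmetric] y_def[symmetric] ennreal_mult'[symmetric] ennreal_leI)
      qed simp
    qed
    also have "\<dots> = ennreal (B\<^sup>2) * (\<integral>\<^sup>+z. ennreal ((1 - (norm z)\<^sup>2) powr (p - 2 * q) * ((1 - (norm a)\<^sup>2) / (cmod (1 - hinner z a))\<^sup>2) powr p)
       * indicator (ball 0 1) z \<partial>lborel)"
    proof (intro nn_integral_cmult)
      have 1: "\<forall>x\<in>ball 0 1. 1 - (norm (x :: complex ^ 'n))\<^sup>2 \<noteq> 0"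
      proof
        fix x :: "complex ^ 'n" assume "x \<in> ball 0 1"
        then have "(norm x)\<^sup>2 < 1" by (simp add: abs_square_less_1)
        then show "1 - (norm x)\<^sup>2 \<noteq> 0" by simp
      qed
      have a2: "1 - (norm a)\<^sup>2 \<noteq> 0" using na abs_square_less_1[of "norm a"] by simp
      have "(\<lambda>z. ennreal ((1 - (norm z)\<^sup>2) powr (p - 2 * q) * ((1 - (norm a)\<^sup>2) / (cmod (1 - hinner z a))\<^sup>2) powr p)
         * indicator (ball 0 1) z) \<in> borel_measurable borel"
      proof (intro ball_borel_measurable continuous_intros 1)
        show 2: "\<forall>x\<in>ball 0 1. (cmod (1 - hinner x a))\<^sup>2 \<noteq> 0"
          using one_minus_hinner(3)[OF na] by auto
        then show "\<forall>x\<in>ball 0 1. (1 - (norm a)\<^sup>2) / (cmod (1 - hinner x a))\<^sup>2 \<noteq> 0"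
          using a2 by simp
      qed
      then show "(\<lambda>z. ennreal ((1 - (norm z)\<^sup>2) powr (p - 2 * q) * ((1 - (norm a)\<^sup>2) / (cmod (1 - hinner z a))\<^sup>2) powr p)
         * indicator (ball 0 1) z) \<in> borel_measurable lborel"
        by (simp only: measurable_lborel2)
    qed
    also have "\<dots> \<le> ennreal (B\<^sup>2) * ennreal K" by (intro mult_left_mono K na) simp
    also have "\<dots> = ennreal (B\<^sup>2 * K)" by (simp add: ennreal_mult')
    finally show ?thesis .
  qed
  then have "Np_norm p f < \<infinity>" unfolding Np_norm_finite_iff[OF contf] by blast
  then show "f \<in> Np_space p" using f by (simp add: Np_space_def)
qed


section \<open>Locally uniform limits of holomorphic functions\<close>

text \<open>
  Cauchy's estimate on the complex line through \<open>z\<close> in the direction of \<open>h\<close>.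
\<close>

lemma norm_derivative_le:
  fixes g :: "complex ^ 'n \<Rightarrow> complex"
  assumes g: "cn_holomorphic_on g S" and sub: "cball z \<rho> \<subseteq> S" and \<rho>: "0 < \<rho>"
    and B: "\<And>w. w \<in> cball z \<rho> \<Longrightarrow> cmod (g w) \<le> B"
    and D: "(g has_derivative D) (at z)" "\<And>c v. D (c *s v) = c * D v"
  shows "cmod (D h) \<le> B / \<rho> * norm h"
proof (cases "h = 0")
  case True
  then show ?thesis using D(2)[of 0 0] by simp
next
  case False
  define R where "R = \<rho> / norm h"
  have R: "R > 0" using \<rho> False by (simp add: R_def)
  \<comment> \<open>the restriction of \<open>g\<close> to a complex line; \<open>R\<close> is the largest radius for which the line stays in \<open>cball z \<rho>\<close>\<close>
  define \<phi> where "\<phi> = (\<lambda>\<zeta>. g (z + \<zeta> *s h))"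
  have mem: "z + \<zeta> *s h \<in> cball z \<rho>" if "\<zeta> \<in> cball 0 R" for \<zeta>
    using that False by (simp add: dist_norm norm_smult R_def field_simps)
  have hol: "\<phi> holomorphic_on cball 0 R"
    unfolding \<phi>_def by (rule cn_holomorphic_on_slice[OF g]) (use mem sub in blast)
  have "(\<phi> has_field_derivative D h) (at 0)"
    unfolding \<phi>_def using cn_holomorphic_slice[of g D z 0 h] D by simp
  then have "deriv \<phi> 0 = D h" by (rule DERIV_imp_deriv)
  moreover have "cmod ((deriv ^^ 1) \<phi> 0) \<le> fact 1 * B / R ^ 1"
  proof (rule Cauchy_inequality)
    show "\<phi> holomorphic_on ball 0 R" using hol by (rule holomorphic_on_subset) auto
    show "continuous_on (cball 0 R) \<phi>" using hol by (rule holomorphic_on_imp_continuous_on)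
    show "cmod (\<phi> x) \<le> B" if "cmod (0 - x) = R" for x
      unfolding \<phi>_def using that by (intro B mem) simp
  qed (rule R)
  ultimately show ?thesis by (simp add: R_def)
qed

text \<open>
  By Cauchy's estimate the derivatives form a uniformly Cauchy sequence near each point as well, so
  differentiation and limit can be exchanged, and complex linearity passes to the limit.
\<close>

lemma cn_holomorphic_on_uniform_limit:
  fixes F :: "nat \<Rightarrow> complex ^ 'n \<Rightarrow> complex"
  assumes F: "\<And>m. cn_holomorphic_on (F m) (ball 0 1)"
    and lim: "\<And>r. r < 1 \<Longrightarrow> uniform_limit (cball 0 r) F f sequentially"
  shows "cn_holomorphic_on f (ball 0 1)"
  unfolding cn_holomorphic_on_def
proof
  fix z0 :: "complex ^ 'n" assume z0: "z0 \<in> ball 0 1"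
  define \<rho> where "\<rho> = (1 - norm z0) / 4"
  have \<rho>: "\<rho> > 0" using z0 by (simp add: \<rho>_def)
  define r where "r = norm z0 + 2 * \<rho>"
  have r: "r < 1" using z0 by (simp add: r_def \<rho>_def field_simps)
  define S where "S = ball z0 \<rho>"
  have cb: "cball x \<rho> \<subseteq> cball 0 r" if "x \<in> S" for x
  proof
    fix y assume "y \<in> cball x \<rho>"
    then have "norm (y - z0) \<le> 2 * \<rho>"
      using that norm_triangle_ineq[of "y - x" "x - z0"] by (auto simp: S_def dist_norm norm_minus_commute)
    then show "y \<in> cball 0 r" using norm_triangle_ineq[of "y - z0" z0] by (simp add: r_def)
  qed
  have cb1: "cball 0 r \<subseteq> ball 0 1" using r by auto
  have Sb: "x \<in> ball 0 1" if "x \<in> S" for x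
    using cb[OF that] cb1 \<rho> centre_in_cball[of x \<rho>] by (meson less_imp_le subsetD)
  have "\<forall>m. \<forall>x. \<exists>D. x \<in> ball 0 1 \<longrightarrow> (F m has_derivative D) (at x) \<and> (\<forall>c v. D (c *s v) = c * D v)"
    using F unfolding cn_holomorphic_on_def by blast
  then obtain F' where F': "\<And>m x. x \<in> ball 0 1 \<Longrightarrow> (F m has_derivative F' m x) (at x)"
    "\<And>m x c v. x \<in> ball 0 1 \<Longrightarrow> F' m x (c *s v) = c * F' m x v" by metis
  have unif: "\<exists>N. \<forall>m\<ge>N. \<forall>n\<ge>N. \<forall>x\<in>S. \<forall>h. cmod (F' m x h - F' n x h) \<le> e * norm h" if e: "e > 0" for e
  proof -
    have "uniformly_Cauchy_on (cball 0 r) F"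
      using lim[OF r] uniformly_convergent_Cauchy uniformly_convergent_on_def by blast
    then obtain N where N: "\<And>x m n. x \<in> cball 0 r \<Longrightarrow> N \<le> m \<Longrightarrow> N \<le> n \<Longrightarrow> dist (F m x) (F n x) < e * \<rho>"
      unfolding uniformly_Cauchy_on_def using e \<rho> by (meson mult_pos_pos)
    have "cmod (F' m x h - F' n x h) \<le> e * norm h" if mn: "N \<le> m" "N \<le> n" and x: "x \<in> S" for m n x h
    proof -
      have "cn_holomorphic_on (\<lambda>x. F m x - F n x) (ball 0 1)"
        unfolding cn_holomorphic_on_def
      proof
        fix y :: "complex ^ 'n" assume y: "y \<in> ball 0 1"
        show "\<exists>D. ((\<lambda>x. F m x - F n x) has_derivative D) (at y) \<and> (\<forall>c v. D (c *s v) = c * D v)"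
          using has_derivative_diff[OF F'(1)[OF y, of m] F'(1)[OF y, of n]] F'(2)[OF y]
          by (intro exI[of _ "\<lambda>h. F' m y h - F' n y h"]) (simp add: right_diff_distrib)
      qed
      then have "cmod (F' m x h - F' n x h) \<le> (e * \<rho>) / \<rho> * norm h"
      proof (rule norm_derivative_le[where z=x and D="\<lambda>h. F' m x h - F' n x h"])
        show "cball x \<rho> \<subseteq> ball 0 1" using cb[OF x] cb1 by blast
        show "((\<lambda>x. F m x - F n x) has_derivative (\<lambda>h. F' m x h - F' n x h)) (at x)"
          by (intro has_derivative_diff F'(1) Sb x)
        show "cmod (F m w - F n w) \<le> e * \<rho>" if "w \<in> cball x \<rho>" for w
          using N[of w m n] mn cb[OF x] that by (auto simp: dist_norm less_imp_le)
      qed (use \<rho> in \<open>simp_all add: F'(2)[OF Sb[OF x]] right_diff_distrib\<close>)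
      then show ?thesis using \<rho> by simp
    qed
    then show ?thesis by blast
  qed
  define g' where "g' = (\<lambda>x h. lim (\<lambda>m. F' m x h))"
  have g': "(\<lambda>m. F' m x h) \<longlonglongrightarrow> g' x h" if x: "x \<in> S" for x h
  proof -
    have "Cauchy (\<lambda>m. F' m x h)"
    proof (rule metric_CauchyI)
      fix e :: real assume e: "e > 0"
      have e': "e / (norm h + 1) > 0" using e by (simp add: add_nonneg_pos)
      obtain N where N: "\<And>m n. m \<ge> N \<Longrightarrow> n \<ge> N \<Longrightarrow> cmod (F' m x h - F' n x h) \<le> e / (norm h + 1) * norm h"
        using unif[OF e'] x by blast
      have pos: "norm h + 1 > 0" by (simp add: add_nonneg_pos)
      have "e / (norm h + 1) * norm h < e / (norm h + 1) * (norm h + 1)"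
        by (intro mult_strict_left_mono e') simp
      also have "\<dots> = e" using pos by simp
      finally have "e / (norm h + 1) * norm h < e" .
      then show "\<exists>M. \<forall>m\<ge>M. \<forall>n\<ge>M. dist (F' m x h) (F' n x h) < e"
        using N by (intro exI[of _ N]) (force simp: dist_norm)
    qed
    then show ?thesis unfolding g'_def by (simp add: Cauchy_convergent_iff convergent_LIMSEQ_iff)
  qed
  have "\<exists>g. \<forall>x\<in>S. (\<lambda>m. F m x) \<longlonglongrightarrow> g x \<and> (g has_derivative g' x) (at x within S)"
  proof (rule has_derivative_sequence)
    show "convex S" by (simp add: S_def)
    show "(F m has_derivative F' m x) (at x within S)" if "x \<in> S" for m x
      by (rule has_derivative_at_withinI[OF F'(1)[OF Sb[OF that]]])
    show "\<forall>\<^sub>F m in sequentially. \<forall>x\<in>S. \<forall>h. norm (F' m x h - g' x h) \<le> e * norm h" if "e > 0" for e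
    proof -
      obtain N where N: "\<And>m n x h. m \<ge> N \<Longrightarrow> n \<ge> N \<Longrightarrow> x \<in> S \<Longrightarrow> cmod (F' m x h - F' n x h) \<le> e * norm h"
        using unif[OF \<open>e > 0\<close>] by blast
      have "norm (F' m x h - g' x h) \<le> e * norm h" if "m \<ge> N" "x \<in> S" for m x h
      proof (rule tendsto_upperbound)
        show "(\<lambda>n. norm (F' m x h - F' n x h)) \<longlonglongrightarrow> norm (F' m x h - g' x h)"
          by (intro tendsto_intros g' that)
        show "\<forall>\<^sub>F n in sequentially. norm (F' m x h - F' n x h) \<le> e * norm h"
          using N that by (auto simp: eventually_sequentially intro!: exI[of _ N])
      qed simp
      then show ?thesis by (auto simp: eventually_sequentially)
    qed
    show "z0 \<in> S" using \<rho> by (simp add: S_def)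
    show "(\<lambda>m. F m z0) \<longlonglongrightarrow> f z0"
      using tendsto_uniform_limitI[OF lim[OF r]] cb \<rho> by (auto simp: r_def)
  qed
  then obtain g where g: "\<And>x. x \<in> S \<Longrightarrow> (\<lambda>m. F m x) \<longlonglongrightarrow> g x"
    "\<And>x. x \<in> S \<Longrightarrow> (g has_derivative g' x) (at x within S)" by blast
  have z0S: "z0 \<in> S" using \<rho> by (simp add: S_def)
  have fg: "f x = g x" if "x \<in> S" for x
  proof -
    have "x \<in> cball 0 r" using cb[OF that] \<rho> centre_in_cball[of x \<rho>] by (meson less_imp_le subsetD)
    then have "(\<lambda>m. F m x) \<longlonglongrightarrow> f x" by (rule tendsto_uniform_limitI[OF lim[OF r]])
    then show ?thesis using g(1)[OF that] LIMSEQ_unique by blast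
  qed
  have "(g has_derivative g' z0) (at z0)"
    using g(2)[OF z0S] at_within_open[OF z0S] by (simp add: S_def)
  then have "(f has_derivative g' z0) (at z0)"
    by (rule has_derivative_transform_within_open[of _ _ _ _ S]) (use z0S fg in \<open>auto simp: S_def\<close>)
  moreover have "g' z0 (c *s v) = c * g' z0 v" for c v
  proof -
    have "(\<lambda>m. F' m z0 (c *s v)) \<longlonglongrightarrow> c * g' z0 v"
      unfolding F'(2)[OF z0] by (intro tendsto_intros g' z0S)
    then show ?thesis using g'[OF z0S] LIMSEQ_unique by blast
  qed
  ultimately show "\<exists>D. (f has_derivative D) (at z0) \<and> (\<forall>c v. D (c *s v) = c * D v)" by blast
qed

section \<open>Monomials and their orthogonality\<close>

definition monomial :: "('n \<Rightarrow> nat) \<Rightarrow> complex ^ 'n \<Rightarrow> complex" where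
  "monomial \<alpha> z = (\<Prod>i\<in>UNIV. z $ i ^ \<alpha> i)"

lemma cn_holomorphic_on_add:
  assumes "cn_holomorphic_on f S" "cn_holomorphic_on g S"
  shows "cn_holomorphic_on (\<lambda>z. f z + g z) S"
  unfolding cn_holomorphic_on_def
proof
  fix z assume "z \<in> S"
  then obtain D E where "(f has_derivative D) (at z)" "\<And>c v. D (c *s v) = c * D v"
    "(g has_derivative E) (at z)" "\<And>c v. E (c *s v) = c * E v"
    using assms unfolding cn_holomorphic_on_def by metis
  then show "\<exists>D. ((\<lambda>z. f z + g z) has_derivative D) (at z) \<and> (\<forall>c v. D (c *s v) = c * D v)"
    by (intro exI[of _ "\<lambda>h. D h + E h"]) (auto intro: has_derivative_add simp: distrib_left)
qed

lemma cn_holomorphic_on_mult: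
  assumes "cn_holomorphic_on f S" "cn_holomorphic_on g S"
  shows "cn_holomorphic_on (\<lambda>z. f z * g z) S"
  unfolding cn_holomorphic_on_def
proof
  fix z assume "z \<in> S"
  then obtain D E where "(f has_derivative D) (at z)" "\<And>c v. D (c *s v) = c * D v"
    "(g has_derivative E) (at z)" "\<And>c v. E (c *s v) = c * E v"
    using assms unfolding cn_holomorphic_on_def by metis
  then show "\<exists>D. ((\<lambda>z. f z * g z) has_derivative D) (at z) \<and> (\<forall>c v. D (c *s v) = c * D v)"
    by (intro exI[of _ "\<lambda>h. f z * E h + D h * g z"] conjI allI has_derivative_mult) (auto simp: algebra_simps)
qed

lemma cn_holomorphic_on_const: "cn_holomorphic_on (\<lambda>_. c) S"
  unfolding cn_holomorphic_on_def by (auto intro!: exI[of _ "\<lambda>_. 0"])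

lemma cn_holomorphic_on_nth: "cn_holomorphic_on (\<lambda>z. z $ i) S"
  unfolding cn_holomorphic_on_def
  by (auto intro!: exI[of _ "\<lambda>h. h $ i"] bounded_linear_imp_has_derivative bounded_linear_vec_nth)

lemma cn_holomorphic_on_sum:
  assumes "\<And>x. x \<in> A \<Longrightarrow> cn_holomorphic_on (f x) S"
  shows "cn_holomorphic_on (\<lambda>z. \<Sum>x\<in>A. f x z) S"
  using assms by (induction A rule: infinite_finite_induct)
    (auto intro: cn_holomorphic_on_add cn_holomorphic_on_const)

lemma cn_holomorphic_on_prod:
  assumes "\<And>x. x \<in> A \<Longrightarrow> cn_holomorphic_on (f x) S"
  shows "cn_holomorphic_on (\<lambda>z. \<Prod>x\<in>A. f x z) S"
  using assms by (induction A rule: infinite_finite_induct)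
    (auto intro: cn_holomorphic_on_mult cn_holomorphic_on_const)

lemma cn_holomorphic_on_monomial: "cn_holomorphic_on (monomial \<alpha>) S"
proof -
  have "cn_holomorphic_on (\<lambda>z. z $ i ^ m) S" for i m
    by (induction m) (auto intro: cn_holomorphic_on_mult cn_holomorphic_on_const cn_holomorphic_on_nth)
  then show ?thesis unfolding monomial_def by (intro cn_holomorphic_on_prod)
qed

lemma continuous_on_monomial [continuous_intros]: "continuous_on S (monomial \<alpha>)"
  unfolding monomial_def by (intro continuous_intros)

lemma borel_measurable_monomial [measurable]: "monomial \<alpha> \<in> borel_measurable borel"
  by (intro borel_measurable_continuous_onI continuous_intros)

lemma borel_measurable_cnj [measurable]: "cnj \<in> borel_measurable borel"
  by (intro borel_measurable_continuous_onI continuous_on_cnj continuous_on_id)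

lemma norm_monomial: "cmod (monomial \<alpha> z) = (\<Prod>i\<in>UNIV. cmod (z $ i) ^ \<alpha> i)"
  by (simp add: monomial_def prod_norm[symmetric] norm_power)

lemma norm_monomial_le_1: "norm z \<le> 1 \<Longrightarrow> cmod (monomial \<alpha> z) \<le> 1"
  unfolding norm_monomial
  by (intro prod_le_1) (auto intro!: power_le_one order_trans[OF Finite_Cartesian_Product.norm_nth_le])

text \<open>
  Rotating one coordinate in which the exponents differ by the angle \<open>\<pi> / (\<alpha>\<^sub>i - \<beta>\<^sub>i)\<close> changes the sign
  of the integrand but not the integral.
\<close>

lemma integral_monomial_orthogonal:
  fixes \<phi> :: "complex ^ 'n \<Rightarrow> real"
  assumes [measurable]: "\<phi> \<in> borel_measurable borel"
    and inv: "\<And>z w. (\<And>i. cmod (z $ i) = cmod (w $ i)) \<Longrightarrow> \<phi> z = \<phi> w"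
    and ne: "\<alpha> \<noteq> \<beta>"
  shows "(LINT z|lborel. of_real (\<phi> z) * (monomial \<alpha> z * cnj (monomial \<beta> z))) = 0"
proof -
  obtain i where i: "\<alpha> i \<noteq> \<beta> i" using ne by auto
  define \<theta> where "\<theta> = pi / (real (\<alpha> i) - real (\<beta> i))"
  define T where "T = (\<lambda>z :: complex ^ 'n. \<chi> j. (if j = i then cis \<theta> else 1) * z $ j)"
  have lin: "linear T" by (rule linearI) (simp_all add: T_def vec_eq_iff algebra_simps)
  have Tc: "cmod (T z $ j) = cmod (z $ j)" for z j by (simp add: T_def norm_mult)
  have Tn: "norm (T z) = norm z" for z
  proof -
    have "(norm (T z))\<^sup>2 = (norm z)\<^sup>2" unfolding norm_sq_vec by (simp add: Tc)
    then show ?thesis by simp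
  qed
  have mT: "monomial \<gamma> (T z) = cis \<theta> ^ \<gamma> i * monomial \<gamma> z" for \<gamma> z
  proof -
    have "monomial \<gamma> (T z) = (\<Prod>j\<in>UNIV. (if j = i then cis \<theta> ^ \<gamma> i else 1)) * monomial \<gamma> z"
      unfolding monomial_def prod.distrib[symmetric] by (intro prod.cong) (auto simp: T_def power_mult_distrib)
    then show ?thesis by simp
  qed
  have fac: "cis \<theta> ^ \<alpha> i * cnj (cis \<theta> ^ \<beta> i) = -1"
  proof -
    have "cis \<theta> ^ \<alpha> i * cnj (cis \<theta> ^ \<beta> i) = cis (real (\<alpha> i) * \<theta> + - (real (\<beta> i) * \<theta>))"
      by (simp only: Complex.DeMoivre cis_cnj cis_mult)
    also have "real (\<alpha> i) * \<theta> + - (real (\<beta> i) * \<theta>) = pi"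
    proof -
      have "real (\<alpha> i) * \<theta> + - (real (\<beta> i) * \<theta>) = (real (\<alpha> i) - real (\<beta> i)) * \<theta>"
        by (simp add: algebra_simps)
      then show ?thesis using i by (simp add: \<theta>_def)
    qed
    finally show ?thesis by simp
  qed
  let ?f = "\<lambda>z. of_real (\<phi> z) * (monomial \<alpha> z * cnj (monomial \<beta> z))"
  have f: "?f (T z) = - ?f z" for z
  proof -
    have "?f (T z) = (cis \<theta> ^ \<alpha> i * cnj (cis \<theta> ^ \<beta> i)) * ?f z"
      using inv[of "T z" z] Tc by (simp add: mT)
    then show ?thesis unfolding fac by simp
  qed
  have meas: "?f \<in> borel_measurable borel" by measurable
  have "(LINT z|lborel. ?f z) = (LINT z|lborel. ?f (T z))"
    by (rule integral_isometry[OF lin Tn meas, symmetric])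
  also have "\<dots> = - (LINT z|lborel. ?f z)" unfolding f by simp
  finally show ?thesis by simp
qed

lemma integral_norm_sq_monomial_sum:
  fixes \<phi> :: "complex ^ 'n \<Rightarrow> real" and c :: "'x \<Rightarrow> real"
  assumes int: "integrable lborel \<phi>"
    and inv: "\<And>z w. (\<And>i. cmod (z $ i) = cmod (w $ i)) \<Longrightarrow> \<phi> z = \<phi> w"
    and supp: "\<And>z. norm z > 1 \<Longrightarrow> \<phi> z = 0"
    and X: "finite X" "inj_on \<alpha> X"
  shows "(LINT z|lborel. \<phi> z * (cmod (\<Sum>x\<in>X. of_real (c x) * monomial (\<alpha> x) z))\<^sup>2)
    = (\<Sum>x\<in>X. (c x)\<^sup>2 * (LINT z|lborel. \<phi> z * (cmod (monomial (\<alpha> x) z))\<^sup>2))"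
proof -
  have [measurable]: "\<phi> \<in> borel_measurable borel" using borel_measurable_integrable[OF int] by simp
  have bd: "norm (of_real (\<phi> z) * (monomial \<beta> z * cnj (monomial \<gamma> z))) \<le> norm (\<phi> z)" for z \<beta> \<gamma>
  proof (cases "norm z \<le> 1")
    case True
    have "cmod (monomial \<beta> z) * cmod (monomial \<gamma> z) \<le> 1 * 1"
      by (intro mult_mono norm_monomial_le_1 True) auto
    then show ?thesis by (simp add: norm_mult mult_left_le)
  qed (simp add: supp)
  have integ: "integrable lborel (\<lambda>z. of_real (\<phi> z) * (monomial \<beta> z * cnj (monomial \<gamma> z)))" for \<beta> \<gamma>
  proof (rule Bochner_Integration.integrable_bound[OF int])
    show "(\<lambda>z. of_real (\<phi> z) * (monomial \<beta> z * cnj (monomial \<gamma> z))) \<in> borel_measurable lborel"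
      by measurable
  qed (use bd in auto)
  have "complex_of_real (LINT z|lborel. \<phi> z * (cmod (\<Sum>x\<in>X. of_real (c x) * monomial (\<alpha> x) z))\<^sup>2)
    = (LINT z|lborel. complex_of_real (\<phi> z * (cmod (\<Sum>x\<in>X. of_real (c x) * monomial (\<alpha> x) z))\<^sup>2))"
    by (rule integral_complex_of_real[symmetric])
  also have "\<dots> = (LINT z|lborel. (\<Sum>x\<in>X. \<Sum>y\<in>X. of_real (c x * c y) * (of_real (\<phi> z) * (monomial (\<alpha> x) z * cnj (monomial (\<alpha> y) z)))))"
    unfolding of_real_mult complex_norm_square cnj_sum sum_product unfolding sum_distrib_left
    by (simp add: mult_ac)
  also have "\<dots> = (\<Sum>x\<in>X. \<Sum>y\<in>X. of_real (c x * c y) * (LINT z|lborel. (of_real (\<phi> z) * (monomial (\<alpha> x) z * cnj (monomial (\<alpha> y) z)))))"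
    using integ by simp
  also have "\<dots> = (\<Sum>x\<in>X. \<Sum>y\<in>X. if y = x then of_real (c x * c x) * (LINT z|lborel. (of_real (\<phi> z) * (monomial (\<alpha> x) z * cnj (monomial (\<alpha> x) z)))) else 0)"
  proof (intro sum.cong refl)
    fix x y assume xy: "x \<in> X" "y \<in> X"
    show "of_real (c x * c y) * (LINT z|lborel. (of_real (\<phi> z) * (monomial (\<alpha> x) z * cnj (monomial (\<alpha> y) z))))
       = (if y = x then of_real (c x * c x) * (LINT z|lborel. (of_real (\<phi> z) * (monomial (\<alpha> x) z * cnj (monomial (\<alpha> x) z)))) else 0)"
    proof (cases "y = x")
      case False
      then have "\<alpha> x \<noteq> \<alpha> y" using xy X(2) by (auto simp: inj_on_def)
      then have "(LINT z|lborel. of_real (\<phi> z) * (monomial (\<alpha> x) z * cnj (monomial (\<alpha> y) z))) = 0"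
        by (intro integral_monomial_orthogonal inv) auto
      then show ?thesis using False by simp
    qed simp
  qed
  also have "\<dots> = (\<Sum>x\<in>X. of_real (c x * c x) * (LINT z|lborel. (of_real (\<phi> z) * (monomial (\<alpha> x) z * cnj (monomial (\<alpha> x) z)))))"
    using X(1) by simp
  also have "\<dots> = (\<Sum>x\<in>X. of_real (c x * c x) * (LINT z|lborel. complex_of_real (\<phi> z * (cmod (monomial (\<alpha> x) z))\<^sup>2)))"
    unfolding of_real_mult complex_norm_square by simp
  also have "\<dots> = complex_of_real (\<Sum>x\<in>X. (c x)\<^sup>2 * (LINT z|lborel. \<phi> z * (cmod (monomial (\<alpha> x) z))\<^sup>2))"
    unfolding integral_complex_of_real by (simp add: power2_eq_square)
  finally show ?thesis by (simp only: of_real_eq_iff)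
qed


section \<open>Normalised monomials as Gaussian bumps\<close>

text \<open>
  The difference \<open>\<psi>(t)\<close> of the two sides has derivative \<open>(t - s)(1 - t)/t\<close>, hence its minimum on
  \<open>(0, 1]\<close> is \<open>\<psi>(s) = 0\<close>.
\<close>

lemma bump_upper_aux:
  assumes s: "0 < s" "s \<le> 1" and t: "0 < t" "t \<le> (1::real)"
  shows "s * ln (t / s) \<le> (t - s) - (t - s)\<^sup>2 / 2"
proof -
  define \<psi> where "\<psi> = (\<lambda>t::real. (t - s) - (t - s)\<^sup>2 / 2 - s * ln (t / s))"
  have D: "(\<psi> has_real_derivative (x - s) * (1 - x) / x) (at x)" if "x > 0" for x
    unfolding \<psi>_def using s that
    by (auto intro!: derivative_eq_intros simp: field_simps power2_eq_square)
  have "\<psi> s \<le> \<psi> t"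
  proof (cases "s \<le> t")
    case True
    show ?thesis
    proof (rule DERIV_nonneg_imp_nondecreasing[of s t \<psi>, OF True])
      fix x assume "s \<le> x" "x \<le> t"
      then show "\<exists>y. (\<psi> has_real_derivative y) (at x) \<and> 0 \<le> y"
        using s t by (intro exI[of _ "(x - s) * (1 - x) / x"] conjI D) auto
    qed
  next
    case False
    show ?thesis
    proof (rule DERIV_nonpos_imp_nonincreasing[of t s \<psi>])
      show "t \<le> s" using False by simp
      fix x assume "t \<le> x" "x \<le> s"
      then show "\<exists>y. (\<psi> has_real_derivative y) (at x) \<and> y \<le> 0"
        using s t by (intro exI[of _ "(x - s) * (1 - x) / x"] conjI D)
          (auto simp: divide_le_0_iff mult_le_0_iff)
    qed
  qed
  then show ?thesis using s by (simp add: \<psi>_def)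
qed

text \<open>
  This and the next lemma compare \<open>t \<mapsto> (t/s)\<^bsup>Mb\<^esup>\<close>, where \<open>s = b/M\<close>, with a Gaussian of width \<open>1/M\<close>
  centred at \<open>s\<close>. The linear factor \<open>exp (M\<^sup>2 (t - s))\<close> is split off because the product of
  these factors over all coordinates depends only on \<open>|z|\<close>.
\<close>

lemma bump_upper:
  fixes t :: real and b M :: nat
  assumes t: "0 \<le> t" "t \<le> 1" and M: "0 < M" and b: "b \<le> M"
  shows "(t / (real b / real M)) ^ (M * b)
    \<le> exp ((real M)\<^sup>2 * (t - real b / real M)) * exp (- (real b - real M * t)\<^sup>2 / 2)"
proof (cases "b = 0")
  case True
  have "t * t \<le> 1 * t" using t by (intro mult_right_mono) auto
  then have "t\<^sup>2 \<le> 2 * t" using t unfolding power2_eq_square by linarith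
  then have "(real M)\<^sup>2 * t\<^sup>2 \<le> (real M)\<^sup>2 * (2 * t)" by (intro mult_left_mono) auto
  then show ?thesis using True by (simp add: exp_add[symmetric] power_mult_distrib)
next
  case False
  show ?thesis
  proof (cases "t = 0")
    case True
    then show ?thesis using False M by (simp add: power_0_left)
  next
    case t0: False
    define s where "s = real b / real M"
    have s: "0 < s" "s \<le> 1" using False M b by (auto simp: s_def)
    have bs: "real b = real M * s" using M by (simp add: s_def)
    have pos: "t / s > 0" using t t0 s by simp
    have "(t / s) ^ (M * b) = exp (real (M * b) * ln (t / s))"
      by (simp only: exp_of_nat_mult exp_ln[OF pos])
    also have "real (M * b) * ln (t / s) = (real M)\<^sup>2 * (s * ln (t / s))"
      by (simp add: bs power2_eq_square)
    also have "exp \<dots> \<le> exp ((real M)\<^sup>2 * ((t - s) - (t - s)\<^sup>2 / 2))"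
      using bump_upper_aux[OF s _ t(2)] t t0 by (simp add: mult_left_mono)
    also have "(real M)\<^sup>2 * ((t - s) - (t - s)\<^sup>2 / 2) = (real M)\<^sup>2 * (t - s) + - (real b - real M * t)\<^sup>2 / 2"
    proof -
      have sq: "(real M * s - real M * t)\<^sup>2 = (real M)\<^sup>2 * (t - s)\<^sup>2"
        unfolding right_diff_distrib[symmetric] power_mult_distrib by (simp add: power2_commute)
      show ?thesis unfolding bs sq right_diff_distrib by simp
    qed
    finally show ?thesis unfolding s_def[symmetric] exp_add[symmetric] .
  qed
qed

text \<open>
  From \<open>ln x \<le> x - 1\<close> at \<open>x = s/t\<close>.
\<close>

lemma bump_lower:
  fixes t :: real and b M :: nat
  assumes t: "0 < t" and M: "0 < M"
  shows "exp ((real M)\<^sup>2 * (t - real b / real M)) * exp (- (real b - real M * t)\<^sup>2 / t)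
    \<le> (t / (real b / real M)) ^ (M * b)"
proof (cases "b = 0")
  case True
  then show ?thesis using t by (simp add: exp_add[symmetric] power_mult_distrib power2_eq_square)
next
  case False
  define s where "s = real b / real M"
  have s: "0 < s" using False M by (auto simp: s_def)
  have bs: "real b = real M * s" using M by (simp add: s_def)
  have pos: "t / s > 0" using t s by simp
  have "ln (s / t) \<le> s / t - 1" using s t by (intro ln_le_minus_one) simp
  then have "1 - s / t \<le> ln (t / s)" using s t by (simp add: ln_div)
  then have "(real M)\<^sup>2 * (s * (1 - s / t)) \<le> (real M)\<^sup>2 * (s * ln (t / s))"
    using s by (intro mult_left_mono) auto
  moreover have "s * (1 - s / t) = (t - s) - (s - t)\<^sup>2 / t"
    using t by (simp add: field_simps power2_eq_square)
  ultimately have le: "(real M)\<^sup>2 * ((t - s) - (s - t)\<^sup>2 / t) \<le> (real M)\<^sup>2 * (s * ln (t / s))" by simp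
  have "exp ((real M)\<^sup>2 * (t - s)) * exp (- (real b - real M * t)\<^sup>2 / t)
      = exp ((real M)\<^sup>2 * ((t - s) - (s - t)\<^sup>2 / t))"
  proof -
    have sq: "(real M * s - real M * t)\<^sup>2 = (real M)\<^sup>2 * (s - t)\<^sup>2"
      unfolding right_diff_distrib[symmetric] power_mult_distrib ..
    have "(real M)\<^sup>2 * (t - s) + - ((real M)\<^sup>2 * (s - t)\<^sup>2) / t = (real M)\<^sup>2 * ((t - s) - (s - t)\<^sup>2 / t)"
      unfolding right_diff_distrib by simp
    then show ?thesis unfolding bs exp_add[symmetric] sq by (simp only:)
  qed
  also have "\<dots> \<le> exp ((real M)\<^sup>2 * (s * ln (t / s)))" using le by simp
  also have "(real M)\<^sup>2 * (s * ln (t / s)) = real (M * b) * ln (t / s)"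
    by (simp add: bs power2_eq_square)
  also have "exp \<dots> = (t / s) ^ (M * b)" by (simp only: exp_of_nat_mult exp_ln[OF pos])
  finally show ?thesis by (simp add: s_def)
qed

lemma two_sided_geometric_sum_le:
  fixes a :: real and l L :: nat
  assumes a: "0 < a" "a < 1"
  shows "(\<Sum>m<L. if m \<le> l then a ^ (l - m) else a ^ (m - l - 1)) \<le> 2 / (1 - a)"
proof -
  have geo: "(\<Sum>j<N. a ^ j) \<le> 1 / (1 - a)" for N :: nat
    using a by (simp add: sum_gp_strict divide_right_mono)
  let ?g = "\<lambda>m. if m \<le> l then a ^ (l - m) else a ^ (m - l - 1)"
  have "(\<Sum>m<L. ?g m) \<le> (\<Sum>m\<in>{..<Suc l} \<union> {Suc l..<Suc l + L}. ?g m)"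
    using a by (intro sum_mono2) auto
  also have "\<dots> = (\<Sum>m<Suc l. ?g m) + (\<Sum>m\<in>{Suc l..<Suc l + L}. ?g m)"
    by (intro sum.union_disjoint) auto
  also have "(\<Sum>m<Suc l. ?g m) = (\<Sum>m<Suc l. a ^ (Suc l - Suc m))" by (intro sum.cong) auto
  also have "\<dots> = (\<Sum>j<Suc l. a ^ j)" by (rule sum.nat_diff_reindex)
  also have "(\<Sum>m\<in>{Suc l..<Suc l + L}. ?g m) = (\<Sum>j<L. a ^ j)"
    by (rule sum.reindex_bij_witness[of _ "\<lambda>j. j + Suc l" "\<lambda>m. m - Suc l"]) auto
  also have "(\<Sum>j<Suc l. a ^ j) + (\<Sum>j<L. a ^ j) \<le> 2 / (1 - a)"
    using geo[of "Suc l"] geo[of L] by simp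
  finally show ?thesis .
qed

definition gauss_const :: real where
  "gauss_const = exp (1/4) * (2 / (1 - exp (- 1/2)))"

text \<open>
  From \<open>(|m - x| - 1)\<^sup>2 \<ge> 0\<close> one gets \<open>-(m - x)\<^sup>2/4 \<le> 1/4 - |m - x|/2\<close>, which leaves two geometric
  series, one to the left and one to the right of \<open>x\<close>.
\<close>

lemma gaussian_sum_le:
  fixes x :: real
  assumes "0 \<le> x"
  shows "(\<Sum>m\<le>M. exp (- (real m - x)\<^sup>2 / 4)) \<le> gauss_const"
proof -
  define l where "l = nat \<lfloor>x\<rfloor>"
  have l: "real l \<le> x" "x < real l + 1" using assms by (auto simp: l_def)
  define a where "a = exp (- 1/2 :: real)"
  have a: "0 < a" "a < 1" by (auto simp: a_def)
  have apow: "a ^ j = exp (- real j / 2)" for j by (simp add: a_def exp_of_nat_mult[symmetric])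
  have "exp (- (real m - x)\<^sup>2 / 4) \<le> exp (1/4) * (if m \<le> l then a ^ (l - m) else a ^ (m - l - 1))" for m
  proof -
    have "0 \<le> (\<bar>real m - x\<bar> - 1)\<^sup>2" by simp
    also have "\<dots> = (real m - x)\<^sup>2 - 2 * \<bar>real m - x\<bar> + 1" by (simp add: power2_diff)
    finally have q: "- (real m - x)\<^sup>2 / 4 \<le> 1/4 - \<bar>real m - x\<bar> / 2" by simp
    define d where "d = (if m \<le> l then l - m else m - l - 1)"
    have "real d \<le> \<bar>real m - x\<bar>"
    proof (cases "m \<le> l")
      case True
      then have "real d = real l - real m" by (simp add: d_def of_nat_diff)
      then show ?thesis using l by linarith
    next
      case False
      then have "real d = real m - real l - 1" by (simp add: d_def of_nat_diff)
      then show ?thesis using l by linarith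
    qed
    then have "- (real m - x)\<^sup>2 / 4 \<le> 1/4 + - real d / 2"
      by (intro order_trans[OF q]) simp
    then have "exp (- (real m - x)\<^sup>2 / 4) \<le> exp (1/4 + - real d / 2)"
      by (rule iffD2[OF exp_le_cancel_iff])
    also have "\<dots> = exp (1/4) * (if m \<le> l then a ^ (l - m) else a ^ (m - l - 1))"
      unfolding exp_add apow[symmetric] by (simp add: d_def)
    finally show ?thesis .
  qed
  then have "(\<Sum>m\<le>M. exp (- (real m - x)\<^sup>2 / 4)) \<le> (\<Sum>m\<le>M. exp (1/4) * (if m \<le> l then a ^ (l - m) else a ^ (m - l - 1)))"
    by (rule sum_mono)
  also have "\<dots> = exp (1/4) * (\<Sum>m<Suc M. if m \<le> l then a ^ (l - m) else a ^ (m - l - 1))"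
    by (simp only: sum_distrib_left lessThan_Suc_atMost)
  also have "\<dots> \<le> exp (1/4) * (2 / (1 - a))"
    by (intro mult_left_mono two_sided_geometric_sum_le a) simp
  finally show ?thesis by (simp add: gauss_const_def a_def)
qed

definition bump_indices :: "nat \<Rightarrow> ('n::finite \<Rightarrow> nat) set" where
  "bump_indices M = {b. (\<Sum>i\<in>UNIV. b i) = M}"

definition bump_coeff :: "nat \<Rightarrow> ('n::finite \<Rightarrow> nat) \<Rightarrow> real" where
  "bump_coeff M b = (\<Prod>i\<in>UNIV. (1 / sqrt (real (b i) / real M)) ^ (M * b i))"

text \<open>
  The monomial \<open>z\<^bsup>Mb\<^esup>\<close> divided by its maximum modulus on the unit sphere, which is attained where
  \<open>|z\<^sub>i|\<^sup>2 = b\<^sub>i/M\<close> for all \<open>i\<close>. For \<open>b\<^sub>i = 0\<close> the coefficient has the factor \<open>1\<close>, a power with exponent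
  \<open>0\<close>.
\<close>

definition bump :: "nat \<Rightarrow> ('n::finite \<Rightarrow> nat) \<Rightarrow> complex ^ 'n \<Rightarrow> complex" where
  "bump M b z = of_real (bump_coeff M b) * monomial (\<lambda>i. M * b i) z"

lemma bump_indices_le: "b \<in> bump_indices M \<Longrightarrow> b i \<le> M"
  unfolding bump_indices_def using member_le_sum[of i UNIV b] by auto

lemma bump_indices_subset: "bump_indices M \<subseteq> (UNIV :: 'n::finite set) \<rightarrow>\<^sub>E {..M}"
  using bump_indices_le by auto

lemma finite_bump_indices: "finite (bump_indices M :: ('n::finite \<Rightarrow> nat) set)"
  by (rule finite_subset[OF bump_indices_subset]) (auto intro!: finite_PiE)

lemma norm_sq_bump:
  "(cmod (bump M b z))\<^sup>2 = (\<Prod>i\<in>UNIV. ((cmod (z $ i))\<^sup>2 / (real (b i) / real M)) ^ (M * b i))"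
proof -
  have "bump_coeff M b \<ge> 0" by (simp add: bump_coeff_def prod_nonneg)
  then have "cmod (bump M b z) = bump_coeff M b * (\<Prod>i\<in>UNIV. cmod (z $ i) ^ (M * b i))"
    by (simp add: bump_def norm_mult norm_monomial)
  also have "\<dots> = (\<Prod>i\<in>UNIV. (cmod (z $ i) / sqrt (real (b i) / real M)) ^ (M * b i))"
    unfolding bump_coeff_def prod.distrib[symmetric] power_mult_distrib[symmetric] by simp
  finally have eq: "cmod (bump M b z) = (\<Prod>i\<in>UNIV. (cmod (z $ i) / sqrt (real (b i) / real M)) ^ (M * b i))" .
  have pc: "(x ^ m)\<^sup>2 = (x\<^sup>2) ^ m" for x :: real and m
    by (simp only: power_mult[symmetric] mult.commute)
  show ?thesis unfolding eq prod_power_distrib pc by (simp add: power_divide)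
qed

text \<open>
  The exponents of the linear factors add up to a function of \<open>|z|\<close> alone, because the \<open>b\<^sub>i\<close> have sum
  \<open>M\<close>.
\<close>

lemma sum_bump_exponent:
  fixes z :: "complex ^ 'n"
  assumes b: "b \<in> bump_indices M" and M: "0 < M"
  shows "(\<Sum>i\<in>UNIV. (real M)\<^sup>2 * ((cmod (z $ i))\<^sup>2 - real (b i) / real M)) = - ((real M)\<^sup>2 * (1 - (norm z)\<^sup>2))"
proof -
  have "(\<Sum>i\<in>UNIV. real (b i)) = real M" using b by (simp add: bump_indices_def flip: of_nat_sum)
  then have "(\<Sum>i\<in>UNIV. real (b i) / real M) = 1" using M by (simp add: sum_divide_distrib[symmetric])
  note one = this
  show ?thesis
    unfolding sum_distrib_left[symmetric] sum_subtractf norm_sq_vec one by (simp add: algebra_simps)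
qed

lemma norm_sq_bump_le:
  fixes z :: "complex ^ 'n"
  assumes b: "b \<in> bump_indices M" and M: "0 < M" and z: "norm z \<le> 1"
  shows "(cmod (bump M b z))\<^sup>2 \<le> exp (- ((real M)\<^sup>2 * (1 - (norm z)\<^sup>2))) *
    (\<Prod>i\<in>UNIV. exp (- (real (b i) - real M * (cmod (z $ i))\<^sup>2)\<^sup>2 / 2))"
proof -
  have "(cmod (bump M b z))\<^sup>2 \<le> (\<Prod>i\<in>UNIV. exp ((real M)\<^sup>2 * ((cmod (z $ i))\<^sup>2 - real (b i) / real M)) *
      exp (- (real (b i) - real M * (cmod (z $ i))\<^sup>2)\<^sup>2 / 2))"
    unfolding norm_sq_bump
  proof (intro prod_mono conjI)
    fix i
    have "cmod (z $ i) \<le> 1" using Finite_Cartesian_Product.norm_nth_le[of z i] z by linarith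
    then show "((cmod (z $ i))\<^sup>2 / (real (b i) / real M)) ^ (M * b i) \<le> exp ((real M)\<^sup>2 * ((cmod (z $ i))\<^sup>2 - real (b i) / real M)) *
      exp (- (real (b i) - real M * (cmod (z $ i))\<^sup>2)\<^sup>2 / 2)"
      using bump_indices_le[OF b] M by (intro bump_upper) (auto simp: power_le_one)
  qed simp
  also have "\<dots> = exp (- ((real M)\<^sup>2 * (1 - (norm z)\<^sup>2))) *
    (\<Prod>i\<in>UNIV. exp (- (real (b i) - real M * (cmod (z $ i))\<^sup>2)\<^sup>2 / 2))"
    unfolding prod.distrib sum_bump_exponent[OF b M, of z, symmetric] by (simp add: exp_sum)
  finally show ?thesis .
qed

definition bump_sum :: "nat \<Rightarrow> complex ^ 'n \<Rightarrow> complex" where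
  "bump_sum M z = (\<Sum>b\<in>bump_indices M. bump M b z)"

text \<open>
  Extending the sum over \<open>b\<close> from the simplex to a cube only adds nonnegative terms, and over the
  cube it factors into one-dimensional Gaussian sums.
\<close>

lemma norm_bump_sum_le:
  fixes z :: "complex ^ 'n"
  assumes M: "0 < M" and z: "norm z \<le> 1"
  shows "cmod (bump_sum M z) \<le> gauss_const ^ CARD('n) * exp (- ((real M)\<^sup>2 * (1 - (norm z)\<^sup>2) / 2))"
proof -
  let ?E = "exp (- ((real M)\<^sup>2 * (1 - (norm z)\<^sup>2) / 2))"
  let ?h = "\<lambda>i m. exp (- (real m - real M * (cmod (z $ i))\<^sup>2)\<^sup>2 / 4)"
  have "cmod (bump M b z) \<le> ?E * (\<Prod>i\<in>UNIV. ?h i (b i))" if "b \<in> bump_indices M" for b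
  proof (rule power2_le_imp_le)
    have "(?E * (\<Prod>i\<in>UNIV. ?h i (b i)))\<^sup>2 = exp (- ((real M)\<^sup>2 * (1 - (norm z)\<^sup>2))) *
        (\<Prod>i\<in>UNIV. exp (- (real (b i) - real M * (cmod (z $ i))\<^sup>2)\<^sup>2 / 2))"
      unfolding power_mult_distrib prod_power_distrib exp_double[symmetric] by simp
    then show "(cmod (bump M b z))\<^sup>2 \<le> (?E * (\<Prod>i\<in>UNIV. ?h i (b i)))\<^sup>2"
      using norm_sq_bump_le[OF that M z] by simp
  qed (auto intro!: mult_nonneg_nonneg prod_nonneg)
  then have "cmod (bump_sum M z) \<le> (\<Sum>b\<in>bump_indices M. ?E * (\<Prod>i\<in>UNIV. ?h i (b i)))"
    unfolding bump_sum_def by (rule sum_norm_le)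
  also have "\<dots> \<le> (\<Sum>b\<in>(UNIV :: 'n set) \<rightarrow>\<^sub>E {..M}. ?E * (\<Prod>i\<in>UNIV. ?h i (b i)))"
    by (intro sum_mono2 bump_indices_subset) (auto intro!: finite_PiE mult_nonneg_nonneg prod_nonneg)
  also have "\<dots> = ?E * (\<Prod>i\<in>UNIV. \<Sum>m\<le>M. ?h i m)"
    by (simp add: sum_distrib_left[symmetric] prod_sum_PiE)
  also have "\<dots> \<le> ?E * (\<Prod>i\<in>(UNIV :: 'n set). gauss_const)"
    by (intro mult_left_mono prod_mono conjI gaussian_sum_le sum_nonneg) auto
  finally show ?thesis by (simp add: mult.commute)
qed

section \<open>The lacunary series and its growth\<close>

lemma powr_pow_commute: "((4::real) powr s) ^ m = (4 ^ m) powr s"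
proof (induction m)
  case (Suc m)
  have "((4::real) ^ Suc m) powr s = 4 powr s * (4 ^ m) powr s"
    unfolding power_Suc by (rule powr_mult)
  then show ?case unfolding power_Suc[of "4 powr s"] Suc.IH by simp
qed simp

text \<open>
  Put \<open>y = 4\<^sup>k x\<close>. The terms with \<open>y \<le> 1\<close> are at most \<open>y\<^sup>q x\<^bsup>-q\<^esup>\<close>, and those with \<open>y > 1\<close> at most a
  multiple of \<open>y\<^bsup>-q\<^esup> x\<^bsup>-q\<^esup>\<close>, since \<open>y\<^bsup>2q\<^esup> e\<^bsup>-y/2\<^esup>\<close> is bounded. Both ranges are dominated by geometric
  series with ratio \<open>4\<^bsup>-q\<^esup>\<close>.
\<close>

lemma lacunary_growth_sum_le:
  fixes q x :: real
  assumes q: "0 < q" and x: "0 < x" "x \<le> 1"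
  shows "(\<Sum>k<L. (4 ^ k) powr q * exp (- (4 ^ k * x / 2)))
    \<le> max 1 ((4 * q) powr (2 * q)) * (2 / (1 - 4 powr (- q))) * x powr (- q)"
proof -
  define C where "C = max 1 ((4 * q) powr (2 * q))"
  define a where "a = (4::real) powr (- q)"
  have a: "0 < a" "a < 1" using q by (auto simp: a_def powr_minus_divide divide_less_eq)
  have powy: "y powr (2 * q) * exp (- (y / 2)) \<le> (4 * q) powr (2 * q)" if y: "y > 0" for y :: real
  proof -
    have "y / (4 * q) \<le> exp (y / (4 * q))" using exp_ge_add_one_self[of "y / (4 * q)"] by linarith
    then have "(y / (4 * q)) powr (2 * q) \<le> exp (y / (4 * q)) powr (2 * q)"
      using y q by (intro powr_mono2) auto
    also have "\<dots> = exp (y / 2)" using q by (simp add: powr_def)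
    finally have "y powr (2 * q) \<le> exp (y / 2) * (4 * q) powr (2 * q)"
      using y q by (simp add: powr_divide divide_le_eq)
    then show ?thesis by (simp add: exp_minus field_simps)
  qed
  obtain N where "1 / x < 4 ^ N" using real_arch_pow[of 4 "1/x"] by auto
  then have ex: "\<exists>N. 1 < 4 ^ N * x" using x by (auto simp: field_simps)
  \<comment> \<open>the first index with \<open>4\<^sup>k x > 1\<close>\<close>
  define K' where "K' = (LEAST N. 1 < 4 ^ N * x)"
  have K1: "1 < 4 ^ K' * x" unfolding K'_def by (rule LeastI_ex[OF ex])
  have K2: "4 ^ k * x \<le> 1" if "k < K'" for k
    using not_less_Least[OF that[unfolded K'_def]] by simp
  have "K' \<noteq> 0"
  proof
    assume "K' = 0" then show False using K1 x by simp
  qed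
  then obtain K where K: "K' = Suc K" by (cases K') auto
  have up: "(4 ^ k * x) powr q * exp (- (4 ^ k * x / 2)) \<le> C * (if k \<le> K then a ^ (K - k) else a ^ (k - K - 1))" for k
  proof (cases "k \<le> K")
    case True
    define y where "y = 4 ^ k * x"
    have y: "y > 0" using x by (simp add: y_def)
    have apow: "a ^ (K - k) = (1 / 4 ^ (K - k)) powr q"
      unfolding a_def powr_pow_commute by (simp add: powr_minus_divide powr_divide)
    have "(4::real) ^ K = 4 ^ (K - k) * 4 ^ k" using True by (simp add: power_add[symmetric])
    then have "4 ^ (K - k) * y \<le> 1" using K2[of K] K by (simp add: y_def)
    then have "y \<le> 1 / 4 ^ (K - k)" by (simp add: field_simps)
    then have "y powr q \<le> a ^ (K - k)" unfolding apow using y q by (intro powr_mono2) auto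
    then have "y powr q * exp (- (y / 2)) \<le> a ^ (K - k) * 1"
      using y a by (intro mult_mono) auto
    also have "\<dots> \<le> C * a ^ (K - k)" using a by (simp add: C_def mult_le_cancel_right1)
    finally show ?thesis using True by (simp add: y_def)
  next
    case False
    define y where "y = 4 ^ k * x"
    define j where "j = k - K - 1"
    have kj: "k = K' + j" using False K by (simp add: j_def)
    have y: "y > 0" using x by (simp add: y_def)
    have "4 ^ j * 1 \<le> 4 ^ j * (4 ^ K' * x)" using K1 by (intro mult_left_mono) auto
    then have yj: "4 ^ j \<le> y" by (simp add: y_def kj power_add mult_ac)
    have apow: "a ^ j = (4 ^ j) powr (- q)"
      unfolding a_def by (rule powr_pow_commute)
    have "y powr q * exp (- (y / 2)) = (y powr (2 * q) * exp (- (y / 2))) * y powr (- q)"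
    proof -
      have "y powr q = y powr (2 * q) * y powr (- q)" by (simp add: powr_add[symmetric])
      then show ?thesis by (simp only: mult_ac)
    qed
    also have "\<dots> \<le> C * (4 ^ j) powr (- q)"
      using powy[OF y] y yj q by (intro mult_mono powr_mono2') (auto simp: C_def)
    also have "\<dots> = C * a ^ j" by (simp only: apow)
    finally show ?thesis using False by (simp add: y_def j_def)
  qed
  have "(\<Sum>k<L. (4 ^ k) powr q * exp (- (4 ^ k * x / 2)))
      = (\<Sum>k<L. (4 ^ k * x) powr q * exp (- (4 ^ k * x / 2))) * x powr (- q)"
    unfolding sum_distrib_right using x by (intro sum.cong) (auto simp: powr_mult powr_minus)
  also have "(\<Sum>k<L. (4 ^ k * x) powr q * exp (- (4 ^ k * x / 2)))
     \<le> (\<Sum>k<L. C * (if k \<le> K then a ^ (K - k) else a ^ (k - K - 1)))"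
    by (intro sum_mono up)
  also have "\<dots> \<le> C * (2 / (1 - a))"
    unfolding sum_distrib_left[symmetric] by (intro mult_left_mono two_sided_geometric_sum_le a) (simp add: C_def)
  finally show ?thesis by (simp add: C_def a_def mult_right_mono)
qed

definition lacunary_partial :: "real \<Rightarrow> nat \<Rightarrow> complex ^ 'n \<Rightarrow> complex" where
  "lacunary_partial q L z = (\<Sum>k<L. of_real ((4 ^ k) powr q) * bump_sum (2 ^ k) z)"

definition lacunary :: "real \<Rightarrow> complex ^ 'n \<Rightarrow> complex" where
  "lacunary q z = (\<Sum>k. of_real ((4 ^ k) powr q) * bump_sum (2 ^ k) z)"

definition lacunary_const :: "real \<Rightarrow> nat \<Rightarrow> real" where
  "lacunary_const q n = gauss_const ^ n * (max 1 ((4 * q) powr (2 * q)) * (2 / (1 - 4 powr (- q))))"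

lemma four_pow: "(real (2 ^ k))\<^sup>2 = 4 ^ k"
  by (simp add: power_mult[symmetric] mult.commute[of k]) (simp add: power_mult)

lemma gauss_const_pos: "gauss_const > 0"
  by (simp add: gauss_const_def)

lemma lacunary_term_le:
  fixes z :: "complex ^ 'n"
  assumes "norm z \<le> r" "r \<le> 1" "0 \<le> r"
  shows "cmod (of_real ((4 ^ k) powr q) * bump_sum (2 ^ k) z)
    \<le> gauss_const ^ CARD('n) * ((4 ^ k) powr q * exp (- (4 ^ k * (1 - r\<^sup>2) / 2)))"
proof -
  have "cmod (bump_sum (2 ^ k) z) \<le> gauss_const ^ CARD('n) * exp (- (4 ^ k * (1 - (norm z)\<^sup>2) / 2))"
    using norm_bump_sum_le[of "2 ^ k" z] assms unfolding four_pow by simp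
  also have "\<dots> \<le> gauss_const ^ CARD('n) * exp (- (4 ^ k * (1 - r\<^sup>2) / 2))"
    using assms gauss_const_pos by (intro mult_left_mono) (auto intro!: power_mono)
  finally have "(4 ^ k) powr q * cmod (bump_sum (2 ^ k) z) \<le> (4 ^ k) powr q * (gauss_const ^ CARD('n) * exp (- (4 ^ k * (1 - r\<^sup>2) / 2)))"
    by (intro mult_left_mono) auto
  then show ?thesis by (simp add: norm_mult mult_ac)
qed

lemma lacunary_majorant_le:
  fixes q r :: real
  assumes q: "0 < q" and r: "0 \<le> r" "r < 1"
  shows "(\<Sum>k<L. gauss_const ^ n * ((4 ^ k) powr q * exp (- (4 ^ k * (1 - r\<^sup>2) / 2))))
    \<le> lacunary_const q n * (1 - r\<^sup>2) powr (- q)"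
proof -
  have x: "0 < 1 - r\<^sup>2" "1 - r\<^sup>2 \<le> 1" using r by (auto simp: abs_square_less_1)
  have "(\<Sum>k<L. gauss_const ^ n * ((4 ^ k) powr q * exp (- (4 ^ k * (1 - r\<^sup>2) / 2))))
    \<le> gauss_const ^ n * (max 1 ((4 * q) powr (2 * q)) * (2 / (1 - 4 powr (- q))) * (1 - r\<^sup>2) powr (- q))"
    unfolding sum_distrib_left[symmetric]
    using gauss_const_pos by (intro mult_left_mono lacunary_growth_sum_le q x) auto
  then show ?thesis by (simp only: lacunary_const_def mult.assoc)
qed

lemma norm_lacunary_partial_le:
  fixes z :: "complex ^ 'n"
  assumes q: "0 < q" and r: "norm z \<le> r" "r < 1"
  shows "cmod (lacunary_partial q L z) \<le> lacunary_const q CARD('n) * (1 - r\<^sup>2) powr (- q)"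
proof -
  have r0: "0 \<le> r" using r norm_ge_zero[of z] by linarith
  have "cmod (lacunary_partial q L z) \<le> (\<Sum>k<L. gauss_const ^ CARD('n) * ((4 ^ k) powr q * exp (- (4 ^ k * (1 - r\<^sup>2) / 2))))"
    unfolding lacunary_partial_def using r r0 by (intro sum_norm_le lacunary_term_le) auto
  also have "\<dots> \<le> lacunary_const q CARD('n) * (1 - r\<^sup>2) powr (- q)"
    by (rule lacunary_majorant_le[OF q r0 r(2)])
  finally show ?thesis .
qed

lemma uniform_limit_lacunary:
  assumes q: "0 < q" and r: "r < 1"
  shows "uniform_limit (cball 0 r) (lacunary_partial q) (lacunary q :: complex ^ 'n \<Rightarrow> complex) sequentially"
proof (cases "0 \<le> r")
  case True
  have "summable (\<lambda>k. gauss_const ^ CARD('n) * ((4 ^ k) powr q * exp (- (4 ^ k * (1 - r\<^sup>2) / 2))))"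
    using gauss_const_pos lacunary_majorant_le[OF q True r]
    by (intro summableI_nonneg_bounded) auto
  then show ?thesis
    unfolding lacunary_partial_def[abs_def] lacunary_def[abs_def]
    by (rule Weierstrass_m_test[rotated]) (use True r in \<open>auto intro!: lacunary_term_le\<close>)
next
  case False
  then have "cball 0 r = ({} :: (complex ^ 'n) set)" by simp
  then show ?thesis by (simp only: uniform_limit_on_empty)
qed

lemma cn_holomorphic_lacunary_partial: "cn_holomorphic_on (lacunary_partial q L) S"
  unfolding lacunary_partial_def[abs_def] bump_sum_def bump_def
  by (intro cn_holomorphic_on_sum cn_holomorphic_on_mult cn_holomorphic_on_const cn_holomorphic_on_monomial)

lemma cn_holomorphic_lacunary:
  assumes "0 < q"
  shows "cn_holomorphic_on (lacunary q) (ball 0 1)"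
  by (rule cn_holomorphic_on_uniform_limit[OF cn_holomorphic_lacunary_partial uniform_limit_lacunary[OF assms]])

lemma norm_lacunary_le:
  fixes z :: "complex ^ 'n"
  assumes q: "0 < q" and z: "norm z < 1"
  shows "cmod (lacunary q z) \<le> lacunary_const q CARD('n) * (1 - (norm z)\<^sup>2) powr (- q)"
proof (rule tendsto_upperbound)
  show "(\<lambda>L. cmod (lacunary_partial q L z)) \<longlonglongrightarrow> cmod (lacunary q z)"
    by (intro tendsto_norm tendsto_uniform_limitI[OF uniform_limit_lacunary[OF q z]]) simp
qed (use norm_lacunary_partial_le[OF q order_refl z] in auto)

theorem lacunary_in_growth_space:
  assumes q: "0 < q"
  shows "(lacunary q :: complex ^ 'n \<Rightarrow> complex) \<in> growth_space q"
proof -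
  have "growth_norm q (lacunary q :: complex ^ 'n \<Rightarrow> complex) \<le> ennreal (lacunary_const q CARD('n))"
    unfolding growth_norm_def
  proof (intro SUP_least ennreal_leI)
    fix z :: "complex ^ 'n" assume "z \<in> ball 0 1"
    then have z: "norm z < 1" by simp
    then have x: "1 - (norm z)\<^sup>2 > 0" by (simp add: abs_square_less_1)
    have "cmod (lacunary q z) * (1 - (norm z)\<^sup>2) powr q
      \<le> lacunary_const q CARD('n) * (1 - (norm z)\<^sup>2) powr (- q) * (1 - (norm z)\<^sup>2) powr q"
      by (intro mult_right_mono norm_lacunary_le[OF q z]) auto
    also have "\<dots> = lacunary_const q CARD('n)" using x by (simp add: powr_minus)
    finally show "cmod (lacunary q z) * (1 - (norm z)\<^sup>2) powr q \<le> lacunary_const q CARD('n)" .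
  qed
  then have "growth_norm q (lacunary q :: complex ^ 'n \<Rightarrow> complex) < \<infinity>"
    using ennreal_less_top le_less_trans by (metis infinity_ennreal_def)
  then show ?thesis using cn_holomorphic_lacunary[OF q] by (simp add: growth_space_def)
qed


section \<open>Lower bounds on shells\<close>

lemma norm_sq_bump_ge:
  fixes z :: "complex ^ 'n"
  assumes b: "b \<in> bump_indices M" and M: "0 < M" and z: "\<And>i. z $ i \<noteq> 0"
  shows "exp (- ((real M)\<^sup>2 * (1 - (norm z)\<^sup>2))) *
    (\<Prod>i\<in>UNIV. exp (- (real (b i) - real M * (cmod (z $ i))\<^sup>2)\<^sup>2 / (cmod (z $ i))\<^sup>2)) \<le> (cmod (bump M b z))\<^sup>2"
proof -
  have "exp (- ((real M)\<^sup>2 * (1 - (norm z)\<^sup>2))) *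
    (\<Prod>i\<in>UNIV. exp (- (real (b i) - real M * (cmod (z $ i))\<^sup>2)\<^sup>2 / (cmod (z $ i))\<^sup>2))
    = (\<Prod>i\<in>UNIV. exp ((real M)\<^sup>2 * ((cmod (z $ i))\<^sup>2 - real (b i) / real M)) *
      exp (- (real (b i) - real M * (cmod (z $ i))\<^sup>2)\<^sup>2 / (cmod (z $ i))\<^sup>2))"
    unfolding prod.distrib sum_bump_exponent[OF b M, of z, symmetric] by (simp add: exp_sum)
  also have "\<dots> \<le> (cmod (bump M b z))\<^sup>2"
    unfolding norm_sq_bump
    by (intro prod_mono conjI bump_lower M) (use z in auto)
  finally show ?thesis .
qed

text \<open>
  Round every \<open>M |z\<^sub>i|\<^sup>2\<close> down, except for one index, which absorbs what is missing from the sum \<open>M\<close>.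
\<close>

lemma bump_index_near:
  fixes z :: "complex ^ 'n"
  assumes z: "norm z \<le> 1"
  obtains b where "b \<in> bump_indices M"
    "\<And>i. \<bar>real (b i) - real M * (cmod (z $ i))\<^sup>2\<bar> \<le> real CARD('n) + real M * (1 - (norm z)\<^sup>2)"
proof -
  obtain j :: 'n where True by blast
  define t where "t = (\<lambda>i. real M * (cmod (z $ i))\<^sup>2)"
  have t0: "t i \<ge> 0" for i by (simp add: t_def)
  define fl where "fl = (\<lambda>i. nat \<lfloor>t i\<rfloor>)"
  have fl: "real (fl i) \<le> t i" "t i < real (fl i) + 1" for i
    using t0[of i] by (auto simp: fl_def)
  have n1: "1 \<le> real CARD('n)" using zero_less_card_finite[where 'a='n] by linarith
  have z2: "0 \<le> real M * (1 - (norm z)\<^sup>2)" using z by (simp add: power_le_one)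
  have tsum: "(\<Sum>i\<in>UNIV. t i) = real M * (norm z)\<^sup>2"
    by (simp add: t_def norm_sq_vec sum_distrib_left)
  have split: "(\<Sum>i\<in>UNIV. t i) = t j + (\<Sum>i\<in>UNIV - {j}. t i)"
    by (rule sum.remove) auto
  have le: "(\<Sum>i\<in>UNIV - {j}. real (fl i)) \<le> (\<Sum>i\<in>UNIV - {j}. t i)"
    by (intro sum_mono fl)
  have ge: "(\<Sum>i\<in>UNIV - {j}. t i) \<le> (\<Sum>i\<in>UNIV - {j}. real (fl i) + 1)"
    by (intro sum_mono less_imp_le fl)
  have "(\<Sum>i\<in>UNIV - {j}. real (fl i) + 1) = (\<Sum>i\<in>UNIV - {j}. real (fl i)) + (real CARD('n) - 1)"
    using n1 by (simp add: sum.distrib card_Diff_singleton of_nat_diff)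
  then have ge: "(\<Sum>i\<in>UNIV - {j}. t i) \<le> (\<Sum>i\<in>UNIV - {j}. real (fl i)) + (real CARD('n) - 1)"
    using ge by simp
  have "(\<Sum>i\<in>UNIV - {j}. real (fl i)) \<le> real M"
    using le split tsum t0[of j] z2 by (simp add: algebra_simps)
  then have leM: "(\<Sum>i\<in>UNIV - {j}. fl i) \<le> M" by (simp flip: of_nat_sum)
  define b where "b = (\<lambda>i. if i = j then M - (\<Sum>i\<in>UNIV - {j}. fl i) else fl i)"
  have bj: "real (b j) = real M - (\<Sum>i\<in>UNIV - {j}. real (fl i))"
    using leM by (simp add: b_def of_nat_diff)
  have "(\<Sum>i\<in>UNIV. b i) = b j + (\<Sum>i\<in>UNIV - {j}. b i)" by (rule sum.remove) auto
  also have "(\<Sum>i\<in>UNIV - {j}. b i) = (\<Sum>i\<in>UNIV - {j}. fl i)"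
    by (intro sum.cong) (auto simp: b_def)
  also have "b j + \<dots> = M" using leM by (simp add: b_def)
  finally have "b \<in> bump_indices M" by (simp add: bump_indices_def)
  moreover have "\<bar>real (b i) - real M * (cmod (z $ i))\<^sup>2\<bar> \<le> real CARD('n) + real M * (1 - (norm z)\<^sup>2)" for i
  proof (cases "i = j")
    case True
    have "real (b j) - t j = real M * (1 - (norm z)\<^sup>2) + ((\<Sum>i\<in>UNIV - {j}. t i) - (\<Sum>i\<in>UNIV - {j}. real (fl i)))"
      using split tsum by (simp add: bj algebra_simps)
    then have "\<bar>real (b j) - t j\<bar> \<le> real CARD('n) + real M * (1 - (norm z)\<^sup>2)"
      using le ge z2 by linarith
    then show ?thesis using True by (simp add: t_def)
  next
    case False
    then have "real (b i) = real (fl i)" by (simp add: b_def)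
    then have "\<bar>real (b i) - t i\<bar> \<le> real CARD('n) + real M * (1 - (norm z)\<^sup>2)"
      using fl[of i] n1 z2 by linarith
    then show ?thesis by (simp add: t_def)
  qed
  ultimately show ?thesis using that by blast
qed

text \<open>
  Here the block of degree \<open>4\<^sup>k\<close> is not yet small. The coordinates are kept away from \<open>0\<close> because the
  lower bound for the bumps degenerates there.
\<close>

definition shell :: "nat \<Rightarrow> (complex ^ 'n) set" where
  "shell k = {z. 1 - 2 / 4 ^ k \<le> (norm z)\<^sup>2 \<and> (norm z)\<^sup>2 \<le> 1 - 1 / 4 ^ k
     \<and> (\<forall>i. 1 / (4 * real CARD('n)) \<le> (cmod (z $ i))\<^sup>2)}"

text \<open>
  A single bump, one centred near \<open>(|z\<^sub>1|\<^sup>2, \<dots>, |z\<^sub>n|\<^sup>2)\<close>, is already large enough.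
\<close>

lemma sum_norm_sq_bump_ge:
  fixes z :: "complex ^ 'n"
  assumes z: "z \<in> shell k" and k: "1 \<le> k"
  shows "exp (- (2 + real CARD('n) * ((real CARD('n) + 1)\<^sup>2 * (4 * real CARD('n)))))
    \<le> (\<Sum>b\<in>bump_indices (2 ^ k). (cmod (bump (2 ^ k) b z))\<^sup>2)"
proof -
  define n where "n = real CARD('n)"
  define M where "M = (2::nat) ^ k"
  have n1: "1 \<le> n" using zero_less_card_finite[where 'a='n] unfolding n_def by linarith
  have M2: "(real M)\<^sup>2 = 4 ^ k" unfolding M_def by (rule four_pow)
  have M0: "0 < M" by (simp add: M_def)
  have M2': "2 \<le> real M" using k by (simp add: M_def self_le_power)
  have zz: "1 - (norm z)\<^sup>2 \<le> 2 / (real M)\<^sup>2" "1 / (real M)\<^sup>2 \<le> 1 - (norm z)\<^sup>2"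
    "\<And>i. 1 / (4 * n) \<le> (cmod (z $ i))\<^sup>2"
    using z by (auto simp: shell_def M2 n_def)
  have "0 \<le> 1 / (real M)\<^sup>2" by simp
  then have "(norm z)\<^sup>2 \<le> 1" using zz(2) by linarith
  then have z1: "norm z \<le> 1" by (simp add: abs_square_le_1)
  have znz: "z $ i \<noteq> 0" for i
  proof -
    have "0 < 1 / (4 * n)" using n1 by simp
    then have "0 < (cmod (z $ i))\<^sup>2" using zz(3)[of i] by linarith
    then show ?thesis by auto
  qed
  obtain b where b: "b \<in> bump_indices M"
    "\<And>i. \<bar>real (b i) - real M * (cmod (z $ i))\<^sup>2\<bar> \<le> n + real M * (1 - (norm z)\<^sup>2)"
    using bump_index_near[OF z1, of M] unfolding n_def by blast
  have "real M * (1 - (norm z)\<^sup>2) \<le> real M * (2 / (real M)\<^sup>2)"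
    using zz(1) by (intro mult_left_mono) auto
  also have "\<dots> = 2 / real M" using M0 by (simp add: power2_eq_square)
  also have "\<dots> \<le> 1" using M2' by simp
  finally have bi: "\<bar>real (b i) - real M * (cmod (z $ i))\<^sup>2\<bar> \<le> n + 1" for i using b(2)[of i] by linarith
  have e1: "exp (- 2) \<le> exp (- ((real M)\<^sup>2 * (1 - (norm z)\<^sup>2)))"
  proof -
    have "(real M)\<^sup>2 * (1 - (norm z)\<^sup>2) \<le> (real M)\<^sup>2 * (2 / (real M)\<^sup>2)"
      using zz(1) by (intro mult_left_mono) auto
    also have "\<dots> = 2" using M0 by simp
    finally show ?thesis by simp
  qed
  have "(\<Prod>i\<in>(UNIV :: 'n set). exp (- ((n + 1)\<^sup>2 * (4 * n))))
    \<le> (\<Prod>i\<in>UNIV. exp (- (real (b i) - real M * (cmod (z $ i))\<^sup>2)\<^sup>2 / (cmod (z $ i))\<^sup>2))"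
  proof (intro prod_mono conjI)
    fix i
    have sq: "(real (b i) - real M * (cmod (z $ i))\<^sup>2)\<^sup>2 \<le> (n + 1)\<^sup>2"
      using bi[of i] n1 by (intro abs_le_square_iff[THEN iffD1]) auto
    have "(real (b i) - real M * (cmod (z $ i))\<^sup>2)\<^sup>2 / (cmod (z $ i))\<^sup>2 \<le> (n + 1)\<^sup>2 / (1 / (4 * n))"
      using sq zz(3)[of i] n1 by (intro frac_le) auto
    then show "exp (- ((n + 1)\<^sup>2 * (4 * n))) \<le> exp (- (real (b i) - real M * (cmod (z $ i))\<^sup>2)\<^sup>2 / (cmod (z $ i))\<^sup>2)"
      by simp
  qed simp
  then have "exp (- 2) * (\<Prod>i\<in>(UNIV :: 'n set). exp (- ((n + 1)\<^sup>2 * (4 * n))))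
    \<le> exp (- ((real M)\<^sup>2 * (1 - (norm z)\<^sup>2))) *
      (\<Prod>i\<in>UNIV. exp (- (real (b i) - real M * (cmod (z $ i))\<^sup>2)\<^sup>2 / (cmod (z $ i))\<^sup>2))"
    by (intro mult_mono e1) (auto intro!: prod_nonneg)
  also have "\<dots> \<le> (cmod (bump M b z))\<^sup>2" by (rule norm_sq_bump_ge[OF b(1) M0 znz])
  also have "\<dots> \<le> (\<Sum>b\<in>bump_indices M. (cmod (bump M b z))\<^sup>2)"
    by (rule member_le_sum[OF b(1)]) (auto simp: finite_bump_indices)
  also have "exp (- 2) * (\<Prod>i\<in>(UNIV :: 'n set). exp (- ((n + 1)\<^sup>2 * (4 * n)))) = exp (- (2 + n * ((n + 1)\<^sup>2 * (4 * n))))"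
    by (simp add: exp_of_nat_mult[symmetric] n_def exp_add[symmetric])
  finally show ?thesis by (simp add: n_def M_def)
qed

text \<open>
  A truncated cone around the points whose coordinates have equal moduli. It is scaled by dilations,
  which gives its volume as a function of \<open>\<rho>\<close>; shells contain differences of two such cones.
\<close>

definition diagonal_cone :: "real \<Rightarrow> (complex ^ 'n) set" where
  "diagonal_cone \<rho> = {z. norm z < \<rho> \<and> (\<forall>i. (norm z)\<^sup>2 < 2 * real CARD('n) * (cmod (z $ i))\<^sup>2)}"

lemma open_diagonal_cone: "open (diagonal_cone \<rho> :: (complex ^ 'n) set)"
proof -
  have "open {z :: complex ^ 'n. norm z < \<rho>}"
    by (intro open_Collect_less continuous_intros)
  moreover have "open (\<Inter>i. {z :: complex ^ 'n. (norm z)\<^sup>2 < 2 * real CARD('n) * (cmod (z $ i))\<^sup>2})"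
    by (intro open_INT ballI open_Collect_less continuous_intros) simp
  moreover have "(\<Inter>i. {z :: complex ^ 'n. (norm z)\<^sup>2 < 2 * real CARD('n) * (cmod (z $ i))\<^sup>2})
      = {z. \<forall>i. (norm z)\<^sup>2 < 2 * real CARD('n) * (cmod (z $ i))\<^sup>2}" by auto
  ultimately show ?thesis unfolding diagonal_cone_def Collect_conj_eq by (simp only: open_Int)
qed

lemma emeasure_diagonal_cone:
  assumes \<rho>: "0 < \<rho>"
  shows "emeasure lborel (diagonal_cone \<rho> :: (complex ^ 'n) set) = ennreal ((\<rho>\<^sup>2) ^ CARD('n)) * emeasure lborel (diagonal_cone 1 :: (complex ^ 'n) set)"
proof -
  have [measurable]: "(diagonal_cone \<rho> :: (complex ^ 'n) set) \<in> sets borel" by (intro borel_open open_diagonal_cone)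
  have mem: "(\<chi> i. \<rho> *\<^sub>R w $ i) \<in> diagonal_cone \<rho> \<longleftrightarrow> w \<in> diagonal_cone 1" for w :: "complex ^ 'n"
  proof -
    have e: "(\<chi> i. \<rho> *\<^sub>R w $ i) = \<rho> *\<^sub>R w" by (simp add: vec_eq_iff)
    show ?thesis
      unfolding e diagonal_cone_def using \<rho>
      by (simp add: norm_mult power_mult_distrib mult.left_commute[of _ "\<rho>\<^sup>2"] mult.assoc)
  qed
  have "emeasure lborel (diagonal_cone \<rho> :: (complex ^ 'n) set) = (\<integral>\<^sup>+z. indicator (diagonal_cone \<rho> :: (complex ^ 'n) set) z \<partial>lborel)"
    by simp
  also have "\<dots> = ennreal ((\<Prod>i\<in>(UNIV :: 'n set). \<rho>)\<^sup>2) * (\<integral>\<^sup>+w. indicator (diagonal_cone \<rho> :: (complex ^ 'n) set) (0 + (\<chi> i. \<rho> *\<^sub>R w $ i)) \<partial>lborel)"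
    by (rule nn_integral_diag_affine[OF \<rho>]) simp
  also have "(\<integral>\<^sup>+w. indicator (diagonal_cone \<rho> :: (complex ^ 'n) set) (0 + (\<chi> i. \<rho> *\<^sub>R w $ i)) \<partial>lborel)
      = (\<integral>\<^sup>+w. indicator (diagonal_cone 1 :: (complex ^ 'n) set) w \<partial>lborel)"
    by (intro nn_integral_cong) (simp add: mem indicator_def)
  also have "\<dots> = emeasure lborel (diagonal_cone 1 :: (complex ^ 'n) set)"
    by (simp add: borel_open open_diagonal_cone)
  also have "(\<Prod>i\<in>(UNIV :: 'n set). \<rho>)\<^sup>2 = (\<rho>\<^sup>2) ^ CARD('n)"
    by (simp add: power_mult[symmetric] mult.commute)
  finally show ?thesis .
qed

lemma emeasure_diagonal_cone_finite: "emeasure lborel (diagonal_cone \<rho> :: (complex ^ 'n) set) < \<infinity>"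
proof -
  have "emeasure lborel (diagonal_cone \<rho> :: (complex ^ 'n) set) \<le> emeasure lborel (ball 0 \<rho> :: (complex ^ 'n) set)"
    by (intro emeasure_mono) (auto simp: diagonal_cone_def)
  also have "\<dots> < \<infinity>" by (rule emeasure_lborel_ball_finite)
  finally show ?thesis .
qed

lemma measure_diagonal_cone_pos: "0 < measure lborel (diagonal_cone 1 :: (complex ^ 'n) set)"
proof -
  define n where "n = real CARD('n)"
  have n1: "1 \<le> n" using zero_less_card_finite[where 'a='n] unfolding n_def by linarith
  \<comment> \<open>an interior point: all coordinates equal, \<open>|z|\<^sup>2 = 1 / (4 n)\<close>\<close>
  define z :: "complex ^ 'n" where "z = (\<chi> i. of_real (1 / (2 * n)))"
  have zi: "(cmod (z $ i))\<^sup>2 = (1 / (2 * n))\<^sup>2" for i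
    using n1 by (simp add: z_def norm_divide)
  have "(norm z)\<^sup>2 = n * (1 / (2 * n))\<^sup>2" unfolding norm_sq_vec zi by (simp add: n_def)
  also have "\<dots> = 1 / (4 * n)" using n1 by (simp add: power2_eq_square field_simps)
  finally have nz: "(norm z)\<^sup>2 = 1 / (4 * n)" .
  have "1 / (4 * n) < 2 * n * (1 / (2 * n))\<^sup>2" using n1 by (simp add: power2_eq_square field_simps)
  moreover have "norm z < 1"
  proof -
    have "(norm z)\<^sup>2 < 1" unfolding nz using n1 by simp
    then show ?thesis by (simp add: abs_square_less_1)
  qed
  ultimately have "z \<in> diagonal_cone 1" by (simp add: diagonal_cone_def nz zi flip: n_def)
  then obtain e where e: "e > 0" "ball z e \<subseteq> diagonal_cone 1" using open_diagonal_cone openE by blast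
  have "0 < measure lborel (ball z e)" using e by simp
  also have "\<dots> \<le> measure lborel (diagonal_cone 1 :: (complex ^ 'n) set)"
    using emeasure_diagonal_cone_finite[of 1] e
    by (intro measure_mono_fmeasurable) (auto simp: fmeasurable_def borel_open open_diagonal_cone)
  finally show ?thesis .
qed

lemma measure_diagonal_cone:
  assumes "0 < \<rho>"
  shows "measure lborel (diagonal_cone \<rho> :: (complex ^ 'n) set) = (\<rho>\<^sup>2) ^ CARD('n) * measure lborel (diagonal_cone 1 :: (complex ^ 'n) set)"
  unfolding measure_def emeasure_diagonal_cone[OF assms] enn2real_mult by simp

lemma shell_borel [measurable]: "(shell k :: (complex ^ 'n) set) \<in> sets borel"
proof -
  have "closed {z :: complex ^ 'n. 1 - 2 / 4 ^ k \<le> (norm z)\<^sup>2}"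
    "closed {z :: complex ^ 'n. (norm z)\<^sup>2 \<le> 1 - 1 / 4 ^ k}"
    "closed {z :: complex ^ 'n. \<forall>i. 1 / (4 * real CARD('n)) \<le> (cmod (z $ i))\<^sup>2}"
    by (intro closed_Collect_all closed_Collect_le continuous_intros)+
  then show ?thesis unfolding shell_def Collect_conj_eq by (intro borel_closed closed_Int)
qed

lemma shell_subset: "shell k \<subseteq> ball 0 1"
proof
  fix z :: "complex ^ 'n" assume "z \<in> shell k"
  then have "(norm z)\<^sup>2 \<le> 1 - 1 / 4 ^ k" by (simp add: shell_def)
  also have "\<dots> < 1" by simp
  finally show "z \<in> ball 0 1" by (simp add: abs_square_less_1)
qed

lemma emeasure_shell_finite: "emeasure lborel (shell k :: (complex ^ 'n) set) < \<infinity>"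
proof -
  have "emeasure lborel (shell k :: (complex ^ 'n) set) \<le> emeasure lborel (ball 0 1 :: (complex ^ 'n) set)"
    by (intro emeasure_mono shell_subset) simp
  also have "\<dots> < \<infinity>" by (rule emeasure_lborel_ball_finite)
  finally show ?thesis .
qed

lemma measure_shell_ge:
  assumes k: "1 \<le> k"
  shows "(1/2) ^ CARD('n) * measure lborel (diagonal_cone 1 :: (complex ^ 'n) set) / 4 ^ k
    \<le> measure lborel (shell k :: (complex ^ 'n) set)"
proof -
  define n where "n = CARD('n)"
  have n1: "1 \<le> n" using zero_less_card_finite[where 'a='n] unfolding n_def by linarith
  define x where "x = 1 / (4::real) ^ k"
  have "(4::real) ^ 1 \<le> 4 ^ k" using k by (intro power_increasing) auto
  then have x: "0 < x" "x \<le> 1/4" by (auto simp: x_def field_simps)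
  define r1 where "r1 = sqrt (1 - 2 * x)"
  define r2 where "r2 = sqrt (1 - x)"
  have r: "0 < r1" "r1 \<le> r2" "r1\<^sup>2 = 1 - 2 * x" "r2\<^sup>2 = 1 - x" using x by (auto simp: r1_def r2_def)
  have sub: "(diagonal_cone r1 :: (complex ^ 'n) set) \<subseteq> diagonal_cone r2" using r by (auto simp: diagonal_cone_def)
  have diff: "(diagonal_cone r2 - diagonal_cone r1 :: (complex ^ 'n) set) \<subseteq> shell k"
  proof
    fix z :: "complex ^ 'n" assume z: "z \<in> diagonal_cone r2 - diagonal_cone r1"
    then have z': "norm z < r2" "r1 \<le> norm z" "\<And>i. (norm z)\<^sup>2 < 2 * real n * (cmod (z $ i))\<^sup>2"
      by (auto simp: diagonal_cone_def n_def)
    have a: "(norm z)\<^sup>2 \<le> 1 - x" using power_mono[of "norm z" r2 2] z' r by simp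
    have b: "1 - 2 * x \<le> (norm z)\<^sup>2" using power_mono[of r1 "norm z" 2] z' r by simp
    have "1 / (4 * real n) \<le> (cmod (z $ i))\<^sup>2" for i
    proof -
      have "1 / 2 < 2 * real n * (cmod (z $ i))\<^sup>2" using b x z'(3)[of i] by linarith
      then show ?thesis using n1 by (simp add: field_simps)
    qed
    then show "z \<in> shell k" using a b by (simp add: shell_def x_def n_def)
  qed
  define v where "v = measure lborel (diagonal_cone 1 :: (complex ^ 'n) set)"
  have v: "0 < v" by (simp add: v_def measure_diagonal_cone_pos)
  have "(1/2) ^ n * v * x \<le> ((1 - x) ^ n - (1 - 2 * x) ^ n) * v"
  proof -
    obtain m where m: "n = Suc m" using n1 by (cases n) auto
    have "x * (1 - 2 * x) ^ m \<le> (1 - x) * (1 - x) ^ m - (1 - 2 * x) * (1 - 2 * x) ^ m"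
    proof -
      have "(1 - x) * (1 - 2 * x) ^ m \<le> (1 - x) * (1 - x) ^ m"
        using x by (intro mult_left_mono power_mono) auto
      then show ?thesis by (simp add: algebra_simps)
    qed
    moreover have "(1/2) ^ n \<le> (1 - 2 * x) ^ m"
    proof -
      have "(1/2::real) ^ n \<le> (1/2) ^ m" using m by simp
      also have "\<dots> \<le> (1 - 2 * x) ^ m" using x by (intro power_mono) auto
      finally show ?thesis .
    qed
    then have "x * (1/2) ^ n \<le> x * (1 - 2 * x) ^ m" using x by (intro mult_left_mono) auto
    ultimately have "x * (1/2) ^ n \<le> (1 - x) ^ n - (1 - 2 * x) ^ n" unfolding m power_Suc by linarith
    then have "x * (1/2) ^ n * v \<le> ((1 - x) ^ n - (1 - 2 * x) ^ n) * v" using v by (intro mult_right_mono) auto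
    then show ?thesis by (simp only: mult_ac)
  qed
  also have "\<dots> = measure lborel (diagonal_cone r2 :: (complex ^ 'n) set) - measure lborel (diagonal_cone r1 :: (complex ^ 'n) set)"
    unfolding measure_diagonal_cone[OF r(1)] measure_diagonal_cone[OF less_le_trans[OF r(1,2)]] r(3,4)
    by (simp only: n_def v_def left_diff_distrib)
  also have "\<dots> = measure lborel (diagonal_cone r2 - diagonal_cone r1 :: (complex ^ 'n) set)"
    using emeasure_diagonal_cone_finite[of r2] sub
    by (intro measure_Diff[symmetric]) (auto simp: borel_open open_diagonal_cone less_top)
  also have "\<dots> \<le> measure lborel (shell k :: (complex ^ 'n) set)"
    using emeasure_shell_finite[of k] diff
    by (intro measure_mono_fmeasurable) (auto simp: fmeasurable_def borel_open open_diagonal_cone)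
  finally show ?thesis by (simp add: n_def v_def x_def)
qed

section \<open>Divergence of the weighted integral of the lacunary series\<close>

text \<open>
  The monomials in all blocks are pairwise different: the degree \<open>4\<^sup>k\<close> determines the block, and the
  exponents determine the index within the block.
\<close>

lemma integral_norm_sq_lacunary_partial:
  fixes \<phi> :: "complex ^ 'n \<Rightarrow> real"
  assumes int: "integrable lborel \<phi>"
    and inv: "\<And>z w. (\<And>i. cmod (z $ i) = cmod (w $ i)) \<Longrightarrow> \<phi> z = \<phi> w"
    and supp: "\<And>z. norm z > 1 \<Longrightarrow> \<phi> z = 0"
  shows "(LINT z|lborel. \<phi> z * (cmod (lacunary_partial q L z))\<^sup>2)
    = (\<Sum>k<L. ((4 ^ k) powr q)\<^sup>2 * (\<Sum>b\<in>bump_indices (2 ^ k). LINT z|lborel. \<phi> z * (cmod (bump (2 ^ k) b z))\<^sup>2))"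
proof -
  let ?X = "Sigma {..<L} (\<lambda>k. bump_indices (2 ^ k)) :: (nat \<times> ('n \<Rightarrow> nat)) set"
  define c where "c = (\<lambda>x :: nat \<times> ('n \<Rightarrow> nat). (4 ^ fst x) powr q * bump_coeff (2 ^ fst x) (snd x))"
  define \<alpha> where "\<alpha> = (\<lambda>x :: nat \<times> ('n \<Rightarrow> nat). \<lambda>i. 2 ^ fst x * snd x i)"
  have fin: "finite ?X" by (intro finite_SigmaI) (auto simp: finite_bump_indices)
  have deg: "(\<Sum>i\<in>UNIV. \<alpha> x i) = 4 ^ fst x" if "x \<in> ?X" for x
  proof -
    have "(\<Sum>i\<in>UNIV. \<alpha> x i) = 2 ^ fst x * 2 ^ fst x"
      using that by (auto simp: \<alpha>_def sum_distrib_left[symmetric] bump_indices_def)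
    also have "\<dots> = (2 * 2) ^ fst x" by (simp only: power_mult_distrib)
    finally show ?thesis by simp
  qed
  have inj: "inj_on \<alpha> ?X"
  proof (rule inj_onI)
    fix x y assume xy: "x \<in> ?X" "y \<in> ?X" "\<alpha> x = \<alpha> y"
    have "(4::nat) ^ fst x = 4 ^ fst y" using deg[OF xy(1)] deg[OF xy(2)] xy(3) by simp
    then have f: "fst x = fst y" by simp
    have "snd x i = snd y i" for i
      using fun_cong[OF xy(3), of i] f by (simp add: \<alpha>_def)
    then show "x = y" using f by (simp add: prod_eq_iff fun_eq_iff)
  qed
  have part: "lacunary_partial q L z = (\<Sum>x\<in>?X. of_real (c x) * monomial (\<alpha> x) z)" for z
  proof -
    have "lacunary_partial q L z = (\<Sum>k<L. \<Sum>b\<in>bump_indices (2 ^ k). of_real (c (k, b)) * monomial (\<alpha> (k, b)) z)"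
      by (simp add: lacunary_partial_def bump_sum_def bump_def c_def \<alpha>_def sum_distrib_left mult.assoc)
    also have "\<dots> = (\<Sum>x\<in>?X. of_real (c x) * monomial (\<alpha> x) z)"
      by (subst sum.Sigma) (auto simp: finite_bump_indices split_def)
    finally show ?thesis .
  qed
  have "(LINT z|lborel. \<phi> z * (cmod (lacunary_partial q L z))\<^sup>2)
     = (\<Sum>x\<in>?X. (c x)\<^sup>2 * (LINT z|lborel. \<phi> z * (cmod (monomial (\<alpha> x) z))\<^sup>2))"
    unfolding part by (rule integral_norm_sq_monomial_sum[OF int inv supp fin inj])
  also have "\<dots> = (\<Sum>k<L. \<Sum>b\<in>bump_indices (2 ^ k). (c (k, b))\<^sup>2 * (LINT z|lborel. \<phi> z * (cmod (monomial (\<alpha> (k, b)) z))\<^sup>2))"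
    by (subst sum.Sigma) (auto simp: finite_bump_indices split_def)
  also have "\<dots> = (\<Sum>k<L. ((4 ^ k) powr q)\<^sup>2 * (\<Sum>b\<in>bump_indices (2 ^ k). LINT z|lborel. \<phi> z * (cmod (bump (2 ^ k) b z))\<^sup>2))"
  proof (intro sum.cong refl)
    fix k
    show "(\<Sum>b\<in>bump_indices (2 ^ k). (c (k, b))\<^sup>2 * (LINT z|lborel. \<phi> z * (cmod (monomial (\<alpha> (k, b)) z))\<^sup>2))
       = ((4 ^ k) powr q)\<^sup>2 * (\<Sum>b\<in>bump_indices (2 ^ k). LINT z|lborel. \<phi> z * (cmod (bump (2 ^ k) b z))\<^sup>2)"
      unfolding sum_distrib_left
    proof (intro sum.cong refl)
      fix b :: "'n \<Rightarrow> nat"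
      have "(LINT z|lborel. \<phi> z * (cmod (bump (2 ^ k) b z))\<^sup>2)
        = (LINT z|lborel. (bump_coeff (2 ^ k) b)\<^sup>2 * (\<phi> z * (cmod (monomial (\<alpha> (k, b)) z))\<^sup>2))"
        by (intro Bochner_Integration.integral_cong) (simp_all add: bump_def norm_mult power_mult_distrib \<alpha>_def)
      also have "\<dots> = (bump_coeff (2 ^ k) b)\<^sup>2 * (LINT z|lborel. \<phi> z * (cmod (monomial (\<alpha> (k, b)) z))\<^sup>2)"
        by (rule integral_mult_right_zero)
      finally show "(c (k, b))\<^sup>2 * (LINT z|lborel. \<phi> z * (cmod (monomial (\<alpha> (k, b)) z))\<^sup>2)
        = ((4 ^ k) powr q)\<^sup>2 * (LINT z|lborel. \<phi> z * (cmod (bump (2 ^ k) b z))\<^sup>2)"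
        by (simp add: c_def power_mult_distrib)
    qed
  qed
  finally show ?thesis .
qed

text \<open>
  On a ball of radius \<open>r < 1\<close> the series converges uniformly, so the orthogonality of the blocks
  passes from the partial sums to \<open>f\<close>. If \<open>r\<^sup>2 = 1 - 4\<^bsup>-(K+1)\<^esup>\<close>, this ball contains the shells for
  \<open>1 \<le> k \<le> K\<close>. The \<open>k\<close>-th block contributes at least a constant multiple of
  \<open>4\<^bsup>2kq\<^esup> 4\<^bsup>-kp\<^esup> 4\<^bsup>-k\<^esup> = 1\<close>: the squared coefficient, the weight on the shell and the volume of the shell.
\<close>

theorem lacunary_energy_infinite:
  fixes p :: real
  assumes p: "0 < p"
  shows "energy p (lacunary ((p + 1) / 2) :: complex ^ 'n \<Rightarrow> complex) 0 = \<infinity>"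
proof -
  define q where "q = (p + 1) / 2"
  have q: "0 < q" using p by (simp add: q_def)
  let ?f = "lacunary q :: complex ^ 'n \<Rightarrow> complex"
  define c0 where "c0 = exp (- (2 + real CARD('n) * ((real CARD('n) + 1)\<^sup>2 * (4 * real CARD('n)))))"
  define c1 where "c1 = (1/2) ^ CARD('n) * measure lborel (diagonal_cone 1 :: (complex ^ 'n) set)"
  have c: "0 < c0" "0 < c1" by (simp_all add: c0_def c1_def measure_diagonal_cone_pos)
  have main: "ennreal (real K * (c0 * c1)) \<le> energy p ?f 0" for K :: nat
  proof -
    define r where "r = sqrt (1 - 1 / 4 ^ Suc K)"
    have x: "0 < 1 / (4::real) ^ Suc K" "1 / (4::real) ^ Suc K \<le> 1"
      by (simp_all del: power_Suc)
    have r: "0 \<le> r" "r < 1" "r\<^sup>2 = 1 - 1 / 4 ^ Suc K"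
      unfolding r_def using x by (simp_all del: power_Suc)
    define \<phi> where "\<phi> = (\<lambda>z :: complex ^ 'n. indicator (cball 0 r) z * (1 - (norm z)\<^sup>2) powr p)"
    have \<phi>0: "0 \<le> \<phi> z" for z by (simp add: \<phi>_def)
    have [measurable]: "cball 0 r \<in> sets (borel :: (complex ^ 'n) measure)" by (intro borel_closed closed_cball)
    have [measurable]: "\<phi> \<in> borel_measurable borel" unfolding \<phi>_def by measurable
    have \<phi>out: "\<phi> z = 0" if "r < norm z" for z using that by (simp add: \<phi>_def)
    have \<phi>le: "\<phi> z \<le> indicator (cball 0 r) z" for z
      using p r by (auto simp: \<phi>_def indicator_def power_le_one intro!: powr_le1)
    have int: "integrable lborel \<phi>"
    proof (rule Bochner_Integration.integrable_bound)
      show "integrable lborel (indicator (cball 0 r) :: complex ^ 'n \<Rightarrow> real)"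
        by (intro integrable_real_indicator) (use emeasure_lborel_cball_finite in \<open>auto simp: less_top\<close>)
      show "AE z in lborel. norm (\<phi> z) \<le> norm (indicator (cball 0 r) z :: real)"
        using \<phi>le \<phi>0 by (auto simp: abs_of_nonneg)
    qed simp
    have inv: "\<phi> z = \<phi> w" if "\<And>i. cmod (z $ i) = cmod (w $ i)" for z w :: "complex ^ 'n"
    proof -
      have "(norm z)\<^sup>2 = (norm w)\<^sup>2" unfolding norm_sq_vec by (simp add: that)
      then have "norm z = norm w" by simp
      then show ?thesis by (simp add: \<phi>_def indicator_def)
    qed
    have supp: "\<phi> z = 0" if "norm z > 1" for z using that r by (intro \<phi>out) linarith
    define B where "B = lacunary_const q CARD('n) * (1 - r\<^sup>2) powr (- q)"
    have meas: "(\<lambda>z. \<phi> z * (cmod (lacunary_partial q L z))\<^sup>2) \<in> borel_measurable lborel" for L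
    proof -
      have "lacunary_partial q L \<in> borel_measurable (borel :: (complex ^ 'n) measure)"
        by (intro borel_measurable_continuous_onI cn_holomorphic_imp_continuous cn_holomorphic_lacunary_partial)
      then show ?thesis by measurable
    qed
    have lim: "(\<lambda>L. \<phi> z * (cmod (lacunary_partial q L z))\<^sup>2) \<longlonglongrightarrow> \<phi> z * (cmod (?f z))\<^sup>2" for z
    proof (cases "norm z \<le> r")
      case True
      then show ?thesis
        by (intro tendsto_intros tendsto_uniform_limitI[OF uniform_limit_lacunary[OF q r(2)]]) simp
    qed (simp add: \<phi>out)
    have bound: "norm (\<phi> z * (cmod (lacunary_partial q L z))\<^sup>2) \<le> B\<^sup>2 * \<phi> z" for z L
    proof (cases "norm z \<le> r")
      case True
      have "(cmod (lacunary_partial q L z))\<^sup>2 \<le> B\<^sup>2"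
        unfolding B_def by (intro power_mono norm_lacunary_partial_le q True r) simp
      then show ?thesis using \<phi>0[of z] by (simp add: mult.commute[of "B\<^sup>2"] mult_left_mono)
    qed (simp add: \<phi>out)
    have measf: "(\<lambda>z. \<phi> z * (cmod (?f z))\<^sup>2) \<in> borel_measurable lborel"
      by (rule borel_measurable_LIMSEQ_real[OF lim meas])
    have intw: "integrable lborel (\<lambda>z. B\<^sup>2 * \<phi> z)" using int by simp
    have conv: "(\<lambda>L. LINT z|lborel. \<phi> z * (cmod (lacunary_partial q L z))\<^sup>2) \<longlonglongrightarrow> (LINT z|lborel. \<phi> z * (cmod (?f z))\<^sup>2)"
      by (rule integral_dominated_convergence[OF measf meas intw]) (use lim bound in auto)
    have intf: "integrable lborel (\<lambda>z. \<phi> z * (cmod (?f z))\<^sup>2)"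
      by (rule integrable_dominated_convergence[where s="\<lambda>L z. \<phi> z * (cmod (lacunary_partial q L z))\<^sup>2", OF measf meas intw]) (use lim bound in auto)
    have intb: "integrable lborel (\<lambda>z. \<phi> z * (cmod (bump M b z))\<^sup>2)" for M and b :: "'n \<Rightarrow> nat"
    proof (rule Bochner_Integration.integrable_bound)
      show "integrable lborel (\<lambda>z. (bump_coeff M b)\<^sup>2 * \<phi> z)" using int by simp
      show "(\<lambda>z. \<phi> z * (cmod (bump M b z))\<^sup>2) \<in> borel_measurable lborel"
        unfolding bump_def by measurable
      have "norm (\<phi> z * (cmod (bump M b z))\<^sup>2) \<le> norm ((bump_coeff M b)\<^sup>2 * \<phi> z)" for z
      proof (cases "norm z \<le> 1")
        case True
        have "(cmod (monomial (\<lambda>i. M * b i) z))\<^sup>2 \<le> 1"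
          by (intro power_le_one norm_monomial_le_1 True) simp
        then have "(bump_coeff M b)\<^sup>2 * (cmod (monomial (\<lambda>i. M * b i) z))\<^sup>2 \<le> (bump_coeff M b)\<^sup>2"
          by (intro mult_left_le) auto
        then have "\<phi> z * ((bump_coeff M b)\<^sup>2 * (cmod (monomial (\<lambda>i. M * b i) z))\<^sup>2) \<le> \<phi> z * (bump_coeff M b)\<^sup>2"
          by (intro mult_left_mono \<phi>0)
        then show ?thesis using \<phi>0[of z] by (simp add: bump_def norm_mult power_mult_distrib mult.commute)
      qed (simp add: supp)
      then show "AE z in lborel. norm (\<phi> z * (cmod (bump M b z))\<^sup>2) \<le> norm ((bump_coeff M b)\<^sup>2 * \<phi> z)" by simp
    qed
    have block: "c0 * c1 \<le> ((4 ^ k) powr q)\<^sup>2 * (\<Sum>b\<in>bump_indices (2 ^ k). LINT z|lborel. \<phi> z * (cmod (bump (2 ^ k) b z))\<^sup>2)"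
      if k: "1 \<le> k" "k \<le> K" for k
    proof -
      define N where "N = (4::real) ^ k"
      have N: "N > 0" by (simp add: N_def)
      have "(1 / N) powr p * c0 * (c1 / N) \<le> (1 / N) powr p * c0 * measure lborel (shell k :: (complex ^ 'n) set)"
        using measure_shell_ge[OF k(1), where 'n='n] c by (intro mult_left_mono) (auto simp: c1_def N_def)
      also have "\<dots> = (LINT z|lborel. (1 / N) powr p * c0 * indicator (shell k :: (complex ^ 'n) set) z)"
        by simp
      also have "\<dots> \<le> (LINT z|lborel. (\<Sum>b\<in>bump_indices (2 ^ k). \<phi> z * (cmod (bump (2 ^ k) b z))\<^sup>2))"
      proof (rule integral_mono)
        show "integrable lborel (\<lambda>z. (1 / N) powr p * c0 * indicator (shell k :: (complex ^ 'n) set) z)"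
          using emeasure_shell_finite[of k, where 'n='n]
          by (intro integrable_mult_right integrable_real_indicator) auto
        show "integrable lborel (\<lambda>z. \<Sum>b\<in>bump_indices (2 ^ k). \<phi> z * (cmod (bump (2 ^ k) b z))\<^sup>2)"
          by (intro Bochner_Integration.integrable_sum intb)
        fix z :: "complex ^ 'n"
        show "(1 / N) powr p * c0 * indicator (shell k) z \<le> (\<Sum>b\<in>bump_indices (2 ^ k). \<phi> z * (cmod (bump (2 ^ k) b z))\<^sup>2)"
        proof (cases "z \<in> shell k")
          case True
          have sh: "1 / N \<le> 1 - (norm z)\<^sup>2" using True by (simp add: shell_def N_def)
          have "1 / (4::real) ^ Suc K \<le> 1 / N"
            unfolding N_def using k by (intro divide_left_mono power_increasing) auto
          then have "(norm z)\<^sup>2 \<le> r\<^sup>2" using sh r(3) by linarith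
          then have zr: "norm z \<le> r" using r(1) by (rule power2_le_imp_le)
          have "(1 / N) powr p \<le> \<phi> z" using sh zr N p by (simp add: \<phi>_def powr_mono2)
          then have "(1 / N) powr p * c0 \<le> \<phi> z * (\<Sum>b\<in>bump_indices (2 ^ k). (cmod (bump (2 ^ k) b z))\<^sup>2)"
            unfolding c0_def by (intro mult_mono sum_norm_sq_bump_ge[OF True k(1)]) (auto intro: \<phi>0)
          then show ?thesis using True by (simp add: sum_distrib_left)
        next
          case False
          then show ?thesis using \<phi>0 by (simp add: sum_nonneg)
        qed
      qed
      also have "\<dots> = (\<Sum>b\<in>bump_indices (2 ^ k). LINT z|lborel. \<phi> z * (cmod (bump (2 ^ k) b z))\<^sup>2)"
        by (intro Bochner_Integration.integral_sum intb)
      finally have "(N powr q)\<^sup>2 * ((1 / N) powr p * c0 * (c1 / N))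
        \<le> (N powr q)\<^sup>2 * (\<Sum>b\<in>bump_indices (2 ^ k). LINT z|lborel. \<phi> z * (cmod (bump (2 ^ k) b z))\<^sup>2)"
        by (intro mult_left_mono) auto
      moreover have "(N powr q)\<^sup>2 = N powr p * N"
      proof -
        have "(N powr q)\<^sup>2 = N powr (p + 1)" using N by (simp add: powr_power q_def add_divide_distrib)
        also have "\<dots> = N powr p * N" using N by (simp add: powr_add)
        finally show ?thesis .
      qed
      moreover have "(1 / N) powr p = 1 / N powr p" using N by (simp add: powr_divide)
      ultimately show ?thesis using N by (simp add: N_def[symmetric])
    qed
    have nonneg: "0 \<le> ((4 ^ k) powr q)\<^sup>2 * (\<Sum>b\<in>bump_indices (2 ^ k). LINT z|lborel. \<phi> z * (cmod (bump (2 ^ k) b z))\<^sup>2)" for k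
      using \<phi>0 by (intro mult_nonneg_nonneg sum_nonneg integral_nonneg) auto
    have "real K * (c0 * c1) \<le> (LINT z|lborel. \<phi> z * (cmod (lacunary_partial q L z))\<^sup>2)" if L: "L \<ge> Suc K" for L
    proof -
      have "real K * (c0 * c1) = (\<Sum>k\<in>{1..K}. c0 * c1)" by simp
      also have "\<dots> \<le> (\<Sum>k\<in>{1..K}. ((4 ^ k) powr q)\<^sup>2 * (\<Sum>b\<in>bump_indices (2 ^ k). LINT z|lborel. \<phi> z * (cmod (bump (2 ^ k) b z))\<^sup>2))"
        by (intro sum_mono block) auto
      also have "\<dots> \<le> (\<Sum>k<L. ((4 ^ k) powr q)\<^sup>2 * (\<Sum>b\<in>bump_indices (2 ^ k). LINT z|lborel. \<phi> z * (cmod (bump (2 ^ k) b z))\<^sup>2))"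
        using L nonneg by (intro sum_mono2) auto
      also have "\<dots> = (LINT z|lborel. \<phi> z * (cmod (lacunary_partial q L z))\<^sup>2)"
        by (rule integral_norm_sq_lacunary_partial[OF int inv supp, symmetric])
      finally show ?thesis .
    qed
    then have "real K * (c0 * c1) \<le> (LINT z|lborel. \<phi> z * (cmod (?f z))\<^sup>2)"
      by (intro LIMSEQ_le_const[OF conv]) blast
    then have "ennreal (real K * (c0 * c1)) \<le> ennreal (LINT z|lborel. \<phi> z * (cmod (?f z))\<^sup>2)" by (rule ennreal_leI)
    also have "\<dots> = (\<integral>\<^sup>+z. ennreal (\<phi> z * (cmod (?f z))\<^sup>2) \<partial>lborel)"
      using intf \<phi>0 by (intro nn_integral_eq_integral[symmetric]) auto
    also have "\<dots> \<le> energy p ?f 0"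
      unfolding energy_def
    proof (rule nn_integral_mono)
      fix z :: "complex ^ 'n"
      show "ennreal (\<phi> z * (cmod (?f z))\<^sup>2) \<le> ennreal ((cmod (?f z))\<^sup>2 *
        mobius_kernel (0 :: complex ^ 'n) z powr p) * indicator (ball 0 1) z"
      proof (cases "norm z \<le> r")
        case True
        then show ?thesis using r by (simp add: \<phi>_def hinner_simps mult.commute)
      qed (simp add: \<phi>out)
    qed
    finally show ?thesis .
  qed
  have "energy p ?f 0 = \<infinity>"
  proof (rule ccontr)
    assume "energy p ?f 0 \<noteq> \<infinity>"
    then obtain E where E: "0 \<le> E" "energy p ?f 0 = ennreal E" by (cases "energy p ?f 0") auto
    obtain K where "E < real K * (c0 * c1)" using c reals_Archimedean3[of "c0 * c1"] by auto
    moreover have "real K * (c0 * c1) \<le> E" using main[of K] E by simp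
    ultimately show False by simp
  qed
  then show ?thesis by (simp add: q_def)
qed

section \<open>The strict inclusions\<close>

lemma lacunary_notin_Np_space:
  assumes "0 < p" "p' \<le> p"
  shows "(lacunary ((p + 1) / 2) :: complex ^ 'n \<Rightarrow> complex) \<notin> Np_space p'"
proof
  let ?f = "lacunary ((p + 1) / 2) :: complex ^ 'n \<Rightarrow> complex"
  assume f: "?f \<in> Np_space p'"
  then have "continuous_on (ball 0 1) ?f" by (simp add: Np_space_def cn_holomorphic_imp_continuous)
  then obtain C where "\<forall>a\<in>ball 0 1. energy p' ?f a \<le> ennreal C"
    using f Np_norm_finite_iff[of ?f p'] by (auto simp: Np_space_def)
  then have "energy p' ?f 0 \<le> ennreal C" by simp
  moreover have "energy p ?f 0 \<le> energy p' ?f 0" using assms by (intro energy_mono) auto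
  ultimately show False using lacunary_energy_infinite[OF assms(1), where 'n='n] by (simp add: top_unique)
qed

lemma Np_space_mono:
  assumes "p \<le> p'"
  shows "Np_space p \<subseteq> (Np_space p' :: (complex ^ 'n \<Rightarrow> complex) set)"
proof
  fix f :: "complex ^ 'n \<Rightarrow> complex" assume f: "f \<in> Np_space p"
  then have cont: "continuous_on (ball 0 1) f" by (simp add: Np_space_def cn_holomorphic_imp_continuous)
  have "\<exists>C. \<forall>a\<in>ball 0 1. energy p f a \<le> ennreal C"
    using f Np_norm_finite_iff[OF cont] by (simp add: Np_space_def)
  then obtain C where C: "\<And>a. a \<in> ball 0 1 \<Longrightarrow> energy p f a \<le> ennreal C" by blast
  have "energy p' f a \<le> ennreal C" if "a \<in> ball 0 1" for a
    using energy_mono[OF assms, of a f] C[OF that] that by (simp add: order_trans)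
  then have "Np_norm p' f < \<infinity>" unfolding Np_norm_finite_iff[OF cont] by blast
  then show "f \<in> Np_space p'" using f by (simp add: Np_space_def)
qed

theorem corollary5p2:
  fixes p1 p2 :: real
  assumes "0 < p1" and "p1 < p2" and "p2 \<le> real CARD('n::finite)"
  shows "(Np_space p1 :: (complex ^ 'n \<Rightarrow> complex) set) \<subset> Np_space p2
       \<and> (Np_space p2 :: (complex ^ 'n \<Rightarrow> complex) set) \<subset> growth_space ((real CARD('n) + 1) / 2)"
proof (intro conjI psubsetI Np_space_mono Np_space_subset_growth_space)
  show "p1 \<le> p2" "0 < p2" using assms by auto
  \<comment> \<open>with \<open>q = (p + 1) / 2\<close>, the choice \<open>p \<ge> p2 - 1\<close> means \<open>p2 - 2 q \<le> 0\<close>, and \<open>p < p2\<close> means \<open>p2 - 2 q > -1\<close>\<close>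
  define p where "p = max p1 (p2 - 1)"
  have p: "0 < p" "p1 \<le> p" "p2 - 1 \<le> p" "p < p2" using assms by (auto simp: p_def)
  have e: "2 * ((p + 1) / 2) = p + 1" by simp
  have "growth_space ((p + 1) / 2) \<subseteq> (Np_space p2 :: (complex ^ 'n \<Rightarrow> complex) set)"
  proof (rule growth_space_subset_Np_space)
    show "0 < p2" using assms by simp
    show "-1 < p2 - 2 * ((p + 1) / 2)" "p2 - 2 * ((p + 1) / 2) \<le> 0" "2 * ((p + 1) / 2) < real CARD('n) + 1"
      unfolding e using p assms by auto
  qed
  then have "(lacunary ((p + 1) / 2) :: complex ^ 'n \<Rightarrow> complex) \<in> Np_space p2"
    using lacunary_in_growth_space[of "(p + 1) / 2", where 'n='n] p by auto
  moreover have "(lacunary ((p + 1) / 2) :: complex ^ 'n \<Rightarrow> complex) \<notin> Np_space p1"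
    by (rule lacunary_notin_Np_space[OF p(1,2)])
  ultimately show "(Np_space p1 :: (complex ^ 'n \<Rightarrow> complex) set) \<noteq> Np_space p2" by blast
  have "(lacunary ((real CARD('n) + 1) / 2) :: complex ^ 'n \<Rightarrow> complex) \<in> growth_space ((real CARD('n) + 1) / 2)"
    by (rule lacunary_in_growth_space) simp
  moreover have "(lacunary ((real CARD('n) + 1) / 2) :: complex ^ 'n \<Rightarrow> complex) \<notin> Np_space p2"
    by (rule lacunary_notin_Np_space) (use assms in auto)
  ultimately show "(Np_space p2 :: (complex ^ 'n \<Rightarrow> complex) set) \<noteq> growth_space ((real CARD('n) + 1) / 2)" by blast
qed

end
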